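(* Let $\mathbb P(\mathcal S)=\bigoplus_{K\subseteq\mathbb I}\Bbbk[X_1^{\pm1},\dots,X_n^{\pm1}]^{W_K}\mathbf v^{(K)}$, where $\mathbf v^{(K)}$ is a formal copy of $\mathbf v$ indexing the summand. There is a faithful representation $\rho$ of the affine Schur algebra $\mathcal S$ on $\mathbb P(\mathcal S)$ in which, for $J,K\subseteq\mathbb I$ and $d\in D_{K,J}$, the basis element $\mathbf b^d_{K,J}$ acts by zero on the summands indexed by $J'\ne J$ and, for $f\in\Bbbk[X_1^{\pm1},\dots,X_n^{\pm1}]^{W_J}$, $$\rho(\mathbf b^d_{K,J})\,f\mathbf v^{(J)}=\sum_{a\in D^K_{\emptyset,K\cap dJ}}T_aT_d\cdot f\mathbf v^{(K)},$$ where the right-hand side is computed in the $\mathcal H$-module $\Bbbk[X_1^{\pm1},\dots,X_n^{\pm1}]\mathbf v$ and placed in the summand indexed by $K$.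
   Context: Setting: $q$ is the residue field cardinality of a finite extension of $\mathbb Q_p$, $\Bbbk$ algebraically closed of characteristic $\ne p$ with $q\ne 1$ in $\Bbbk$, $n\ge 2$. $\mathcal H$: unital $\Bbbk$-algebra generated by $T_1,\dots,T_{n-1},X_1^{\pm1},\dots,X_n^{\pm1}$ with $(T_i-q)(T_i+1)=0$, braid relations, commuting Laurent $X_j$, $T_iX_j=X_jT_i$ ($j\notin\{i,i+1\}$), $T_iX_iT_i=qX_{i+1}$. $\mathbb I=\{s_1,\dots,s_{n-1}\}\subseteq\mathfrak S_n$, $W_J=\langle J\rangle$, $T_w=T_{i_1}\cdots T_{i_r}$ for reduced $w=s_{i_1}\cdots s_{i_r}\in\mathfrak S_n$, $\mathbf v_J=\sum_{w\in W_J}T_w$. Extended affine Weyl group: $\mathrm W=\mathfrak S_n\ltimes\mathfrak X$, $\mathfrak X$ the free abelian group on $X_1,\dots,X_n$ with $wX_iw^{-1}=X_{w(i)}$. Put $s_0=s_{n-1}\cdots s_2s_1s_2\cdots s_{n-1}X_1X_n^{-1}$, $\tau=s_{n-1}\cdots s_1X_1$; every $w\in\mathrm W$ is uniquely $x\tau^j$ with $x$ in the Coxeter group generated by $s_0,\dots,s_{n-1}$, $j\in\mathbb Z$; $l(w)$ is the Coxeter length of $x$ and $T_w=T_{s_{i_1}}\cdots T_{s_{i_r}}T_\tau^j$ for a reduced $x=s_{i_1}\cdots s_{i_r}$, with $T_{s_i}=T_i$ ($i\ge1$), $T_{s_0}=q^{n-1}X_1^{-1}X_n(T_{n-1}\cdots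 T_2T_1T_2\cdots T_{n-1})^{-1}$, $T_\tau=q^{-(n-1)/2}T_{n-1}\cdots T_1X_1$. For $J,K\subseteq\mathbb I$, $D_{K,J}$ is the set of minimal-length elements of the double cosets $W_K\backslash\mathrm W/W_J$. For $w\in\mathrm W$, $\mathbf b^w_{K,J}\in\mathrm{Hom}_{\mathcal H}(\mathbf v_J\mathcal H,\mathbf v_K\mathcal H)$ is the right-module homomorphism with $\mathbf v_J\mapsto\sum_{v\in W_KwW_J}T_v$. $\mathcal S=\mathrm{End}_{\mathcal H}(\bigoplus_{J\subseteq\mathbb I}\mathbf v_J\mathcal H)$ (right modules), product = composition; the elements $\mathbf b^d_{K,J}$ ($J,K\subseteq \mathbb I$, $d\in D_{K,J}$) form a basis of $\mathcal S$. For $d\in D_{K,J}$, $K\cap dJ=\{s\in K\mid d^{-1}sd\in J\}$, and for $L\subseteq K$, $D^K_{\emptyset,L}$ is the set of minimal-length representatives of the left cosets $W_K/W_L$. $\Bbbk[X^{\pm1}]\mathbf v$ is the $\mathcal H$-module on which $X_j$ act by multiplication and $T_i\cdot f\mathbf v=qf\mathbf v-\frac{qX_i-X_{i+1}}{X_i-X_{i+1}}(f-s_i(f))\mathbf v$, where $s_i(f)$ swaps $X_i,X_{i+1}$; $W_K$ acts on Laurent polynomials by permuting variables. *)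

theory Defs
  imports "HOL-Library.Poly_Mapping" "HOL-Combinatorics.Permutations"
          "HOL-Computational_Algebra.Polynomial"
begin

type_synonym 'k laurent = "(nat \<Rightarrow>\<^sub>0 int) \<Rightarrow>\<^sub>0 'k"

definition LX :: "nat \<Rightarrow> 'k::comm_ring_1 laurent" where
  "LX j = Poly_Mapping.single (Poly_Mapping.single j 1) 1"

definition LXinv :: "nat \<Rightarrow> 'k::comm_ring_1 laurent" where
  "LXinv j = Poly_Mapping.single (Poly_Mapping.single j (-1)) 1"

definition Lsc :: "'k::comm_ring_1 \<Rightarrow> 'k laurent" where
  "Lsc c = Poly_Mapping.single 0 c"

definition laurent_set :: "nat \<Rightarrow> 'k::comm_ring_1 laurent set" where
  "laurent_set n = {f. \<forall>e\<in>Poly_Mapping.keys f. Poly_Mapping.keys e \<subseteq> {1..n}}"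

definition pexp :: "(nat \<Rightarrow> nat) \<Rightarrow> (nat \<Rightarrow>\<^sub>0 int) \<Rightarrow> (nat \<Rightarrow>\<^sub>0 int)" where
  "pexp \<sigma> e = (\<Sum>i\<in>Poly_Mapping.keys e. Poly_Mapping.single (\<sigma> i) (Poly_Mapping.lookup e i))"

definition permL :: "(nat \<Rightarrow> nat) \<Rightarrow> 'k::comm_ring_1 laurent \<Rightarrow> 'k laurent" where
  "permL \<sigma> f = (\<Sum>e\<in>Poly_Mapping.keys f. Poly_Mapping.single (pexp \<sigma> e) (Poly_Mapping.lookup f e))"

definition invariants :: "nat \<Rightarrow> (nat \<Rightarrow> nat) set \<Rightarrow> 'k::comm_ring_1 laurent set" where
  "invariants n G = {f \<in> laurent_set n. \<forall>\<sigma>\<in>G. permL \<sigma> f = f}"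

definition sw :: "nat \<Rightarrow> nat \<Rightarrow> nat" where
  "sw i k = (if k = i then Suc i else if k = Suc i then i else k)"

text \<open>A pair (sigma, lambda) stands for the element sigma X^lambda of S_n \<ltimes> X,
  where w X_i w^-1 = X_(w i).  Hence (s,l)(t,m) = (s o t, l o t + m).\<close>
type_synonym waff = "(nat \<Rightarrow> nat) \<times> (nat \<Rightarrow> int)"

definition wmul :: "waff \<Rightarrow> waff \<Rightarrow> waff" where
  "wmul a b = (fst a \<circ> fst b, \<lambda>i. snd a (fst b i) + snd b i)"

definition wone :: waff where "wone = (id, \<lambda>_. 0)"

definition winv :: "waff \<Rightarrow> waff" where
  "winv a = (inv (fst a), \<lambda>i. - snd a (inv (fst a) i))"

definition wpow :: "waff \<Rightarrow> int \<Rightarrow> waff" where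
  "wpow w j = (if 0 \<le> j then (wmul w ^^ nat j) wone else (wmul (winv w) ^^ nat (-j)) wone)"

definition Wset :: "nat \<Rightarrow> waff set" where
  "Wset n = {w. fst w permutes {1..n} \<and> (\<forall>i. i \<notin> {1..n} \<longrightarrow> snd w i = 0)}"

definition ex :: "nat \<Rightarrow> nat \<Rightarrow> int" where "ex i k = (if k = i then 1 else 0)"

definition sfin :: "nat \<Rightarrow> waff" where "sfin i = (sw i, \<lambda>_. 0)"

definition wprodS :: "nat list \<Rightarrow> waff" where
  "wprodS is = foldr (\<lambda>i w. wmul (sfin i) w) is wone"

definition s0 :: "nat \<Rightarrow> waff" where
  "s0 n = wmul (wprodS (rev [2..<n] @ [1] @ [2..<n])) (id, \<lambda>k. ex 1 k - ex n k)"

definition tau :: "nat \<Rightarrow> waff" where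
  "tau n = wmul (wprodS (rev [1..<n])) (id, ex 1)"

definition sgen :: "nat \<Rightarrow> nat \<Rightarrow> waff" where
  "sgen n i = (if i = 0 then s0 n else sfin i)"

definition wprodA :: "nat \<Rightarrow> nat list \<Rightarrow> waff" where
  "wprodA n is = foldr (\<lambda>i w. wmul (sgen n i) w) is wone"

definition lenW :: "nat \<Rightarrow> waff \<Rightarrow> nat" where
  "lenW n w = (LEAST r. \<exists>is j. length is = r \<and> set is \<subseteq> {..<n} \<and>
                               w = wmul (wprodA n is) (wpow (tau n) j))"

definition WK :: "nat set \<Rightarrow> waff set" where
  "WK K = {wprodS is | is. set is \<subseteq> K}"

definition Dset :: "nat \<Rightarrow> nat set \<Rightarrow> nat set \<Rightarrow> waff set" where
  "Dset n K J = {d \<in> Wset n. \<forall>u\<in>WK K. \<forall>v\<in>WK J. lenW n d \<le> lenW n (wmul (wmul u d) v)}"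

definition Dleft :: "nat \<Rightarrow> nat set \<Rightarrow> nat set \<Rightarrow> waff set" where
  "Dleft n K L = {a \<in> WK K. \<forall>v\<in>WK L. lenW n a \<le> lenW n (wmul a v)}"

definition capd :: "nat set \<Rightarrow> waff \<Rightarrow> nat set \<Rightarrow> nat set" where
  "capd K d J = {k \<in> K. \<exists>j\<in>J. wmul (wmul (winv d) (sfin k)) d = sfin j}"

datatype hgen = GT nat | GX nat | GXi nat

type_synonym 'k falg = "hgen list \<Rightarrow>\<^sub>0 'k"

definition fmul :: "'k::comm_ring_1 falg \<Rightarrow> 'k falg \<Rightarrow> 'k falg" where
  "fmul f g = (\<Sum>u\<in>Poly_Mapping.keys f. \<Sum>v\<in>Poly_Mapping.keys g.
                 Poly_Mapping.single (u @ v) (Poly_Mapping.lookup f u * Poly_Mapping.lookup g v))"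

definition fsc :: "'k::comm_ring_1 \<Rightarrow> 'k falg" where "fsc c = Poly_Mapping.single [] c"

definition fgen :: "hgen \<Rightarrow> 'k::comm_ring_1 falg" where "fgen g = Poly_Mapping.single [g] 1"

definition fprod :: "'k::comm_ring_1 falg list \<Rightarrow> 'k falg" where
  "fprod xs = foldr fmul xs (fsc 1)"

definition valid_gen :: "nat \<Rightarrow> hgen \<Rightarrow> bool" where
  "valid_gen n g = (case g of GT i \<Rightarrow> 1 \<le> i \<and> i < n | GX j \<Rightarrow> 1 \<le> j \<and> j \<le> n
                              | GXi j \<Rightarrow> 1 \<le> j \<and> j \<le> n)"

abbreviation TG :: "nat \<Rightarrow> 'k::comm_ring_1 falg" where "TG i \<equiv> fgen (GT i)"
abbreviation XG :: "nat \<Rightarrow> 'k::comm_ring_1 falg" where "XG i \<equiv> fgen (GX i)"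
abbreviation XiG :: "nat \<Rightarrow> 'k::comm_ring_1 falg" where "XiG i \<equiv> fgen (GXi i)"

definition relations :: "nat \<Rightarrow> nat \<Rightarrow> 'k::comm_ring_1 falg set" where
  "relations n q =
     {fgen g | g. \<not> valid_gen n g}
   \<union> {fmul (TG i - fsc (of_nat q)) (TG i + fsc 1) | i. 1 \<le> i \<and> i < n}
   \<union> {fprod [TG i, TG (Suc i), TG i] - fprod [TG (Suc i), TG i, TG (Suc i)] | i. 1 \<le> i \<and> Suc i < n}
   \<union> {fmul (TG i) (TG j) - fmul (TG j) (TG i) | i j. 1 \<le> i \<and> i < n \<and> 1 \<le> j \<and> j < n \<and> Suc i < j}
   \<union> {fmul (XG j) (XiG j) - fsc 1 | j. 1 \<le> j \<and> j \<le> n}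
   \<union> {fmul (XiG j) (XG j) - fsc 1 | j. 1 \<le> j \<and> j \<le> n}
   \<union> {fmul (XG j) (XG k) - fmul (XG k) (XG j) | j k. 1 \<le> j \<and> j \<le> n \<and> 1 \<le> k \<and> k \<le> n}
   \<union> {fmul (TG i) (XG j) - fmul (XG j) (TG i) | i j. 1 \<le> i \<and> i < n \<and> 1 \<le> j \<and> j \<le> n
                                                   \<and> j \<noteq> i \<and> j \<noteq> Suc i}
   \<union> {fprod [TG i, XG i, TG i] - fmul (fsc (of_nat q)) (XG (Suc i)) | i. 1 \<le> i \<and> i < n}"

inductive_set hideal :: "'k::comm_ring_1 falg set \<Rightarrow> 'k falg set" for R where
  zero: "0 \<in> hideal R"
| gen: "r \<in> R \<Longrightarrow> fmul (fmul (Poly_Mapping.single u c) r) (Poly_Mapping.single v 1) \<in> hideal R"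
| add: "a \<in> hideal R \<Longrightarrow> b \<in> hideal R \<Longrightarrow> a + b \<in> hideal R"

definition heq :: "nat \<Rightarrow> nat \<Rightarrow> 'k::comm_ring_1 falg \<Rightarrow> 'k falg \<Rightarrow> bool" where
  "heq n q a b \<longleftrightarrow> a - b \<in> hideal (relations n q)"

definition Tinv :: "nat \<Rightarrow> nat \<Rightarrow> 'k::field falg" where
  "Tinv q i = fmul (fsc (inverse (of_nat q))) (TG i - fsc (of_nat q - 1))"

definition Ts0 :: "nat \<Rightarrow> nat \<Rightarrow> 'k::field falg" where
  "Ts0 n q = fmul (fsc (of_nat q ^ (n - 1)))
      (fprod ([XiG 1, XG n] @ rev (map (Tinv q) (rev [2..<n] @ [1] @ [2..<n]))))"

text \<open>T_tau = q^(-(n-1)/2) T_(n-1)...T_1 X_1 with q^(1/2) = sq, and its inverse.\<close>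
definition Ttau :: "nat \<Rightarrow> 'k::field \<Rightarrow> 'k falg" where
  "Ttau n sq = fmul (fsc (inverse sq ^ (n - 1))) (fprod (map TG (rev [1..<n]) @ [XG 1]))"

definition Ttauinv :: "nat \<Rightarrow> nat \<Rightarrow> 'k::field \<Rightarrow> 'k falg" where
  "Ttauinv n q sq = fmul (fsc (sq ^ (n - 1)))
      (fprod (XiG 1 # rev (map (Tinv q) (rev [1..<n]))))"

definition Ttaupow :: "nat \<Rightarrow> nat \<Rightarrow> 'k::field \<Rightarrow> int \<Rightarrow> 'k falg" where
  "Ttaupow n q sq j = (if 0 \<le> j then fprod (replicate (nat j) (Ttau n sq))
                        else fprod (replicate (nat (-j)) (Ttauinv n q sq)))"

definition Tgen :: "nat \<Rightarrow> nat \<Rightarrow> nat \<Rightarrow> 'k::field falg" where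
  "Tgen n q i = (if i = 0 then Ts0 n q else TG i)"

definition redexp :: "nat \<Rightarrow> waff \<Rightarrow> nat list \<times> int" where
  "redexp n w = (SOME (is, j). length is = lenW n w \<and> set is \<subseteq> {..<n} \<and>
                                w = wmul (wprodA n is) (wpow (tau n) j))"

definition Tw :: "nat \<Rightarrow> nat \<Rightarrow> 'k::field \<Rightarrow> waff \<Rightarrow> 'k falg" where
  "Tw n q sq w = (case redexp n w of (is, j) \<Rightarrow>
                    fmul (fprod (map (Tgen n q) is)) (Ttaupow n q sq j))"

definition vJ :: "nat \<Rightarrow> nat \<Rightarrow> 'k::field \<Rightarrow> nat set \<Rightarrow> 'k falg" where
  "vJ n q sq J = (\<Sum>w\<in>WK J. Tw n q sq w)"

definition Mset :: "nat \<Rightarrow> nat \<Rightarrow> 'k::field \<Rightarrow> nat set \<Rightarrow> 'k falg set" where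
  "Mset n q sq J = {x. \<exists>h. heq n q x (fmul (vJ n q sq J) h)}"

definition is_hom :: "nat \<Rightarrow> nat \<Rightarrow> 'k::field \<Rightarrow> nat set \<Rightarrow> nat set \<Rightarrow> ('k falg \<Rightarrow> 'k falg) \<Rightarrow> bool" where
  "is_hom n q sq J K \<phi> \<longleftrightarrow>
     (\<forall>x\<in>Mset n q sq J. \<phi> x \<in> Mset n q sq K) \<and>
     (\<forall>x\<in>Mset n q sq J. \<forall>y\<in>Mset n q sq J. heq n q x y \<longrightarrow> heq n q (\<phi> x) (\<phi> y)) \<and>
     (\<forall>x\<in>Mset n q sq J. \<forall>y\<in>Mset n q sq J. heq n q (\<phi> (x + y)) (\<phi> x + \<phi> y)) \<and>
     (\<forall>x\<in>Mset n q sq J. \<forall>h. heq n q (\<phi> (fmul x h)) (fmul (\<phi> x) h))"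

definition Iset :: "nat \<Rightarrow> nat set set" where "Iset n = Pow {1..<n}"

text \<open>Elements of S = End_H(\<oplus>_J v_J H) as matrices (Phi K J : v_J H \<rightarrow> v_K H).\<close>
definition Sset :: "nat \<Rightarrow> nat \<Rightarrow> 'k::field \<Rightarrow> (nat set \<Rightarrow> nat set \<Rightarrow> 'k falg \<Rightarrow> 'k falg) set" where
  "Sset n q sq = {\<Phi>. \<forall>J\<in>Iset n. \<forall>K\<in>Iset n. is_hom n q sq J K (\<Phi> K J)}"

definition seq :: "nat \<Rightarrow> nat \<Rightarrow> 'k::field \<Rightarrow> (nat set \<Rightarrow> nat set \<Rightarrow> 'k falg \<Rightarrow> 'k falg)
                     \<Rightarrow> (nat set \<Rightarrow> nat set \<Rightarrow> 'k falg \<Rightarrow> 'k falg) \<Rightarrow> bool" where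
  "seq n q sq \<Phi> \<Psi> \<longleftrightarrow> (\<forall>J\<in>Iset n. \<forall>K\<in>Iset n. \<forall>x\<in>Mset n q sq J. heq n q (\<Phi> K J x) (\<Psi> K J x))"

definition sadd :: "(nat set \<Rightarrow> nat set \<Rightarrow> 'k::field falg \<Rightarrow> 'k falg)
                     \<Rightarrow> (nat set \<Rightarrow> nat set \<Rightarrow> 'k falg \<Rightarrow> 'k falg) \<Rightarrow> (nat set \<Rightarrow> nat set \<Rightarrow> 'k falg \<Rightarrow> 'k falg)" where
  "sadd \<Phi> \<Psi> = (\<lambda>K J x. \<Phi> K J x + \<Psi> K J x)"

definition ssc :: "'k::field \<Rightarrow> (nat set \<Rightarrow> nat set \<Rightarrow> 'k falg \<Rightarrow> 'k falg)
                    \<Rightarrow> (nat set \<Rightarrow> nat set \<Rightarrow> 'k falg \<Rightarrow> 'k falg)" where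
  "ssc c \<Phi> = (\<lambda>K J x. fmul (fsc c) (\<Phi> K J x))"

definition scomp :: "nat \<Rightarrow> (nat set \<Rightarrow> nat set \<Rightarrow> 'k::field falg \<Rightarrow> 'k falg)
                     \<Rightarrow> (nat set \<Rightarrow> nat set \<Rightarrow> 'k falg \<Rightarrow> 'k falg) \<Rightarrow> (nat set \<Rightarrow> nat set \<Rightarrow> 'k falg \<Rightarrow> 'k falg)" where
  "scomp n \<Phi> \<Psi> = (\<lambda>K J x. \<Sum>L\<in>Iset n. \<Phi> K L (\<Psi> L J x))"

definition sone :: "nat set \<Rightarrow> nat set \<Rightarrow> 'k::field falg \<Rightarrow> 'k falg" where
  "sone = (\<lambda>K J x. if K = J then x else 0)"

text \<open>The basis element b^d_{K,J}: v_J \<mapsto> sum of T_v over W_K d W_J.\<close>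
definition bS :: "nat \<Rightarrow> nat \<Rightarrow> 'k::field \<Rightarrow> nat set \<Rightarrow> nat set \<Rightarrow> waff
                   \<Rightarrow> (nat set \<Rightarrow> nat set \<Rightarrow> 'k falg \<Rightarrow> 'k falg)" where
  "bS n q sq K J d = (\<lambda>K' J' x. if K' = K \<and> J' = J then
       fmul (\<Sum>v\<in>{wmul (wmul u d) w | u w. u \<in> WK K \<and> w \<in> WK J}. Tw n q sq v)
            (SOME h. heq n q x (fmul (vJ n q sq J) h))
     else 0)"

definition ddiff :: "nat \<Rightarrow> 'k::field laurent \<Rightarrow> 'k laurent" where
  "ddiff i f = (THE g. (LX i - LX (Suc i)) * g = f - permL (sw i) f)"

definition actGen :: "nat \<Rightarrow> nat \<Rightarrow> hgen \<Rightarrow> 'k::field laurent \<Rightarrow> 'k laurent" where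
  "actGen n q g f = (if \<not> valid_gen n g then 0 else
     (case g of GT i \<Rightarrow> Lsc (of_nat q) * f - (Lsc (of_nat q) * LX i - LX (Suc i)) * ddiff i f
              | GX j \<Rightarrow> LX j * f
              | GXi j \<Rightarrow> LXinv j * f))"

definition actF :: "nat \<Rightarrow> nat \<Rightarrow> 'k::field falg \<Rightarrow> 'k laurent \<Rightarrow> 'k laurent" where
  "actF n q x f = (\<Sum>u\<in>Poly_Mapping.keys x. Lsc (Poly_Mapping.lookup x u) * foldr (actGen n q) u f)"

definition Pset :: "nat \<Rightarrow> (nat set \<Rightarrow> 'k::field laurent) set" where
  "Pset n = {F. (\<forall>K\<in>Iset n. F K \<in> invariants n (fst ` WK K)) \<and> (\<forall>K. K \<notin> Iset n \<longrightarrow> F K = 0)}"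

end

theory Submission imports Defs begin

text \<open>The affine Hecke algebra acts on Laurent polynomials by Demazure-Lusztig operators. Linear
  independence of permutations over Laurent polynomials (Dedekind) and the triangularity of \<open>T_w\<close>
  with respect to the length show that the elements \<open>P T_w\<close>, \<open>w\<close> a finite permutation, are independent
  as operators; since they span the algebra, they form a basis and the polynomial
  representation is faithful. The invariants of \<open>W_J\<close> are exactly the common \<open>q\<close>-eigenvectors of the \<open>T_j\<close>,
  \<open>j \<in> J\<close>. A homomorphism out of \<open>v_J H\<close> is determined by the image of \<open>v_J\<close>, which is a right
  \<open>q\<close>-eigenvector of every \<open>T_j\<close> and therefore of the form \<open>h v_J\<close>; it acts on invariants by \<open>h\<close>. This is
  independent of \<open>h\<close> because \<open>h v_J = 0\<close> forces \<open>h\<close> to kill the invariants, even when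
  the Poincare polynomial of \<open>W_J\<close> vanishes at \<open>q\<close>. The formula for the basis elements comes from
  \<open>\<Sum>x \<in> W_K d W_J. T_x = (\<Sum>a. T_a T_d) v_J\<close>, where lengths add along the unique factorisation of
  the elements of a double coset.\<close>

text \<open>Two obstacles shape the proof. The Poincare polynomial of \<open>W_J\<close> may vanish
  at q in the ground field, so an invariant f need not be of the form \<open>v_J g\<close>, and h f
  = 0 cannot be read off from \<open>h v_J = 0\<close> directly. Instead h is written as a sum of
  \<open>P_w T_w\<close> and w is factored as d u with u in \<open>W_J\<close>. On every
  q-eigenvector of the \<open>T_j\<close> the element h acts through the \<open>T_d\<close> and the
  weights \<open>r_d\<close>, the sum over u of \<open>q^l(u) P_(du)\<close>. On \<open>v_J\<close>
  this produces \<open>r_d\<close> as the coefficient of every \<open>T_(du)\<close>, so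
  independence kills all \<open>r_d\<close>, and then h kills f. Secondly, \<open>T_w\<close> in the
  extended affine group rests on a choice of reduced expression, and \<open>T_0\<close> and
  \<open>T_tau\<close> are not generators. Independence of the choice needs Matsumoto's theorem for
  the affine group and the braid relations of \<open>T_0\<close>, which arise from the finite ones
  by conjugation with \<open>T_tau\<close>. As the polynomial representation is faithful, all this
  may be checked in a ring of operators, with equations and inverses in place of congruences in a
  free algebra.\<close>

lemma poly_mapping_additive_induct [case_names zero single add]:
  fixes f :: "'a \<Rightarrow>\<^sub>0 'b::monoid_add"
  assumes "P 0" and "\<And>u c. P (Poly_Mapping.single u c)" and "\<And>f g. P f \<Longrightarrow> P g \<Longrightarrow> P (f + g)"
  shows "P f"
proof (induction f rule: update_induct)
  case const
  then show ?case using assms(1) by simp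
next
  case (update f a b)
  have eq: "Poly_Mapping.update a b f = Poly_Mapping.single a b + f"
    using update by (intro poly_mapping_eqI)
      (auto simp: lookup_update lookup_add lookup_single when_def in_keys_iff)
  show ?case unfolding eq by (rule assms(3)[OF assms(2) update(3)])
qed

text \<open>Additive extension of a map given on single terms; \<open>pexp\<close>,
  \<open>permL\<close>, \<open>act\<close> and \<open>lmap\<close> are all of this form. The
  condition that G u vanish at 0 in the lemmas lets two supports be replaced by a common finite
  superset.\<close>

definition pm_sum :: "('a \<Rightarrow> 'b::zero \<Rightarrow> 'c::comm_monoid_add) \<Rightarrow> ('a \<Rightarrow>\<^sub>0 'b) \<Rightarrow> 'c" where
  "pm_sum G f = (\<Sum>u\<in>Poly_Mapping.keys f. G u (Poly_Mapping.lookup f u))"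

lemma pm_sum_superset:
  assumes "\<And>u. G u 0 = 0" "finite A" "Poly_Mapping.keys f \<subseteq> A"
  shows "pm_sum G f = (\<Sum>u\<in>A. G u (Poly_Mapping.lookup f u))"
  unfolding pm_sum_def
  using assms(2,3) by (intro sum.mono_neutral_left ballI) (auto simp: in_keys_iff assms(1))

lemma pm_sum_zero [simp]: "pm_sum G 0 = 0"
  by (simp add: pm_sum_def)

lemma pm_sum_single:
  assumes "\<And>u. G u 0 = 0" shows "pm_sum G (Poly_Mapping.single u c) = G u c"
  using assms by (simp add: pm_sum_def)

lemma pm_sum_add:
  fixes f g :: "'a \<Rightarrow>\<^sub>0 'b::comm_monoid_add"
  assumes "\<And>u. G u 0 = 0" "\<And>u a b. G u (a + b) = G u a + G u b"
  shows "pm_sum G (f + g) = pm_sum G f + pm_sum G g"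
proof -
  let ?A = "Poly_Mapping.keys f \<union> Poly_Mapping.keys g"
  have "pm_sum G (f + g) = (\<Sum>u\<in>?A. G u (Poly_Mapping.lookup (f + g) u))"
    using assms(1) Poly_Mapping.keys_add[of f g] by (intro pm_sum_superset) auto
  also have "\<dots> = (\<Sum>u\<in>?A. G u (Poly_Mapping.lookup f u)) + (\<Sum>u\<in>?A. G u (Poly_Mapping.lookup g u))"
    by (simp add: lookup_add assms(2) sum.distrib)
  also have "\<dots> = pm_sum G f + pm_sum G g"
    using assms(1) by (subst (1 2) pm_sum_superset[of G ?A]) auto
  finally show ?thesis .
qed

lemma sum_singles: "(\<Sum>u\<in>Poly_Mapping.keys f. Poly_Mapping.single u (Poly_Mapping.lookup f u)) = f"
proof (rule poly_mapping_eqI)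
  fix k
  have "(\<Sum>u\<in>Poly_Mapping.keys f. Poly_Mapping.lookup f u when u = k) = Poly_Mapping.lookup f k"
  proof (cases "k \<in> Poly_Mapping.keys f")
    case True
    then show ?thesis by (simp add: when_def sum.delta')
  next
    case False
    then have "Poly_Mapping.lookup f k = 0" by (simp add: in_keys_iff)
    moreover have "(\<Sum>u\<in>Poly_Mapping.keys f. Poly_Mapping.lookup f u when u = k) = 0"
      by (rule sum.neutral) (use False in \<open>auto simp: when_def\<close>)
    ultimately show ?thesis by simp
  qed
  then show "Poly_Mapping.lookup (\<Sum>u\<in>Poly_Mapping.keys f. Poly_Mapping.single u (Poly_Mapping.lookup f u)) k
      = Poly_Mapping.lookup f k"
    by (simp add: lookup_sum lookup_single)
qed

text \<open>Words form a monoid under concatenation, so that the free algebra becomes a monoid ring and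
  \<open>fmul\<close> its multiplication.\<close>

instantiation list :: (type) monoid_add
begin
definition zero_list :: "'a list" where "0 = []"
definition plus_list :: "'a list \<Rightarrow> 'a list \<Rightarrow> 'a list" where "xs + ys = xs @ ys"
instance by standard (simp_all add: zero_list_def plus_list_def)
end

lemma fmul_eq_times: "fmul f g = f * g"
proof -
  have "f * g = (\<Sum>u\<in>Poly_Mapping.keys f. Poly_Mapping.single u (Poly_Mapping.lookup f u)) *
                (\<Sum>v\<in>Poly_Mapping.keys g. Poly_Mapping.single v (Poly_Mapping.lookup g v))"
    by (simp add: sum_singles)
  also have "\<dots> = fmul f g"
    by (simp add: fmul_def sum_distrib_left sum_distrib_right mult_single plus_list_def)
       (rule sum.swap)
  finally show ?thesis ..
qed

section \<open>Scalars and products in the free algebra\<close>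

lemma fsc_0 [simp]: "fsc 0 = 0"
  by (simp add: fsc_def)

lemma fsc_1 [simp]: "fsc 1 = 1"
  by (simp add: fsc_def zero_list_def[symmetric])

lemma fsc_add: "fsc (a + b) = fsc a + fsc b"
  by (simp add: fsc_def single_add)

lemma fsc_minus: "fsc (- a) = - fsc a"
  by (simp add: fsc_def single_uminus)

lemma fsc_diff: "fsc (a - b) = fsc a - fsc b"
  by (simp add: fsc_def single_diff)

lemma fsc_mult: "fsc (a * b) = fsc a * fsc b"
  by (simp add: fsc_def mult_single plus_list_def)

lemma fsc_commute: "fsc c * x = x * fsc c"
  by (induction x rule: poly_mapping_additive_induct)
     (simp_all add: fsc_def mult_single plus_list_def mult.commute algebra_simps)

lemma single_Nil_1: "Poly_Mapping.single [] 1 = (1 :: 'k::comm_ring_1 falg)"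
  by (simp add: zero_list_def[symmetric])

lemma fprod_eq_prod_list: "fprod xs = prod_list xs"
  by (induction xs) (simp_all add: fprod_def fmul_eq_times)

text \<open>Words are built from the left, which suits claims stable under left multiplication by a
  generator, such as \<open>spanning\<close> and \<open>act_LP\<close>.\<close>

lemma falg_induct [case_names scalar gen add]:
  assumes "\<And>c. P (fsc c)" "\<And>g x. P x \<Longrightarrow> P (fgen g * x)" "\<And>x y. P x \<Longrightarrow> P y \<Longrightarrow> P (x + y)"
  shows "P (x :: 'k::comm_ring_1 falg)"
proof (induction x rule: poly_mapping_additive_induct)
  case zero
  then show ?case using assms(1)[of 0] by simp
next
  case (single u c)
  show ?case
  proof (induction u)
    case Nil
    then show ?case using assms(1)[of c] by (simp add: fsc_def)
  next
    case (Cons g u)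
    have "Poly_Mapping.single (g # u) c = fgen g * Poly_Mapping.single u c"
      by (simp add: fgen_def mult_single plus_list_def)
    then show ?case using assms(2)[OF Cons] by metis
  qed
next
  case (add f g)
  then show ?case using assms(3) by blast
qed

subsection \<open>Laurent polynomials\<close>

lemma Lsc_0 [simp]: "Lsc 0 = 0" and Lsc_1 [simp]: "Lsc 1 = 1"
  by (simp_all add: Lsc_def)

lemma Lsc_add: "Lsc (a + b) = Lsc a + Lsc b"
  by (simp add: Lsc_def single_add)

lemma Lsc_diff: "Lsc (a - b) = Lsc a - Lsc b"
  by (simp add: Lsc_def single_diff)

lemma Lsc_mult: "Lsc (a * b) = Lsc a * Lsc b"
  by (simp add: Lsc_def mult_single)

lemma LX_LXinv [simp]: "LX j * LXinv j = 1" "LXinv j * LX j = 1"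
  by (simp_all add: LX_def LXinv_def mult_single single_add[symmetric])

lemma LX_inj: "LX i = (LX j :: 'k::comm_ring_1 laurent) \<longleftrightarrow> i = j"
proof
  assume "LX i = (LX j :: 'k laurent)"
  then have "Poly_Mapping.keys (LX i :: 'k laurent) = Poly_Mapping.keys (LX j :: 'k laurent)" by simp
  then have "Poly_Mapping.single i (1::int) = Poly_Mapping.single j 1" by (simp add: LX_def)
  then have "Poly_Mapping.keys (Poly_Mapping.single i (1::int)) = Poly_Mapping.keys (Poly_Mapping.single j (1::int))" by simp
  then show "i = j" by simp
qed simp

definition mon :: "(nat \<Rightarrow>\<^sub>0 int) \<Rightarrow> 'k::comm_ring_1 laurent" where
  "mon e = Poly_Mapping.single e 1"

lemma mon_0 [simp]: "mon 0 = 1" by (simp add: mon_def)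
lemma mon_add: "mon (d + e) = mon d * mon e" by (simp add: mon_def mult_single)
lemma single_eq_Lsc_mon: "Poly_Mapping.single e c = Lsc c * mon e"
  by (simp add: mon_def Lsc_def mult_single)
lemma LX_eq_mon: "LX j = mon (Poly_Mapping.single j 1)" by (simp add: LX_def mon_def)
lemma LXinv_eq_mon: "LXinv j = mon (Poly_Mapping.single j (-1))" by (simp add: LXinv_def mon_def)

text \<open>The set of variables is a parameter: the divided difference is defined by a description
  on all Laurent polynomials, which calls for \<open>UNIV\<close>, while \<open>{1..n}\<close> gives
  the stability of the representation space.\<close>

definition laurent_on :: "nat set \<Rightarrow> 'k::comm_ring_1 laurent set" where
  "laurent_on A = {f. \<forall>e\<in>Poly_Mapping.keys f. Poly_Mapping.keys e \<subseteq> A}"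

lemma laurent_set_eq_on: "laurent_set n = laurent_on {1..n}"
  by (simp add: laurent_set_def laurent_on_def)

lemma laurent_on_UNIV [simp]: "laurent_on UNIV = UNIV"
  by (simp add: laurent_on_def)

lemma mon_single_induct:
  assumes "\<And>f g. P f \<Longrightarrow> P g \<Longrightarrow> P (f * g)" "P 1" "P (LX j)" "P (LXinv j)"
  shows "P (mon (Poly_Mapping.single j z) :: 'k::comm_ring_1 laurent)"
proof (induction z rule: int_induct[where k=0])
  case base
  then show ?case using assms by simp
next
  case (step1 i)
  have "mon (Poly_Mapping.single j (i + 1)) = LX j * (mon (Poly_Mapping.single j i) :: 'k laurent)"
    by (simp add: LX_eq_mon mon_add[symmetric] single_add[symmetric] add.commute)
  then show ?case using assms step1 by metis
next
  case (step2 i)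
  have "mon (Poly_Mapping.single j (i - 1)) = LXinv j * (mon (Poly_Mapping.single j i) :: 'k laurent)"
    by (simp add: LXinv_eq_mon mon_add[symmetric] single_add[symmetric])
  then show ?case using assms step2 by metis
qed

lemma laurent_induct_aux:
  assumes "f \<in> laurent_on A"
    and sc: "\<And>c. P (Lsc c)" and X: "\<And>j. j \<in> A \<Longrightarrow> P (LX j)" and Xi: "\<And>j. j \<in> A \<Longrightarrow> P (LXinv j)"
    and add: "\<And>f g. P f \<Longrightarrow> P g \<Longrightarrow> P (f + g)" and mult: "\<And>f g. P f \<Longrightarrow> P g \<Longrightarrow> P (f * g)"
  shows "P (f :: 'k::comm_ring_1 laurent)"
proof -
  have one: "P 1" using sc[of 1] by simp
  have zero: "P 0" using sc[of 0] by simp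
  have mon: "P (mon e)" if "Poly_Mapping.keys e \<subseteq> A" for e
  proof -
    have "P (mon (\<Sum>i\<in>I. Poly_Mapping.single i (Poly_Mapping.lookup e i)))"
      if "finite I" "I \<subseteq> A" for I
      using that
    proof (induction I rule: finite_induct)
      case empty
      then show ?case using one by simp
    next
      case (insert i I)
      have "P (mon (Poly_Mapping.single i (Poly_Mapping.lookup e i)))"
        by (rule mon_single_induct[where P = P]) (use insert in \<open>auto intro: mult one X Xi\<close>)
      then show ?case using insert by (simp add: mon_add mult)
    qed
    from this[OF finite_keys that] show ?thesis by (simp add: sum_singles)
  qed
  have "P (\<Sum>e\<in>I. Poly_Mapping.single e (Poly_Mapping.lookup f e))" if "finite I" "I \<subseteq> Poly_Mapping.keys f" for I
    using that
  proof (induction I rule: finite_induct)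
    case empty
    then show ?case using zero by simp
  next
    case (insert i I)
    have "Poly_Mapping.keys i \<subseteq> A" using insert assms(1) by (auto simp: laurent_on_def)
    then show ?case using insert by (auto simp: single_eq_Lsc_mon intro!: add mult sc mon)
  qed
  from this[OF finite_keys order_refl] show ?thesis by (simp add: sum_singles)
qed

lemma laurent_on_Lsc: "Lsc c \<in> laurent_on A"
  by (auto simp: laurent_on_def Lsc_def)
lemma laurent_on_LX: "j \<in> A \<Longrightarrow> LX j \<in> laurent_on A"
  by (auto simp: laurent_on_def LX_def)
lemma laurent_on_LXinv: "j \<in> A \<Longrightarrow> LXinv j \<in> laurent_on A"
  by (auto simp: laurent_on_def LXinv_def)
lemma laurent_on_mon: "Poly_Mapping.keys e \<subseteq> A \<Longrightarrow> mon e \<in> laurent_on A"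
  by (auto simp: laurent_on_def mon_def)
lemma laurent_on_0 [simp]: "0 \<in> laurent_on A"
  by (auto simp: laurent_on_def)
lemma laurent_on_1 [simp]: "1 \<in> laurent_on A"
  using laurent_on_Lsc[of 1] by simp
lemma laurent_on_add: "f \<in> laurent_on A \<Longrightarrow> g \<in> laurent_on A \<Longrightarrow> f + g \<in> laurent_on A"
  unfolding laurent_on_def using Poly_Mapping.keys_add[of f g] by blast
lemma laurent_on_uminus: "f \<in> laurent_on A \<Longrightarrow> - f \<in> laurent_on A"
  unfolding laurent_on_def by (simp add: in_keys_iff)
lemma laurent_on_diff: "f \<in> laurent_on A \<Longrightarrow> g \<in> laurent_on A \<Longrightarrow> f - g \<in> laurent_on A"
  using laurent_on_add[of f A "- g"] laurent_on_uminus[of g A] by simp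
lemma laurent_on_mult: "f \<in> laurent_on A \<Longrightarrow> g \<in> laurent_on A \<Longrightarrow> f * g \<in> laurent_on A"
  unfolding laurent_on_def
proof clarify
  fix e j
  assume *: "\<forall>e\<in>Poly_Mapping.keys f. Poly_Mapping.keys e \<subseteq> A" "\<forall>e\<in>Poly_Mapping.keys g. Poly_Mapping.keys e \<subseteq> A"
    and "e \<in> Poly_Mapping.keys (f * g)" and j: "j \<in> Poly_Mapping.keys e"
  then obtain a b where ab: "e = a + b" "a \<in> Poly_Mapping.keys f" "b \<in> Poly_Mapping.keys g"
    using Poly_Mapping.keys_mult[of f g] by blast
  then show "j \<in> A" using * j Poly_Mapping.keys_add[of a b] by blast
qed
lemma laurent_on_sum: "(\<And>i. i \<in> I \<Longrightarrow> f i \<in> laurent_on A) \<Longrightarrow> sum f I \<in> laurent_on A"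
  by (induction I rule: infinite_finite_induct) (auto intro: laurent_on_add)

lemma laurent_induct [consumes 1, case_names scalar X Xinv add mult]:
  assumes "f \<in> laurent_on A"
    and "\<And>c. P (Lsc c)" and "\<And>j. j \<in> A \<Longrightarrow> P (LX j)" and "\<And>j. j \<in> A \<Longrightarrow> P (LXinv j)"
    and "\<And>f g. f \<in> laurent_on A \<Longrightarrow> g \<in> laurent_on A \<Longrightarrow> P f \<Longrightarrow> P g \<Longrightarrow> P (f + g)"
    and "\<And>f g. f \<in> laurent_on A \<Longrightarrow> g \<in> laurent_on A \<Longrightarrow> P f \<Longrightarrow> P g \<Longrightarrow> P (f * g)"
  shows "P (f :: 'k::comm_ring_1 laurent)"
proof -
  have "f \<in> laurent_on A \<and> P f"
    by (rule laurent_induct_aux[where P = "\<lambda>f. f \<in> laurent_on A \<and> P f", OF assms(1)])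
       (auto intro: assms(2-) laurent_on_Lsc laurent_on_LX laurent_on_LXinv laurent_on_add laurent_on_mult)
  then show ?thesis ..
qed

subsection \<open>Permutation of the variables\<close>

lemma pexp_pm_sum: "pexp \<sigma> e = pm_sum (\<lambda>i. Poly_Mapping.single (\<sigma> i)) e"
  by (simp add: pexp_def pm_sum_def)

lemma pexp_0 [simp]: "pexp \<sigma> 0 = 0"
  by (simp add: pexp_pm_sum)
lemma pexp_add: "pexp \<sigma> (d + e) = pexp \<sigma> d + pexp \<sigma> e"
  by (simp add: pexp_pm_sum pm_sum_add single_add)
lemma pexp_single [simp]: "pexp \<sigma> (Poly_Mapping.single i z) = Poly_Mapping.single (\<sigma> i) z"
  by (simp add: pexp_pm_sum pm_sum_single)
lemma pexp_comp: "pexp (\<sigma> \<circ> \<tau>) e = pexp \<sigma> (pexp \<tau> e)"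
  by (induction e rule: poly_mapping_additive_induct) (simp_all add: pexp_add)
lemma pexp_id: "pexp id e = e"
  by (induction e rule: poly_mapping_additive_induct) (simp_all add: pexp_add)
lemma permL_pm_sum: "permL \<sigma> f = pm_sum (\<lambda>e. Poly_Mapping.single (pexp \<sigma> e)) f"
  by (simp add: permL_def pm_sum_def)

lemma permL_0 [simp]: "permL \<sigma> 0 = 0"
  by (simp add: permL_pm_sum)
lemma permL_add: "permL \<sigma> (f + g) = permL \<sigma> f + permL \<sigma> g"
  by (simp add: permL_pm_sum pm_sum_add single_add)
lemma permL_single: "permL \<sigma> (Poly_Mapping.single e c) = Poly_Mapping.single (pexp \<sigma> e) c"
  by (simp add: permL_pm_sum pm_sum_single)
lemma permL_uminus: "permL \<sigma> (- f) = - permL \<sigma> f"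
  using permL_add[of \<sigma> f "- f"] by (simp add: eq_neg_iff_add_eq_0 add.commute)
lemma permL_diff: "permL \<sigma> (f - g) = permL \<sigma> f - permL \<sigma> g"
  using permL_add[of \<sigma> f "- g"] by (simp add: permL_uminus)
lemma permL_sum: "permL \<sigma> (sum f I) = (\<Sum>i\<in>I. permL \<sigma> (f i))"
  by (induction I rule: infinite_finite_induct) (auto simp: permL_add)
lemma permL_mult: "permL \<sigma> (f * g) = permL \<sigma> f * permL \<sigma> g"
proof (induction f rule: poly_mapping_additive_induct)
  case (single u c)
  show ?case
    by (induction g rule: poly_mapping_additive_induct)
       (simp_all add: permL_add algebra_simps permL_single mult_single pexp_add)
qed (simp_all add: permL_add algebra_simps)
lemma permL_Lsc [simp]: "permL \<sigma> (Lsc c) = Lsc c"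
  by (simp add: Lsc_def permL_single)
lemma permL_1 [simp]: "permL \<sigma> 1 = 1"
  using permL_Lsc[of \<sigma> 1] by simp
lemma permL_LX [simp]: "permL \<sigma> (LX j) = LX (\<sigma> j)"
  by (simp add: LX_def permL_single)
lemma permL_LXinv [simp]: "permL \<sigma> (LXinv j) = LXinv (\<sigma> j)"
  by (simp add: LXinv_def permL_single)
lemma permL_mon [simp]: "permL \<sigma> (mon e) = mon (pexp \<sigma> e)"
  by (simp add: mon_def permL_single)
lemma permL_comp: "permL (\<sigma> \<circ> \<tau>) f = permL \<sigma> (permL \<tau> f)"
  by (induction f rule: poly_mapping_additive_induct) (simp_all only: permL_0 permL_add permL_single pexp_comp)
lemma permL_id [simp]: "permL id f = f"
  by (induction f rule: poly_mapping_additive_induct) (simp_all only: permL_0 permL_add permL_single pexp_id)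
lemma permL_inj:
  assumes "inj \<sigma>" "permL \<sigma> f = 0" shows "f = 0"
proof -
  have "inv \<sigma> \<circ> \<sigma> = id" using assms(1) by simp
  then have "permL (inv \<sigma>) (permL \<sigma> f) = f" by (simp flip: permL_comp)
  then show ?thesis using assms(2) by simp
qed

lemma sw_sw [simp]: "sw i (sw i k) = k" by (simp add: sw_def)
lemma sw_simps [simp]: "sw i i = Suc i" "sw i (Suc i) = i" "k \<noteq> i \<Longrightarrow> k \<noteq> Suc i \<Longrightarrow> sw i k = k"
  by (simp_all add: sw_def)
lemma sw_comp_sw [simp]: "sw i \<circ> sw i = id" by auto
lemma inj_sw: "inj (sw i)" by (metis injI sw_sw)
lemma permL_sw_sw [simp]: "permL (sw i) (permL (sw i) f) = f"
  by (simp flip: permL_comp)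

subsection \<open>Divided differences\<close>

lemma laurent_on_permL:
  assumes "f \<in> laurent_on A" "\<sigma> ` A \<subseteq> A"
  shows "permL \<sigma> f \<in> laurent_on A"
proof -
  have *: "\<sigma> j \<in> A" if "j \<in> A" for j using assms(2) that by blast
  show ?thesis
    using assms(1)
  proof (induction f rule: laurent_induct)
  qed (simp_all add: permL_add permL_mult laurent_on_add laurent_on_mult
        laurent_on_LX laurent_on_LXinv laurent_on_Lsc *)
qed

lemma sw_image: "i \<in> A \<Longrightarrow> Suc i \<in> A \<Longrightarrow> sw i ` A \<subseteq> A"
  by (auto simp: sw_def)

text \<open>The map f - s f is a twisted derivation: f g - s(f g) = (f - s f) g + s(f) (g - s g).
  Divisibility by \<open>X_i - X_(i+1)\<close> therefore passes from the variables and their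
  inverses to all products.\<close>

lemma ddiff_exists:
  assumes "f \<in> laurent_on A" "i \<in> A" "Suc i \<in> A"
  shows "\<exists>g\<in>laurent_on A. (LX i - LX (Suc i)) * g = f - permL (sw i) (f :: 'k::comm_ring_1 laurent)"
  using assms(1)
proof (induction f rule: laurent_induct)
  case (scalar c)
  then show ?case by (intro bexI[of _ 0]) auto
next
  case (X j)
  consider "j = i" | "j = Suc i" | "j \<noteq> i" "j \<noteq> Suc i" by blast
  then show ?case
  proof cases
    case 1
    then show ?thesis by (intro bexI[of _ 1]) auto
  next
    case 2
    then show ?thesis by (intro bexI[of _ "- 1"]) (auto intro: laurent_on_uminus)
  next
    case 3
    then show ?thesis by (intro bexI[of _ 0]) auto
  qed
next
  case (Xinv j)
  have eq: "(LX i - LX (Suc i)) * (LXinv i * LXinv (Suc i)) = LXinv (Suc i) - (LXinv i :: 'k laurent)"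
  proof -
    have "(LX i - LX (Suc i)) * (LXinv i * LXinv (Suc i))
        = (LX i * LXinv i) * LXinv (Suc i) - LXinv i * (LX (Suc i) * (LXinv (Suc i) :: 'k laurent))"
      by (simp only: algebra_simps)
    then show ?thesis by simp
  qed
  consider "j = i" | "j = Suc i" | "j \<noteq> i" "j \<noteq> Suc i" by blast
  then show ?case
  proof cases
    case 1
    then show ?thesis using assms eq by (intro bexI[of _ "- (LXinv i * LXinv (Suc i))"])
      (auto intro!: laurent_on_uminus laurent_on_mult laurent_on_LXinv)
  next
    case 2
    then show ?thesis using assms eq by (intro bexI[of _ "LXinv i * LXinv (Suc i)"])
      (auto intro!: laurent_on_mult laurent_on_LXinv)
  next
    case 3
    then show ?thesis by (intro bexI[of _ 0]) auto
  qed
next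
  case (add f g)
  then obtain a b where "a \<in> laurent_on A" "b \<in> laurent_on A" "(LX i - LX (Suc i)) * a = f - permL (sw i) f"
    "(LX i - LX (Suc i)) * b = g - permL (sw i) g" by blast
  then show ?case by (intro bexI[of _ "a + b"]) (auto simp: permL_add distrib_left intro: laurent_on_add)
next
  case (mult f g)
  then obtain a b where ab: "a \<in> laurent_on A" "b \<in> laurent_on A" "(LX i - LX (Suc i)) * a = f - permL (sw i) f"
    "(LX i - LX (Suc i)) * b = g - permL (sw i) g" by blast
  have "(LX i - LX (Suc i)) * (a * g + permL (sw i) f * b)
      = ((LX i - LX (Suc i)) * a) * g + permL (sw i) f * ((LX i - LX (Suc i)) * b)"
    by (simp only: algebra_simps)
  also have "\<dots> = f * g - permL (sw i) (f * g)"
    unfolding ab permL_mult by (simp only: algebra_simps)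
  finally show ?case using ab mult assms
    by (intro bexI[of _ "a * g + permL (sw i) f * b"])
       (simp_all add: laurent_on_add laurent_on_mult laurent_on_permL sw_image)
qed

text \<open>Laurent polynomials over a field form a domain, so the quotient is unique.\<close>

lemma ddiff_eqI:
  assumes "(LX i - LX (Suc i)) * g = f - permL (sw i) (f :: 'k::field laurent)"
  shows "ddiff i f = g"
  unfolding ddiff_def
proof (rule the_equality)
  fix h assume "(LX i - LX (Suc i)) * h = f - permL (sw i) f"
  then have "(LX i - LX (Suc i)) * h = (LX i - LX (Suc i)) * g" using assms by simp
  then show "h = g" by (simp add: LX_inj)
qed (fact assms)

lemma ddiff: "(LX i - LX (Suc i)) * ddiff i f = f - permL (sw i) (f :: 'k::field laurent)"
proof -
  obtain g where g: "(LX i - LX (Suc i)) * g = f - permL (sw i) f"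
    using ddiff_exists[of f UNIV i] by auto
  then show ?thesis unfolding ddiff_eqI[OF g] .
qed

lemma ddiff_in:
  assumes "f \<in> laurent_on A" "i \<in> A" "Suc i \<in> A"
  shows "ddiff i (f :: 'k::field laurent) \<in> laurent_on A"
proof -
  obtain g where g: "g \<in> laurent_on A" "(LX i - LX (Suc i)) * g = f - permL (sw i) f"
    using ddiff_exists[OF assms] by blast
  then show ?thesis by (simp add: ddiff_eqI[OF g(2)])
qed

subsection \<open>The ring of additive endomorphisms\<close>

text \<open>Operators as the elements of an honest ring, so that relations become equations. Only
  additivity is built in; compatibility with scalars is proved separately.\<close>

typedef (overloaded) 'a aend = "{f :: 'a::comm_ring_1 \<Rightarrow> 'a. \<forall>x y. f (x + y) = f x + f y}"
  morphisms app Aend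
  by (rule exI[of _ id]) simp

lemma app_add: "app f (x + y) = app f x + app f y"
  using app[of f] by simp

lemma app_Aend: "(\<And>x y. f (x + y) = f x + f y) \<Longrightarrow> app (Aend f) = f"
  by (simp add: Aend_inverse)

lemma app_zero: "app f 0 = 0"
  using app_add[of f 0 0] by simp

lemma app_sum_arg: "app f (sum g I) = (\<Sum>i\<in>I. app f (g i))"
  by (induction I rule: infinite_finite_induct) (auto simp: app_add app_zero)

lemma aend_eqI: "(\<And>x. app f x = app g x) \<Longrightarrow> f = g"
  by (metis app_inject ext)

instantiation aend :: (comm_ring_1) ring_1
begin
definition "0 = Aend (\<lambda>_. 0)"
definition "1 = Aend (\<lambda>x. x)"
definition "f + g = Aend (\<lambda>x. app f x + app g x)"
definition "f - g = Aend (\<lambda>x. app f x - app g x)"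
definition "- f = Aend (\<lambda>x. - app f x)"
definition "f * g = Aend (\<lambda>x. app f (app g x))"

lemma app_simps [simp]:
  "app 0 x = 0" "app 1 x = x" "app (f + g) x = app f x + app g x" "app (f - g) x = app f x - app g x"
  "app (- f) x = - app f x" "app (f * g) x = app f (app g x)"
  by (simp_all add: zero_aend_def one_aend_def plus_aend_def minus_aend_def uminus_aend_def times_aend_def
      app_Aend app_add)

instance
proof
  show "(0::'a aend) \<noteq> 1"
  proof
    assume "(0::'a aend) = 1"
    then have "app (0::'a aend) 1 = app 1 1" by simp
    then show False by simp
  qed
qed (auto intro!: aend_eqI simp: algebra_simps app_add)
end

lemma app_sum: "app (sum f I) x = (\<Sum>i\<in>I. app (f i) x)"
  by (induction I rule: infinite_finite_induct) auto

definition emul :: "'a::comm_ring_1 \<Rightarrow> 'a aend" where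
  "emul p = Aend (\<lambda>f. p * f)"

lemma app_emul [simp]: "app (emul p) f = p * f"
  by (simp add: emul_def app_Aend distrib_left)

lemma emul_mult: "emul (p * r) = emul p * emul r"
  by (rule aend_eqI) (simp add: mult.assoc)
lemma emul_add: "emul (p + r) = emul p + emul r"
  by (rule aend_eqI) (simp add: algebra_simps)
lemma emul_diff: "emul (p - r) = emul p - emul r"
  by (rule aend_eqI) (simp add: algebra_simps)
lemma emul_1 [simp]: "emul 1 = 1" and emul_0 [simp]: "emul 0 = 0"
  by (rule aend_eqI, simp)+
lemma emul_commute: "emul p * emul r = emul r * emul p"
  by (metis emul_mult mult.commute)

definition Top :: "'k \<Rightarrow> nat \<Rightarrow> 'k::field laurent aend" where
  "Top Q i = Aend (\<lambda>f. Lsc Q * f - (Lsc Q * LX i - LX (Suc i)) * ddiff i f)"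

lemma ddiff_add: "ddiff i (f + g) = ddiff i f + ddiff i g"
  by (rule ddiff_eqI) (simp add: distrib_left ddiff permL_add)

lemma app_Top: "app (Top Q i) f = Lsc Q * f - (Lsc Q * LX i - LX (Suc i)) * ddiff i f"
  by (simp add: Top_def app_Aend ddiff_add algebra_simps)

text \<open>The operators are compared after clearing the denominators \<open>X_i - X_(i+1)\<close>; this form exhibits
  them in the twisted group algebra of the symmetric group.\<close>

lemma Top_cleared:
  "(LX i - LX (Suc i)) * app (Top Q i) f =
     (Lsc Q * LX i - LX (Suc i)) * permL (sw i) f + (1 - Lsc Q) * LX (Suc i) * f"
proof -
  have "(LX i - LX (Suc i)) * app (Top Q i) f
      = (LX i - LX (Suc i)) * (Lsc Q * f) - (Lsc Q * LX i - LX (Suc i)) * ((LX i - LX (Suc i)) * ddiff i f)"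
    by (simp only: app_Top algebra_simps)
  then show ?thesis unfolding ddiff by (simp add: algebra_simps)
qed

lemma laurent_cancel:
  assumes "(LX i - LX j) * f = (LX i - LX j) * (g :: 'k::field laurent)" "i \<noteq> j"
  shows "f = g"
  using assms by (simp add: LX_inj)

text \<open>A permutation applied to the cleared form. Repeated use moves all permutations in a
  product of operators to the innermost argument.\<close>

lemma permL_Top:
  "(LX (\<sigma> i) - LX (\<sigma> (Suc i))) * permL \<sigma> (app (Top Q i) f) =
     (Lsc Q * LX (\<sigma> i) - LX (\<sigma> (Suc i))) * permL \<sigma> (permL (sw i) f) + (1 - Lsc Q) * LX (\<sigma> (Suc i)) * permL \<sigma> f"
proof -
  have "permL \<sigma> ((LX i - LX (Suc i)) * app (Top Q i) f) = permL \<sigma> ((Lsc Q * LX i - LX (Suc i)) * permL (sw i) f + (1 - Lsc Q) * LX (Suc i) * f)"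
    by (simp only: Top_cleared)
  then show ?thesis by (simp only: permL_add permL_mult permL_diff permL_LX permL_Lsc permL_1)
qed

lemma Top_quadratic:
  fixes Q :: "'k::field"
  shows "Top Q i * Top Q i = emul (Lsc (Q - 1)) * Top Q i + emul (Lsc Q)"
proof (rule aend_eqI)
  fix f :: "'k laurent"
  let ?x = "LX i :: 'k laurent" and ?y = "LX (Suc i) :: 'k laurent" and ?t = "app (Top Q i) f" and ?s = "permL (sw i) f"
    and ?q = "Lsc Q :: 'k laurent"
  have 1: "(?x - ?y) * ?t = (?q * ?x - ?y) * ?s + (1 - ?q) * ?y * f" by (rule Top_cleared)
  have 2: "(?y - ?x) * permL (sw i) ?t = (?q * ?y - ?x) * f + (1 - ?q) * ?x * ?s"
    using permL_Top[of "sw i" i Q f] by simp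
  have 3: "(?x - ?y) * app (Top Q i) ?t = (?q * ?x - ?y) * permL (sw i) ?t + (1 - ?q) * ?y * ?t" by (rule Top_cleared)
  \<comment> \<open>Both denominators are cleared; fact 2 supplies the swapped inner value, whose
    denominator has the opposite sign.\<close>
  have "(?x - ?y) * ((?x - ?y) * app (Top Q i) ?t) = (?x - ?y) * ((?x - ?y) * ((?q - 1) * ?t + ?q * f))"
    using 1 2 3 by algebra
  then have "app (Top Q i) ?t = (?q - 1) * ?t + ?q * f"
    using laurent_cancel[of i "Suc i"] by (metis n_not_Suc_n)
  then show "app (Top Q i * Top Q i) f = app (emul (Lsc (Q - 1)) * Top Q i + emul (Lsc Q)) f"
    by (simp add: Lsc_diff)
qed

text \<open>One side of the braid relation over free variables, which leaves plain polynomial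
  identities. With s = \<open>s_i\<close> and r = \<open>s_(i+1)\<close> the letters u0, ..., u5
  stand for f, s f, r f, s r f, r s f, s r s f; L is the value of the triple product and the
  remaining letters are its intermediate terms.\<close>

lemma braid_half:
  fixes x y z q :: "'a::idom"
  assumes "(x - y) * L = (q*x - y) * a + (1-q) * y * b"
    "(x - z) * a = (q*x - z) * c + (1-q) * z * d"
    "(y - z) * b = (q*y - z) * e + (1-q) * z * h"
    "(y - z) * c = (q*y - z) * u5 + (1-q) * z * u3"
    "(y - x) * d = (q*y - x) * u0 + (1-q) * x * u1"
    "(x - z) * e = (q*x - z) * u4 + (1-q) * z * u2"
    "(x - y) * h = (q*x - y) * u1 + (1-q) * y * u0"
  shows "(x-y) * ((x-y) * (x-z) * (y-z)) * L =
    (x-y) * (q*x-y) * (q*x-z) * ((q*y - z) * u5 + (1-q) * z * u3)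
    - (y-z) * (q*x-y) * ((1-q)*z) * ((q*y - x) * u0 + (1-q) * x * u1)
    + (x-y) * ((1-q)*y) * (q*y-z) * ((q*x - z) * u4 + (1-q) * z * u2)
    + (x-z) * ((1-q)*y) * ((1-q)*z) * ((q*x - y) * u1 + (1-q) * y * u0)"
proof -
  have "(x-y) * ((x-y) * (x-z) * (y-z)) * L = (x-y) * (x-z) * (y-z) * ((x - y) * L)"
    by algebra
  also have "\<dots> = (x-y) * (y-z) * (q*x-y) * ((x-z) * a) + (x-y) * (x-z) * ((1-q)*y) * ((y-z) * b)"
    unfolding assms(1) by algebra
  also have "\<dots> = (x-y) * (q*x-y) * (q*x-z) * ((y-z) * c) - (y-z) * (q*x-y) * ((1-q)*z) * ((y-x) * d)
      + (x-y) * ((1-q)*y) * (q*y-z) * ((x-z) * e) + (x-z) * ((1-q)*y) * ((1-q)*z) * ((x-y) * h)"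
    unfolding assms(2,3) by algebra
  finally show ?thesis unfolding assms(4-7) .
qed

lemma braid_half':
  fixes x y z q :: "'a::idom"
  assumes "(y - z) * L = (q*y - z) * a + (1-q) * z * b"
    "(x - z) * a = (q*x - z) * c + (1-q) * z * d"
    "(x - y) * b = (q*x - y) * e + (1-q) * y * h"
    "(x - y) * c = (q*x - y) * u5 + (1-q) * y * u4"
    "(z - y) * d = (q*z - y) * u0 + (1-q) * y * u2"
    "(x - z) * e = (q*x - z) * u3 + (1-q) * z * u1"
    "(y - z) * h = (q*y - z) * u2 + (1-q) * z * u0"
  shows "(y-z) * ((x-y) * (x-z) * (y-z)) * L =
    (y-z) * (q*y-z) * (q*x-z) * ((q*x - y) * u5 + (1-q) * y * u4)
    - (x-y) * (q*y-z) * ((1-q)*z) * ((q*z - y) * u0 + (1-q) * y * u2)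
    + (y-z) * ((1-q)*z) * (q*x-y) * ((q*x - z) * u3 + (1-q) * z * u1)
    + (x-z) * ((1-q)*z) * ((1-q)*y) * ((q*y - z) * u2 + (1-q) * z * u0)"
proof -
  have "(y-z) * ((x-y) * (x-z) * (y-z)) * L = (x-y) * (x-z) * (y-z) * ((y - z) * L)"
    by algebra
  also have "\<dots> = (x-y) * (y-z) * (q*y-z) * ((x-z) * a) + (y-z) * (x-z) * ((1-q)*z) * ((x-y) * b)"
    unfolding assms(1) by algebra
  also have "\<dots> = (y-z) * (q*y-z) * (q*x-z) * ((x-y) * c) - (x-y) * (q*y-z) * ((1-q)*z) * ((z-y) * d)
      + (y-z) * ((1-q)*z) * (q*x-y) * ((x-z) * e) + (x-z) * ((1-q)*z) * ((1-q)*y) * ((y-z) * h)"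
    unfolding assms(2,3) by algebra
  finally show ?thesis unfolding assms(4-7) .
qed

text \<open>Equality of the coefficients of u0, ..., u5 in the two expansions. Their denominators
  differ by a factor x - y against y - z, whence the cross multiplication.\<close>

lemma braid_identity:
  fixes x y z q :: "'a::idom"
  shows "(y-z) * ((x-y) * (q*x-y) * (q*x-z) * ((q*y - z) * u5 + (1-q) * z * u3)
    - (y-z) * (q*x-y) * ((1-q)*z) * ((q*y - x) * u0 + (1-q) * x * u1)
    + (x-y) * ((1-q)*y) * (q*y-z) * ((q*x - z) * u4 + (1-q) * z * u2)
    + (x-z) * ((1-q)*y) * ((1-q)*z) * ((q*x - y) * u1 + (1-q) * y * u0)) =
    (x-y) * ((y-z) * (q*y-z) * (q*x-z) * ((q*x - y) * u5 + (1-q) * y * u4)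
    - (x-y) * (q*y-z) * ((1-q)*z) * ((q*z - y) * u0 + (1-q) * y * u2)
    + (y-z) * ((1-q)*z) * (q*x-y) * ((q*x - z) * u3 + (1-q) * z * u1)
    + (x-z) * ((1-q)*z) * ((1-q)*y) * ((q*y - z) * u2 + (1-q) * z * u0))"
  by algebra

lemma Top_braid:
  fixes Q :: "'k::field"
  shows "Top Q i * Top Q (Suc i) * Top Q i = Top Q (Suc i) * Top Q i * Top Q (Suc i)"
proof (rule aend_eqI)
  fix f :: "'k laurent"
  let ?x = "LX i :: 'k laurent" and ?y = "LX (Suc i) :: 'k laurent" and ?z = "LX (Suc (Suc i)) :: 'k laurent"
  let ?s = "permL (sw i) :: 'k laurent \<Rightarrow> _" and ?r = "permL (sw (Suc i)) :: 'k laurent \<Rightarrow> _"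
  let ?S = "app (Top Q i)" and ?R = "app (Top Q (Suc i))"
  let ?q = "Lsc Q :: 'k laurent"
  have braid: "?s (?r (?s g)) = ?r (?s (?r g))" for g
  proof -
    have "sw i \<circ> (sw (Suc i) \<circ> sw i) = sw (Suc i) \<circ> (sw i \<circ> sw (Suc i))" by (rule ext) (simp add: sw_def)
    then show ?thesis by (simp flip: permL_comp)
  qed
  have ss: "?s (?s g) = g" and rr: "?r (?r g) = g" for g by simp_all
  have S: "(?x - ?y) * ?S g = (?q * ?x - ?y) * ?s g + (1 - ?q) * ?y * g" for g by (rule Top_cleared)
  have R: "(?y - ?z) * ?R g = (?q * ?y - ?z) * ?r g + (1 - ?q) * ?z * g" for g by (rule Top_cleared)
  have sR: "(?x - ?z) * ?s (?R g) = (?q * ?x - ?z) * ?s (?r g) + (1 - ?q) * ?z * ?s g" for g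
    using permL_Top[of "sw i" "Suc i" Q g] by simp
  have sS: "(?y - ?x) * ?s (?S g) = (?q * ?y - ?x) * g + (1 - ?q) * ?x * ?s g" for g
    using permL_Top[of "sw i" "i" Q g] by simp
  have rR: "(?z - ?y) * ?r (?R g) = (?q * ?z - ?y) * g + (1 - ?q) * ?y * ?r g" for g
    using permL_Top[of "sw (Suc i)" "Suc i" Q g] by simp
  have rS: "(?x - ?z) * ?r (?S g) = (?q * ?x - ?z) * ?r (?s g) + (1 - ?q) * ?z * ?r g" for g
    using permL_Top[of "sw (Suc i)" "i" Q g] by simp
  have srS: "(?y - ?z) * ?s (?r (?S g)) = (?q * ?y - ?z) * ?s (?r (?s g)) + (1 - ?q) * ?z * ?s (?r g)" for g
    using permL_Top[of "sw i \<circ> sw (Suc i)" "i" Q g] by (simp add: permL_comp)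
  have rsR: "(?x - ?y) * ?r (?s (?R g)) = (?q * ?x - ?y) * ?r (?s (?r g)) + (1 - ?q) * ?y * ?r (?s g)" for g
    using permL_Top[of "sw (Suc i) \<circ> sw i" "Suc i" Q g] by (simp add: permL_comp)
  \<comment> \<open>The Vandermonde product of the three variables, the denominator shared by both
    sides.\<close>
  define D where "D = (?x - ?y) * (?x - ?z) * (?y - ?z)"
  have D: "D \<noteq> 0" by (simp add: D_def LX_inj)
  note 1 = braid_half[OF S sR R srS sS rS S, of f, folded D_def]
  note 2 = braid_half'[OF R rS S rsR rR sR R, of f, folded D_def]
  have "(?y - ?z) * ((?x - ?y) * D * ?S (?R (?S f))) = (?x - ?y) * ((?y - ?z) * D * ?R (?S (?R f)))"
    unfolding 1 2 braid[of f] by (rule braid_identity)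
  then have "((?x - ?y) * (?y - ?z) * D) * ?S (?R (?S f)) = ((?x - ?y) * (?y - ?z) * D) * ?R (?S (?R f))"
    by (simp only: ac_simps)
  moreover have "(?x - ?y) * (?y - ?z) * D \<noteq> 0" using D by (simp add: LX_inj)
  ultimately have "?S (?R (?S f)) = ?R (?S (?R f))" using mult_left_cancel by blast
  then show "app (Top Q i * Top Q (Suc i) * Top Q i) f = app (Top Q (Suc i) * Top Q i * Top Q (Suc i)) f"
    by simp
qed

subsection \<open>The polynomial representation\<close>

definition gop :: "nat \<Rightarrow> nat \<Rightarrow> hgen \<Rightarrow> 'k::field laurent aend" where
  "gop n q g = (if \<not> valid_gen n g then 0 else
     (case g of GT i \<Rightarrow> Top (of_nat q) i | GX j \<Rightarrow> emul (LX j) | GXi j \<Rightarrow> emul (LXinv j)))"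

definition wop :: "nat \<Rightarrow> nat \<Rightarrow> hgen list \<Rightarrow> 'k::field laurent aend" where
  "wop n q u = prod_list (map (gop n q) u)"

definition act :: "nat \<Rightarrow> nat \<Rightarrow> 'k::field falg \<Rightarrow> 'k laurent aend" where
  "act n q = pm_sum (\<lambda>u c. emul (Lsc c) * wop n q u)"

lemma app_gop: "app (gop n q g) f = actGen n q g f"
  by (auto simp: gop_def actGen_def app_Top split: hgen.split)

lemma app_wop: "app (wop n q u) f = foldr (actGen n q) u f"
  by (induction u) (simp_all add: wop_def app_gop)

lemma actF_eq_app: "actF n q x f = app (act n q x) f"
  by (simp add: actF_def act_def pm_sum_def app_sum app_wop)

lemma act_0 [simp]: "act n q 0 = 0"
  by (simp add: act_def)

lemma act_add: "act n q (x + y) = act n q x + act n q y"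
  unfolding act_def by (rule pm_sum_add) (simp_all add: Lsc_add emul_add distrib_right)

lemma act_uminus: "act n q (- x) = - act n q x"
  using act_add[of n q x "- x"] by (simp add: eq_neg_iff_add_eq_0 add.commute)

lemma act_diff: "act n q (x - y) = act n q x - act n q y"
  using act_add[of n q x "- y"] by (simp add: act_uminus)

lemma act_sum: "act n q (sum f I) = (\<Sum>i\<in>I. act n q (f i))"
  by (induction I rule: infinite_finite_induct) (auto simp: act_add)

lemma act_single: "act n q (Poly_Mapping.single u c) = emul (Lsc c) * wop n q u"
  unfolding act_def by (rule pm_sum_single) simp

lemma act_fsc: "act n q (fsc c) = emul (Lsc c)"
  by (simp add: fsc_def act_single wop_def)

lemma act_fgen: "act n q (fgen g) = gop n q g"
  by (simp add: fgen_def act_single wop_def)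

lemma ddiff_scalar: "ddiff i (Lsc c * f) = Lsc c * ddiff i f"
  by (rule ddiff_eqI) (simp add: permL_mult mult.left_commute ddiff right_diff_distrib)

lemma Top_scalar: "Top Q i * emul (Lsc c) = emul (Lsc c) * Top Q i"
  by (rule aend_eqI) (simp only: app_simps app_emul app_Top ddiff_scalar, simp add: algebra_simps)

lemma gop_scalar: "gop n q g * emul (Lsc c) = emul (Lsc c) * gop n q g"
  by (auto simp: gop_def Top_scalar emul_commute split: hgen.split)

lemma wop_scalar: "wop n q u * emul (Lsc c) = emul (Lsc c) * wop n q u"
proof (induction u)
  case (Cons g u)
  have "wop n q (g # u) * emul (Lsc c) = gop n q g * (wop n q u * emul (Lsc c))"
    by (simp add: wop_def mult.assoc)
  also have "\<dots> = (gop n q g * emul (Lsc c)) * wop n q u"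
    by (simp add: Cons mult.assoc)
  finally show ?case by (simp add: gop_scalar wop_def mult.assoc)
qed (simp add: wop_def)

lemma wop_append: "wop n q (u @ v) = wop n q u * wop n q v"
  by (simp add: wop_def)

lemma act_mult: "act n q (x * y) = act n q x * act n q y"
proof (induction x rule: poly_mapping_additive_induct)
  case (single u c)
  show ?case
  proof (induction y rule: poly_mapping_additive_induct)
    case (single v d)
    have "act n q (Poly_Mapping.single u c) * act n q (Poly_Mapping.single v d)
       = emul (Lsc c) * (wop n q u * emul (Lsc d)) * wop n q v"
      by (simp add: act_single mult.assoc)
    also have "\<dots> = act n q (Poly_Mapping.single u c * Poly_Mapping.single v d)"
      by (simp add: wop_scalar act_single mult_single plus_list_def wop_append Lsc_mult emul_mult mult.assoc)
    finally show ?case ..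
  qed (simp_all add: act_add distrib_left)
qed (simp_all add: act_add distrib_right)

lemma act_1 [simp]: "act n q 1 = 1"
  using act_fsc[of n q 1] by simp

lemma act_prod_list: "act n q (prod_list xs) = prod_list (map (act n q) xs)"
  by (induction xs) (simp_all add: act_mult)

text \<open>Divided differences are linear over the polynomials fixed by the swap.\<close>

lemma Top_commute_mul:
  fixes Q :: "'k::field"
  assumes "permL (sw i) p = p"
  shows "Top Q i * emul p = emul p * Top Q i"
proof (rule aend_eqI)
  fix f :: "'k laurent"
  have "ddiff i (p * f) = p * ddiff i f"
    by (rule ddiff_eqI) (simp add: permL_mult assms mult.left_commute ddiff right_diff_distrib)
  then show "app (Top Q i * emul p) f = app (emul p * Top Q i) f"
    by (simp add: app_Top algebra_simps)
qed

text \<open>The operators involve disjoint pairs of variables, so each swap fixes the denominator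
  and the coefficients of the other operator.\<close>

lemma Top_Top_commute:
  fixes Q :: "'k::field"
  assumes "Suc i < j"
  shows "Top Q i * Top Q j = Top Q j * Top Q i"
proof (rule aend_eqI)
  fix f :: "'k laurent"
  let ?x = "LX i :: 'k laurent" and ?y = "LX (Suc i) :: 'k laurent"
    and ?z = "LX j :: 'k laurent" and ?w = "LX (Suc j) :: 'k laurent"
  let ?s = "permL (sw i) :: 'k laurent \<Rightarrow> _" and ?r = "permL (sw j) :: 'k laurent \<Rightarrow> _"
  let ?S = "app (Top Q i)" and ?R = "app (Top Q j)"
  have sr: "?s (?r g) = ?r (?s g)" for g
  proof -
    have "sw i \<circ> sw j = sw j \<circ> sw i" by (rule ext) (use assms in \<open>simp add: sw_def\<close>)
    then show ?thesis by (simp flip: permL_comp)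
  qed
  have S: "(?x - ?y) * ?S g = (Lsc Q * ?x - ?y) * ?s g + (1 - Lsc Q) * ?y * g" for g by (rule Top_cleared)
  have R: "(?z - ?w) * ?R g = (Lsc Q * ?z - ?w) * ?r g + (1 - Lsc Q) * ?w * g" for g by (rule Top_cleared)
  have sR: "(?z - ?w) * ?s (?R g) = (Lsc Q * ?z - ?w) * ?s (?r g) + (1 - Lsc Q) * ?w * ?s g" for g
    using permL_Top[of "sw i" j Q g] assms by simp
  have rS: "(?x - ?y) * ?r (?S g) = (Lsc Q * ?x - ?y) * ?r (?s g) + (1 - Lsc Q) * ?y * ?r g" for g
    using permL_Top[of "sw j" i Q g] assms by simp
  have 1: "(?z - ?w) * ((?x - ?y) * ?S (?R f)) =
     (Lsc Q * ?x - ?y) * ((?z - ?w) * ?s (?R f)) + (1 - Lsc Q) * ?y * ((?z - ?w) * ?R f)"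
    unfolding S by algebra
  have 2: "(?x - ?y) * ((?z - ?w) * ?R (?S f)) =
     (Lsc Q * ?z - ?w) * ((?x - ?y) * ?r (?S f)) + (1 - Lsc Q) * ?w * ((?x - ?y) * ?S f)"
    unfolding R by algebra
  have "(?z - ?w) * ((?x - ?y) * ?S (?R f)) = (?x - ?y) * ((?z - ?w) * ?R (?S f))"
    unfolding 1 2 unfolding sR R S rS sr by algebra
  then have "(?x - ?y) * ((?z - ?w) * ?S (?R f)) = (?x - ?y) * ((?z - ?w) * ?R (?S f))"
    by (simp only: ac_simps)
  then show "app (Top Q i * Top Q j) f = app (Top Q j * Top Q i) f"
    by (simp add: LX_inj)
qed

lemma Top_LX_Top:
  fixes Q :: "'k::field"
  shows "Top Q i * emul (LX i) * Top Q i = emul (Lsc Q) * emul (LX (Suc i))"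
proof (rule aend_eqI)
  fix f :: "'k laurent"
  let ?x = "LX i :: 'k laurent" and ?y = "LX (Suc i) :: 'k laurent"
  let ?s = "permL (sw i) :: 'k laurent \<Rightarrow> _" and ?S = "app (Top Q i)"
  have 1: "(?x - ?y) * ?S (?x * ?S f) = (Lsc Q * ?x - ?y) * (?y * ?s (?S f)) + (1 - Lsc Q) * ?y * (?x * ?S f)"
    using Top_cleared[of i Q "?x * ?S f"] by (simp add: permL_mult)
  have 2: "(?y - ?x) * ?s (?S f) = (Lsc Q * ?y - ?x) * f + (1 - Lsc Q) * ?x * ?s f"
    using permL_Top[of "sw i" i Q f] by simp
  have 3: "(?x - ?y) * ?S f = (Lsc Q * ?x - ?y) * ?s f + (1 - Lsc Q) * ?y * f" by (rule Top_cleared)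
  have "(?x - ?y) * ((?x - ?y) * ?S (?x * ?S f))
      = - ((Lsc Q * ?x - ?y) * ?y * ((?y - ?x) * ?s (?S f))) + (1 - Lsc Q) * ?y * ?x * ((?x - ?y) * ?S f)"
    unfolding 1 by algebra
  also have "\<dots> = (?x - ?y) * ((?x - ?y) * (Lsc Q * ?y * f))"
    unfolding 2 3 by algebra
  finally have "?S (?x * ?S f) = Lsc Q * ?y * f"
    by (simp add: LX_inj)
  then show "app (Top Q i * emul (LX i) * Top Q i) f = app (emul (Lsc Q) * emul (LX (Suc i))) f"
    by (simp add: mult.assoc)
qed

lemma act_TG: "1 \<le> i \<Longrightarrow> i < n \<Longrightarrow> act n q (TG i) = Top (of_nat q) i"
  and act_XG: "1 \<le> j \<Longrightarrow> j \<le> n \<Longrightarrow> act n q (XG j) = emul (LX j)"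
  and act_XiG: "1 \<le> j \<Longrightarrow> j \<le> n \<Longrightarrow> act n q (XiG j) = emul (LXinv j)"
  by (simp_all add: act_fgen gop_def valid_gen_def)

lemma act_relations:
  fixes r :: "'k::field falg"
  assumes "r \<in> relations n q"
  shows "act n q r = 0"
  using assms unfolding relations_def Un_iff
proof (elim disjE)
  assume "r \<in> {fgen g |g. \<not> valid_gen n g}"
  then show ?thesis by (auto simp: act_fgen gop_def)
next
  assume "r \<in> {fmul (TG i - fsc (of_nat q)) (TG i + fsc 1) |i. 1 \<le> i \<and> i < n}"
  then obtain i where i: "1 \<le> i" "i < n" "r = (TG i - fsc (of_nat q)) * (TG i + 1)"
    by (auto simp: fmul_eq_times)
  have "act n q r = (Top (of_nat q) i - emul (Lsc (of_nat q))) * (Top (of_nat q) i + 1)"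
    using i by (simp add: act_mult act_diff act_add act_TG act_fsc)
  also have "\<dots> = 0"
    by (simp add: algebra_simps Top_quadratic Lsc_diff emul_diff)
  finally show ?thesis .
next
  assume "r \<in> {fmul (TG i) (TG j) - fmul (TG j) (TG i) |i j. 1 \<le> i \<and> i < n \<and> 1 \<le> j \<and> j < n \<and> Suc i < j}"
  then show ?thesis
    by (auto simp: fmul_eq_times act_mult act_diff act_TG dest: Top_Top_commute)
qed (auto simp: fmul_eq_times fprod_eq_prod_list act_mult act_diff act_TG act_XG act_XiG act_fsc
  emul_mult[symmetric] mult.commute Top_commute_mul Top_braid[unfolded mult.assoc]
  Top_LX_Top[unfolded mult.assoc emul_mult[symmetric]])

subsection \<open>Congruence modulo the defining relations\<close>

lemma hideal_mult_left: "x \<in> hideal R \<Longrightarrow> y * x \<in> hideal R"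
proof (induction x rule: hideal.induct)
  case (gen r u c v)
  show ?case
  proof (induction y rule: poly_mapping_additive_induct)
    case (single w d)
    have "Poly_Mapping.single w d * fmul (fmul (Poly_Mapping.single u c) r) (Poly_Mapping.single v 1)
       = fmul (fmul (Poly_Mapping.single (w @ u) (d * c)) r) (Poly_Mapping.single v 1)"
      by (simp add: fmul_eq_times mult.assoc[symmetric] mult_single plus_list_def)
    then show ?case using gen by (simp add: hideal.gen)
  qed (auto simp: distrib_right intro: hideal.intros)
qed (auto simp: distrib_left intro: hideal.intros)

text \<open>The generators of the ideal carry their scalar on the left only, so the scalar of a
  right factor is first moved across by \<open>fsc_commute\<close>.\<close>

lemma hideal_mult_right: "x \<in> hideal R \<Longrightarrow> x * y \<in> hideal R"
proof (induction x rule: hideal.induct)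
  case (gen r u c v)
  show ?case
  proof (induction y rule: poly_mapping_additive_induct)
    case (single w d)
    have "fmul (fmul (Poly_Mapping.single u c) r) (Poly_Mapping.single v 1) * Poly_Mapping.single w d
       = Poly_Mapping.single u c * r * (Poly_Mapping.single (v @ w) 1 * fsc d)"
      by (simp add: fmul_eq_times mult.assoc fsc_def mult_single plus_list_def)
    also have "\<dots> = fsc d * Poly_Mapping.single u c * r * Poly_Mapping.single (v @ w) 1"
      by (metis fsc_commute mult.assoc)
    also have "\<dots> = fmul (fmul (Poly_Mapping.single u (d * c)) r) (Poly_Mapping.single (v @ w) 1)"
      by (simp add: fmul_eq_times fsc_def mult_single plus_list_def)
    finally show ?case using gen by (simp add: hideal.gen)
  qed (auto simp: distrib_left intro: hideal.intros)
qed (auto simp: distrib_right intro: hideal.intros)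

lemma hideal_uminus: "x \<in> hideal R \<Longrightarrow> - x \<in> hideal R"
  using hideal_mult_left[of x R "- 1"] by simp

lemma hideal_relation: "r \<in> R \<Longrightarrow> r \<in> hideal R"
  using hideal.gen[of r R "[]" 1 "[]"] by (simp add: fmul_eq_times single_Nil_1)

lemma heq_refl [simp, intro]: "heq n q x x"
  by (simp add: heq_def hideal.zero)
lemma heq_sym: "heq n q x y \<Longrightarrow> heq n q y x"
  unfolding heq_def using hideal_uminus by fastforce
lemma heq_trans [trans]: "heq n q x y \<Longrightarrow> heq n q y z \<Longrightarrow> heq n q x z"
  unfolding heq_def using hideal.add by fastforce
lemma heq_add: "heq n q x y \<Longrightarrow> heq n q z w \<Longrightarrow> heq n q (x + z) (y + w)"
  unfolding heq_def using hideal.add by (fastforce simp: algebra_simps)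
lemma heq_mult_left: "heq n q x y \<Longrightarrow> heq n q (z * x) (z * y)"
  unfolding heq_def using hideal_mult_left by (metis right_diff_distrib)
lemma heq_mult_right: "heq n q x y \<Longrightarrow> heq n q (x * z) (y * z)"
  unfolding heq_def using hideal_mult_right by (metis left_diff_distrib)
lemma heq_diff: "heq n q x y \<Longrightarrow> heq n q z w \<Longrightarrow> heq n q (x - z) (y - w)"
  using heq_add[of n q x y "- z" "- w"] heq_mult_left[of n q z w "-1"] by simp
lemma heq_sum: "(\<And>i. i \<in> I \<Longrightarrow> heq n q (f i) (g i)) \<Longrightarrow> heq n q (sum f I) (sum g I)"
  by (induction I rule: infinite_finite_induct) (auto intro: heq_add)

lemma heq_imp_act_eq:
  assumes "heq n q x (y :: 'k::field falg)" shows "act n q x = act n q y"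
proof -
  have "act n q z = 0" if "z \<in> hideal (relations n q)" for z :: "'k falg"
    using that by induction (simp_all add: fmul_eq_times act_mult act_add act_relations)
  then have "act n q (x - y) = 0" using assms by (simp add: heq_def)
  then show ?thesis by (simp add: act_diff)
qed

subsection \<open>Affine permutations of the integers\<close>

text \<open>\<open>Wset n\<close> acts faithfully on the integers, commuting with translation by \<open>n\<close>: permutations
  act on \<open>1, \<dots>, n\<close> and \<open>X_i\<close> sends \<open>i\<close> to \<open>i - n\<close>, so that \<open>tau\<close> is translation by \<open>-1\<close>.
  The length becomes the number of inversions up to translation.\<close>

definition zp :: "nat \<Rightarrow> waff \<Rightarrow> int \<Rightarrow> int" where
  "zp n w k = int (fst w (nat ((k - 1) mod int n + 1)))
     + int n * ((k - 1) div int n - snd w (nat ((k - 1) mod int n + 1)))"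

text \<open>The simple reflection on the integers, exchanging i + m n and i + 1 + m n for every m.
  The index is an arbitrary integer and counts modulo n, so conjugation by translations stays inside
  the family.\<close>

definition SI :: "nat \<Rightarrow> int \<Rightarrow> int \<Rightarrow> int" where
  "SI n i k = (if (k - i) mod int n = 0 then k + 1 else if (k - i - 1) mod int n = 0 then k - 1 else k)"

definition periodic :: "nat \<Rightarrow> (int \<Rightarrow> int) \<Rightarrow> bool" where
  "periodic n f \<longleftrightarrow> (\<forall>k. f (k + int n) = f k + int n)"

text \<open>Inversions modulo translation by n, normalised by a first entry in a window of length n.
  The start a is free because the count is easiest when the window starts at the reflected
  position.\<close>

definition Inv :: "nat \<Rightarrow> int \<Rightarrow> (int \<Rightarrow> int) \<Rightarrow> (int \<times> int) set" where
  "Inv n a f = {(i, j). a \<le> i \<and> i < a + int n \<and> i < j \<and> f j < f i}"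

text \<open>The total exponent of the X-part: a homomorphism to the integers that is 0 on
  \<open>s_0, ..., s_(n-1)\<close> and 1 on \<open>tau\<close>. It identifies the power of
  \<open>tau\<close> in an expression.\<close>

definition wdeg :: "nat \<Rightarrow> waff \<Rightarrow> int" where
  "wdeg n w = (\<Sum>i\<in>{1..n}. snd w i)"

lemma periodic_mult: "periodic n f \<Longrightarrow> f (k + int n * m) = f k + int n * m"
proof (induction m rule: int_induct[where k = 0])
  case (step1 i)
  then have "f ((k + int n * i) + int n) = f (k + int n * i) + int n" by (simp add: periodic_def)
  then show ?case using step1 by (simp add: algebra_simps)
next
  case (step2 i)
  then have "f ((k + int n * (i - 1)) + int n) = f (k + int n * (i - 1)) + int n" by (simp only: periodic_def)
  moreover have "(k + int n * (i - 1)) + int n = k + int n * i" by (simp add: algebra_simps)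
  ultimately show ?case using step2 by (simp add: algebra_simps)
qed simp

lemma mod_eq_0_window:
  assumes "(k - a) mod int n = 0" "a \<le> k" "k < a + int n"
  shows "k = a"
  using assms by (metis add.commute diff_add_cancel diff_ge_0_iff_ge diff_less_eq mod_pos_pos_trivial add_0)

lemma small_multiple:
  assumes "int n dvd x" "\<bar>x\<bar> < int n" shows "x = 0"
proof (rule ccontr)
  assume "x \<noteq> 0"
  then show False using dvd_imp_le_int[OF _ assms(1)] assms(2) by simp
qed

lemma periodic_comp: "periodic n f \<Longrightarrow> periodic n g \<Longrightarrow> periodic n (f \<circ> g)"
  by (simp add: periodic_def)
lemma periodic_shift: "periodic n (\<lambda>k. k + c)"
  by (simp add: periodic_def)
lemma periodic_id: "periodic n id"
  by (simp add: periodic_def)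
lemma periodic_SI: "periodic n (SI n i)"
proof -
  have "(k + int n - i) mod int n = (k - i) mod int n" "(k + int n - i - 1) mod int n = (k - i - 1) mod int n" for k
    using mod_add_self2[of "k - i" "int n"] mod_add_self2[of "k - i - 1" "int n"]
    by (simp_all add: algebra_simps)
  then show ?thesis by (simp add: periodic_def SI_def)
qed

locale affine_sym =
  fixes n :: nat
  assumes n2: "n \<ge> 2"
begin

lemma zp_rep:
  assumes "1 \<le> i" "i \<le> n"
  shows "zp n w (int i + int n * m) = int (fst w i) + int n * (m - snd w i)"
proof -
  have 1: "int i + int n * m - 1 = (int i - 1) + int n * m" by simp
  have "(int i + int n * m - 1) mod int n = int i - 1" unfolding 1 using assms by simp
  moreover have "(int i + int n * m - 1) div int n = m" unfolding 1 using assms by simp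
  ultimately show ?thesis unfolding zp_def by simp
qed

lemma zp_rep0: "1 \<le> i \<Longrightarrow> i \<le> n \<Longrightarrow> zp n w (int i) = int (fst w i) - int n * snd w i"
  using zp_rep[of i w 0] by simp

lemma int_rep:
  obtains i m where "1 \<le> i" "i \<le> n" "k = int i + int n * m"
proof
  let ?i = "nat ((k - 1) mod int n + 1)"
  have p: "0 \<le> (k - 1) mod int n" "(k - 1) mod int n < int n" using n2 by simp_all
  then show "1 \<le> ?i" "?i \<le> n" by linarith+
  have "k - 1 = (k - 1) mod int n + int n * ((k - 1) div int n)" by simp
  then show "k = int ?i + int n * ((k - 1) div int n)" using p by linarith
qed

lemma periodic_zp: "periodic n (zp n w)"
  unfolding periodic_def
proof
  fix k
  obtain i m where i: "1 \<le> i" "i \<le> n" "k = int i + int n * m" by (rule int_rep)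
  have "k + int n = int i + int n * (m + 1)" using i by (simp add: algebra_simps)
  then show "zp n w (k + int n) = zp n w k + int n"
    using i zp_rep[of i w "m + 1"] zp_rep[of i w m] by (simp add: algebra_simps)
qed

lemma periodic_eqI:
  assumes "periodic n f" "periodic n g" "\<And>i. 1 \<le> i \<Longrightarrow> i \<le> n \<Longrightarrow> f (int i) = g (int i)"
  shows "f = g"
proof
  fix k
  obtain i m where i: "1 \<le> i" "i \<le> n" "k = int i + int n * m" by (rule int_rep)
  then show "f k = g k" using assms periodic_mult by metis
qed

lemma Wset_fst: "w \<in> Wset n \<Longrightarrow> 1 \<le> i \<Longrightarrow> i \<le> n \<Longrightarrow> 1 \<le> fst w i \<and> fst w i \<le> n"
  using permutes_in_image[of "fst w" "{1..n}" i] by (auto simp: Wset_def)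

lemma zp_wmul: "b \<in> Wset n \<Longrightarrow> zp n (wmul a b) = zp n a \<circ> zp n b"
proof (rule periodic_eqI)
  fix i assume b: "b \<in> Wset n" and i: "1 \<le> i" "i \<le> n"
  have "zp n a (zp n b (int i)) = zp n a (int (fst b i) + int n * (- snd b i))"
    using zp_rep0[OF i, of b] by simp
  also have "\<dots> = int (fst a (fst b i)) + int n * (- snd b i - snd a (fst b i))"
    using Wset_fst[OF b i] by (intro zp_rep) auto
  also have "\<dots> = zp n (wmul a b) (int i)"
    unfolding zp_rep0[OF i] by (simp add: wmul_def algebra_simps)
  finally show "zp n (wmul a b) (int i) = (zp n a \<circ> zp n b) (int i)" by simp
qed (auto intro: periodic_comp periodic_zp)

lemma wone_in: "wone \<in> Wset n"
  by (auto simp: wone_def Wset_def permutes_id)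

lemma wmul_in: "a \<in> Wset n \<Longrightarrow> b \<in> Wset n \<Longrightarrow> wmul a b \<in> Wset n"
  unfolding Wset_def wmul_def by (auto simp: permutes_compose permutes_not_in)

lemma winv_in: "a \<in> Wset n \<Longrightarrow> winv a \<in> Wset n"
  unfolding Wset_def winv_def using permutes_not_in[OF permutes_inv[of "fst a" "{1..n}"]]
  by (auto simp: permutes_inv simp del: atLeastAtMost_iff)

lemma wmul_assoc: "wmul (wmul a b) c = wmul a (wmul b c)"
  by (auto simp: wmul_def)

lemma wmul_one [simp]: "wmul wone a = a" "wmul a wone = a"
  by (simp_all add: wmul_def wone_def)

lemma wmul_winv: "a \<in> Wset n \<Longrightarrow> wmul a (winv a) = wone" "a \<in> Wset n \<Longrightarrow> wmul (winv a) a = wone"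
  by (auto simp: wmul_def wone_def winv_def Wset_def permutes_inverses permutes_inv_o)

lemma wmul_cancel_left: "a \<in> Wset n \<Longrightarrow> wmul a b = wmul a c \<Longrightarrow> b = c"
  by (metis wmul_assoc wmul_one(1) wmul_winv(2))
lemma wmul_cancel_right: "a \<in> Wset n \<Longrightarrow> wmul b a = wmul c a \<Longrightarrow> b = c"
  by (metis wmul_assoc wmul_one(2) wmul_winv(1))

lemma wdeg_wmul:
  assumes "a \<in> Wset n" "b \<in> Wset n" shows "wdeg n (wmul a b) = wdeg n a + wdeg n b"
proof -
  have "(\<Sum>i\<in>{1..n}. snd a (fst b i)) = (\<Sum>i\<in>{1..n}. snd a i)"
    using sum.permute[of "fst b" "{1..n}" "snd a"] assms by (simp add: Wset_def comp_def)
  then show ?thesis by (simp add: wdeg_def wmul_def sum.distrib)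
qed

lemma zp_wone: "zp n wone = id"
  by (rule periodic_eqI) (simp_all add: periodic_zp periodic_id zp_rep0, simp add: wone_def)

text \<open>Values on 1, ..., n determine the permutation as residues modulo n, and then the
  exponents as quotients.\<close>

lemma zp_inj:
  assumes "a \<in> Wset n" "b \<in> Wset n" "zp n a = zp n b" shows "a = b"
proof -
  have *: "fst a i = fst b i \<and> snd a i = snd b i" for i
  proof (cases "1 \<le> i \<and> i \<le> n")
    case True
    then have eq: "int (fst a i) - int n * snd a i = int (fst b i) - int n * snd b i"
      using assms(3) zp_rep0[of i a] zp_rep0[of i b] by simp
    have r: "1 \<le> fst a i" "fst a i \<le> n" "1 \<le> fst b i" "fst b i \<le> n"
      using Wset_fst[OF assms(1)] Wset_fst[OF assms(2)] True by auto
    have "int n dvd (int (fst a i) - int (fst b i))"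
      using eq by (intro dvdI[of _ _ "snd a i - snd b i"]) (simp add: algebra_simps)
    moreover have "\<bar>int (fst a i) - int (fst b i)\<bar> < int n" using r by linarith
    ultimately have "int (fst a i) - int (fst b i) = 0" by (rule small_multiple)
    then show ?thesis using eq n2 by simp
  next
    case False
    then have i: "i \<notin> {1..n}" by auto
    have "fst a i = i" "fst b i = i"
      using assms(1,2) permutes_not_in[OF _ i] unfolding Wset_def by blast+
    moreover have "snd a i = 0" "snd b i = 0"
      using assms(1,2) i unfolding Wset_def by blast+
    ultimately show ?thesis by simp
  qed
  have "fst a = fst b" "snd a = snd b" using * by (simp_all add: fun_eq_iff)
  then show ?thesis by (rule prod_eqI)
qed

lemma zp_winv_comp:
  assumes "w \<in> Wset n"
  shows "zp n (winv w) (zp n w k) = k" "zp n w (zp n (winv w) k) = k"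
proof -
  have "zp n (winv w) \<circ> zp n w = id" "zp n w \<circ> zp n (winv w) = id"
    using zp_wmul[of w "winv w"] zp_wmul[of "winv w" w] assms winv_in[OF assms]
    by (simp_all add: wmul_winv zp_wone)
  then show "zp n (winv w) (zp n w k) = k" "zp n w (zp n (winv w) k) = k"
    by (simp_all add: fun_eq_iff)
qed

lemma inj_zp: "w \<in> Wset n \<Longrightarrow> inj (zp n w)"
  by (rule inj_on_inverseI[where g = "zp n (winv w)"]) (rule zp_winv_comp)

lemma surj_zp: "w \<in> Wset n \<Longrightarrow> surj (zp n w)"
  by (rule surjI[where f = "zp n (winv w)"]) (rule zp_winv_comp)

lemma sw_permutes:
  assumes i: "1 \<le> i" "i < n"
  shows "sw i permutes {1..n}"
proof -
  have eq: "sw i = transpose i (Suc i)" by (auto simp: sw_def transpose_def)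
  show ?thesis unfolding eq by (rule permutes_swap_id) (use i in auto)
qed

lemma sfin_in: "1 \<le> i \<Longrightarrow> i < n \<Longrightarrow> sfin i \<in> Wset n"
  using sw_permutes[of i] by (simp add: sfin_def Wset_def)

lemma wprodS_Nil [simp]: "wprodS [] = wone" by (simp add: wprodS_def)
lemma wprodS_Cons [simp]: "wprodS (i # is) = wmul (sfin i) (wprodS is)" by (simp add: wprodS_def)
lemma wprodA_Nil [simp]: "wprodA n [] = wone" by (simp add: wprodA_def)
lemma wprodA_Cons [simp]: "wprodA n (i # is) = wmul (sgen n i) (wprodA n is)" by (simp add: wprodA_def)

lemma wprodS_in: "set is \<subseteq> {1..<n} \<Longrightarrow> wprodS is \<in> Wset n"
  by (induction "is") (auto intro!: wmul_in sfin_in wone_in)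

lemma wprodS_append: "wprodS (is @ js) = wmul (wprodS is) (wprodS js)"
  by (induction "is") (simp_all add: wmul_assoc)
lemma wprodA_append: "wprodA n (is @ js) = wmul (wprodA n is) (wprodA n js)"
  by (induction "is") (simp_all add: wmul_assoc)

lemma zp_sfin: "1 \<le> i \<Longrightarrow> i < n \<Longrightarrow> zp n (sfin i) = SI n (int i)"
proof (rule periodic_eqI)
  fix j assume i: "1 \<le> i" "i < n" and j: "1 \<le> j" "j \<le> n"
  have z: "zp n (sfin i) (int j) = int (sw i j)" using j by (simp add: zp_rep0 sfin_def)
  have d1: "(int j - int i) mod int n = 0 \<longleftrightarrow> j = i"
  proof
    assume "(int j - int i) mod int n = 0"
    then have "int n dvd int j - int i" by (simp add: mod_eq_0_iff_dvd)
    moreover have "\<bar>int j - int i\<bar> < int n" using i j by linarith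
    ultimately have "int j - int i = 0" by (rule small_multiple)
    then show "j = i" by simp
  qed simp
  have d2: "(int j - int i - 1) mod int n = 0 \<longleftrightarrow> j = Suc i"
  proof
    assume "(int j - int i - 1) mod int n = 0"
    then have "int n dvd int j - int i - 1" by (simp add: mod_eq_0_iff_dvd)
    moreover have "\<bar>int j - int i - 1\<bar> < int n" using i j by linarith
    ultimately have "int j - int i - 1 = 0" by (rule small_multiple)
    then show "j = Suc i" by simp
  qed simp
  show "zp n (sfin i) (int j) = SI n (int i) (int j)"
    unfolding z SI_def d1 d2 by (auto simp: sw_def)
qed (auto intro: periodic_zp periodic_SI)

lemma foldr_sw_up: "k \<le> n \<Longrightarrow> fst (wprodS [k..<n]) j = (if j = n then k else if k \<le> j \<and> j < n then Suc j else j)"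
proof (induction k rule: inc_induct)
  case base
  then show ?case by (simp add: wone_def)
next
  case (step m)
  then show ?case by (simp add: upt_conv_Cons wmul_def sfin_def sw_def)
qed

lemma foldr_sw_down: "k \<le> m \<Longrightarrow> fst (wprodS (rev [k..<m])) j = (if j = k then m else if k < j \<and> j \<le> m then j - 1 else j)"
proof (induction m rule: dec_induct)
  case base
  then show ?case by (simp add: wone_def)
next
  case (step m)
  then show ?case by (auto simp: wmul_def sfin_def sw_def)
qed

lemma snd_wprodS [simp]: "snd (wprodS is) = (\<lambda>_. 0)"
  by (induction "is") (simp_all add: wmul_def wone_def sfin_def)

lemma tau_in: "tau n \<in> Wset n"
proof -
  have "(id, ex 1) \<in> Wset n" using n2 by (auto simp: Wset_def ex_def permutes_id)
  then show ?thesis unfolding tau_def by (intro wmul_in wprodS_in) auto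
qed

lemma s0_in: "s0 n \<in> Wset n"
proof -
  have "(id, \<lambda>k. ex 1 k - ex n k) \<in> Wset n" using n2 by (auto simp: Wset_def ex_def permutes_id)
  then show ?thesis unfolding s0_def using n2 by (intro wmul_in wprodS_in) auto
qed

lemma zp_tau: "zp n (tau n) = (\<lambda>k. k - 1)"
proof (rule periodic_eqI)
  fix i assume i: "1 \<le> i" "i \<le> n"
  have "fst (tau n) i = (if i = 1 then n else i - 1)"
    unfolding tau_def using foldr_sw_down[of 1 n i] i n2 by (auto simp: wmul_def)
  moreover have "snd (tau n) i = (if i = 1 then 1 else 0)"
    unfolding tau_def by (simp add: wmul_def ex_def)
  ultimately show "zp n (tau n) (int i) = int i - 1" using i by (simp add: zp_rep0)
qed (use periodic_shift[where c = "-1"] in \<open>auto intro: periodic_zp\<close>)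

lemma zp_s0: "zp n (s0 n) = SI n 0"
proof (rule periodic_eqI)
  fix i assume i: "1 \<le> i" "i \<le> n"
  let ?w = "wmul (wprodS (rev [2..<n])) (wmul (sfin 1) (wprodS [2..<n]))"
  have f: "fst (s0 n) i = (if i = 1 then n else if i = n then 1 else i)"
  proof -
    have "fst (s0 n) i = fst (wprodS (rev [2..<n])) (sw 1 (fst (wprodS [2..<n]) i))"
      unfolding s0_def by (simp add: wprodS_append wmul_def sfin_def)
    then show ?thesis
      using foldr_sw_up[of 2 i] foldr_sw_down[of 2 n] n2 i by (auto simp: sw_def)
  qed
  have s: "snd (s0 n) i = (if i = 1 then 1 else if i = n then -1 else 0)"
    unfolding s0_def using n2 by (simp add: wmul_def ex_def)
  have d1: "int i mod int n = 0 \<longleftrightarrow> i = n"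
    using i by (metis dvd_imp_le le_antisym mod_0_imp_dvd mod_self of_nat_mod of_nat_eq_0_iff less_eq_Suc_le One_nat_def)
  have d2: "(int i - 1) mod int n = 0 \<longleftrightarrow> i = 1"
    using i by (auto simp: mod_pos_pos_trivial)
  show "zp n (s0 n) (int i) = SI n 0 (int i)"
    unfolding zp_rep0[OF i] f s SI_def using d1 d2 i n2 by auto
qed (auto intro: periodic_zp periodic_SI)

lemma sgen_in: "k < n \<Longrightarrow> sgen n k \<in> Wset n"
  by (auto simp: sgen_def intro: sfin_in s0_in)

lemma zp_sgen: "k < n \<Longrightarrow> zp n (sgen n k) = SI n (int k)"
  using zp_sfin zp_s0 by (auto simp: sgen_def)

lemma wprodA_in: "set is \<subseteq> {..<n} \<Longrightarrow> wprodA n is \<in> Wset n"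
  by (induction "is") (auto intro!: wmul_in sgen_in wone_in)

end

subsection \<open>Inversions and length\<close>

lemma SI_invol:
  assumes n: "n \<ge> 2"
  shows "SI n i (SI n i k) = k"
proof -
  have 1: "\<not> (int n dvd (x - 1) \<and> int n dvd x)" for x
  proof
    assume "int n dvd (x - 1) \<and> int n dvd x"
    then have "int n dvd x - (x - 1)" by (meson dvd_diff)
    then show False using n by simp
  qed
  show ?thesis
    using 1[of "k - i"] 1[of "k - i + 1"] by (auto simp: SI_def mod_eq_0_iff_dvd algebra_simps)
qed

lemma inj_SI: "n \<ge> 2 \<Longrightarrow> inj (SI n i)"
  by (rule inj_on_inverseI[where g = "SI n i"]) (rule SI_invol)

lemma SI_self: "SI n i i = i + 1" by (simp add: SI_def)
lemma SI_Suc: "n \<ge> 2 \<Longrightarrow> SI n i (i + 1) = i"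
  using SI_invol[of n i i] by (simp add: SI_self)

lemma SI_near: "\<bar>SI n i k - k\<bar> \<le> 1" by (simp add: SI_def)

lemma SI_up: "SI n i k = k + 1 \<Longrightarrow> (k - i) mod int n = 0"
  by (simp add: SI_def split: if_splits)

text \<open>The window starting at a contains a and a + 1 and no other point moved by the
  reflection, so it is stable; a window starting at a + 1 would not be.\<close>

lemma SI_window:
  assumes "n \<ge> 2" "a \<le> k" "k < a + int n"
  shows "a \<le> SI n a k \<and> SI n a k < a + int n"
proof (cases "SI n a k = k + 1")
  case True
  then have "k = a" using mod_eq_0_window[OF SI_up] assms by blast
  then show ?thesis using True assms by simp
next
  case False
  have "SI n a k \<noteq> k - 1" if "k = a" using that SI_self[of n a] by simp
  then show ?thesis using False SI_near[of n a k] assms by (cases "k = a") (auto simp: SI_self)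
qed

text \<open>A reflection moves every point by at most one step, so only neighbours that are
  exchanged can change their order.\<close>

lemma SI_order:
  assumes n: "n \<ge> 2" and ij: "a \<le> i" "i < a + int n" "i < j" "(i, j) \<noteq> (a, a + 1)"
  shows "SI n a i < SI n a j"
proof (rule ccontr)
  assume "\<not> ?thesis"
  moreover have "SI n a i \<noteq> SI n a j" using injD[OF inj_SI[OF n], of a i j] ij by auto
  ultimately have less: "SI n a j < SI n a i" by simp
  then have "j = i + 1" "SI n a i = i + 1"
    using SI_near[of n a i] SI_near[of n a j] ij by linarith+
  then have "i = a" using mod_eq_0_window[OF SI_up] ij by blast
  then show False using ij \<open>j = i + 1\<close> by simp
qed

text \<open>The displacement f k - k is periodic, hence bounded by some C, and an inversion (i, j)
  then has j - i < 2 C.\<close>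

lemma finite_Inv:
  assumes "n > 0" "periodic n f" shows "finite (Inv n a f)"
proof -
  define C where "C = Max ((\<lambda>k. \<bar>f k - k\<bar>) ` {0..<int n})"
  have C: "\<bar>f k - k\<bar> \<le> C" for k
  proof -
    have "f k = f (k mod int n) + int n * (k div int n)"
      using periodic_mult[OF assms(2), of "k mod int n" "k div int n"] by simp
    then have "f k - k = f (k mod int n) - k mod int n"
      using mod_mult_div_eq[of k "int n"] by linarith
    moreover have "\<bar>f (k mod int n) - k mod int n\<bar> \<le> C"
      unfolding C_def using assms(1) by (intro Max_ge) auto
    ultimately show ?thesis by simp
  qed
  have "Inv n a f \<subseteq> {a..<a + int n} \<times> {a..a + int n + 2 * C}"
  proof (rule subrelI)
    fix i j assume "(i, j) \<in> Inv n a f"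
    then have "a \<le> i" "i < a + int n" "i < j" "f j < f i" by (auto simp: Inv_def)
    then show "(i, j) \<in> {a..<a + int n} \<times> {a..a + int n + 2 * C}"
      using C[of i] C[of j] by auto
  qed
  then show ?thesis by (rule finite_subset) simp
qed

text \<open>Sliding the window by one step only replaces the pairs starting at a by their translates
  by n.\<close>

lemma card_Inv_Suc:
  assumes n: "n > 0" and p: "periodic n f"
  shows "card (Inv n (a + 1) f) = card (Inv n a f)"
proof -
  let ?h = "\<lambda>(i, j). if i = a then (i + int n, j + int n) else (i, j :: int)"
  have P: "f (k + int n) = f k + int n" for k using p by (simp add: periodic_def)
  have "?h ` Inv n a f = Inv n (a + 1) f"
  proof (rule equalityI; rule subsetI)
    fix x assume "x \<in> ?h ` Inv n a f"
    then obtain i j where x: "x = ?h (i, j)" "a \<le> i" "i < a + int n" "i < j" "f j < f i"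
      by (auto simp: Inv_def)
    show "x \<in> Inv n (a + 1) f"
    proof (cases "i = a")
      case True
      then show ?thesis using x n P[of a] P[of j] by (simp add: Inv_def)
    next
      case False
      then show ?thesis using x by (simp add: Inv_def)
    qed
  next
    fix x assume "x \<in> Inv n (a + 1) f"
    then obtain i j where x: "x = (i, j)" "a + 1 \<le> i" "i < a + 1 + int n" "i < j" "f j < f i"
      by (auto simp: Inv_def)
    show "x \<in> ?h ` Inv n a f"
    proof (cases "i = a + int n")
      case True
      have "f (j - int n) < f a" using P[of "j - int n"] P[of a] x True by simp
      then have "(a, j - int n) \<in> Inv n a f" using x True n by (simp add: Inv_def)
      then show ?thesis using x True by (intro image_eqI[of _ _ "(a, j - int n)"]) auto
    next
      case False
      then show ?thesis using x by (intro image_eqI[of _ _ "(i, j)"]) (auto simp: Inv_def)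
    qed
  qed
  moreover have "inj_on ?h (Inv n a f)"
    by (rule inj_onI) (auto simp: Inv_def split: if_splits)
  ultimately show ?thesis using card_image[of ?h "Inv n a f"] by simp
qed

lemma card_Inv:
  assumes n: "n > 0" and p: "periodic n f"
  shows "card (Inv n a f) = card (Inv n 1 f)"
proof (induction a rule: int_induct[where k = 1])
  case (step1 i)
  then show ?case using card_Inv_Suc[OF assms, of i] by simp
next
  case (step2 i)
  then show ?case using card_Inv_Suc[OF assms, of "i - 1"] by simp
qed simp

text \<open>Applying the reflection to both entries carries the inversions of f to those of the
  composition; the single new one is (a, a + 1), which is no inversion of f by assumption.\<close>

lemma card_Inv_SI_up:
  assumes n: "n \<ge> 2" and p: "periodic n f" and inj: "inj f" and up: "f a < f (a + 1)"
  shows "card (Inv n 1 (f \<circ> SI n a)) = Suc (card (Inv n 1 f))"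
proof -
  have n0: "n > 0" using n by simp
  let ?S = "SI n a"
  let ?h = "map_prod ?S ?S"
  have inj_h: "inj ?h" by (rule prod.inj_map[OF inj_SI[OF n] inj_SI[OF n]])
  have na: "(a, a + 1) \<notin> Inv n a f" using up by (auto simp: Inv_def)
  have *: "(i, j) \<in> Inv n a (f \<circ> ?S) \<longleftrightarrow> (?S i, ?S j) \<in> Inv n a f" if "(i, j) \<noteq> (a, a + 1)" "(i, j) \<noteq> (a + 1, a)" for i j
  proof -
    have 1: "(?S x, ?S y) \<in> Inv n a f" if "(x, y) \<in> Inv n a (f \<circ> ?S)" "(x, y) \<noteq> (a, a + 1)" for x y
      using that SI_order[OF n, of a x y] SI_window[OF n, of a x] by (auto simp: Inv_def)
    have 2: "(x, y) \<in> Inv n a (f \<circ> ?S)" if "(?S x, ?S y) \<in> Inv n a f" for x y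
    proof -
      have ne: "(?S x, ?S y) \<noteq> (a, a + 1)" using that na by metis
      then show ?thesis
        using that SI_order[OF n, of a "?S x" "?S y"] SI_window[OF n, of a "?S x"] by (auto simp: Inv_def SI_invol[OF n])
    qed
    show ?thesis using 1 2 that by blast
  qed
  have "Inv n a (f \<circ> ?S) = insert (a, a + 1) (?h ` Inv n a f)"
  proof (intro equalityI subsetI)
    fix x assume x: "x \<in> Inv n a (f \<circ> ?S)"
    obtain i j where ij: "x = (i, j)" by (cases x)
    have "i < j" using x ij by (simp add: Inv_def)
    show "x \<in> insert (a, a + 1) (?h ` Inv n a f)"
    proof (cases "(i, j) = (a, a + 1)")
      case False
      then have "(?S i, ?S j) \<in> Inv n a f" using *[of i j] x ij \<open>i < j\<close> by auto
      then have "?h (?S i, ?S j) \<in> ?h ` Inv n a f" by (rule imageI)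
      then show ?thesis using ij by (simp add: SI_invol[OF n])
    qed (use ij in simp)
  next
    fix x assume "x \<in> insert (a, a + 1) (?h ` Inv n a f)"
    then consider "x = (a, a + 1)" | i j where "x = (?S i, ?S j)" "(i, j) \<in> Inv n a f" by auto
    then show "x \<in> Inv n a (f \<circ> ?S)"
    proof cases
      case 1
      then show ?thesis using up n by (simp add: Inv_def SI_self SI_Suc)
    next
      case 2
      have ne: "(?S i, ?S j) \<noteq> (a, a + 1)"
      proof
        assume "(?S i, ?S j) = (a, a + 1)"
        then have "i = a + 1" "j = a" using SI_invol[OF n, of a i] SI_invol[OF n, of a j] SI_self SI_Suc[OF n] by auto
        then show False using 2 by (simp add: Inv_def)
      qed
      have ne2: "(?S i, ?S j) \<noteq> (a + 1, a)"
      proof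
        assume "(?S i, ?S j) = (a + 1, a)"
        then have "i = a" "j = a + 1" using SI_invol[OF n, of a i] SI_invol[OF n, of a j] SI_self SI_Suc[OF n] by auto
        then show False using 2 na by simp
      qed
      show ?thesis using *[OF ne ne2] 2 by (simp add: SI_invol[OF n])
    qed
  qed
  moreover have "(a, a + 1) \<notin> ?h ` Inv n a f"
  proof
    assume "(a, a + 1) \<in> ?h ` Inv n a f"
    then obtain i j where "(a, a + 1) = (?S i, ?S j)" "(i, j) \<in> Inv n a f" by auto
    then have "i = a + 1" "j = a" using SI_invol[OF n, of a i] SI_invol[OF n, of a j] SI_self SI_Suc[OF n] by auto
    then show False using \<open>(i, j) \<in> Inv n a f\<close> by (simp add: Inv_def)
  qed
  ultimately have "card (Inv n a (f \<circ> ?S)) = Suc (card (Inv n a f))"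
    using finite_Inv[OF n0 p, of a] card_image[OF inj_on_subset[OF inj_h subset_UNIV]] by simp
  then show ?thesis
    using card_Inv[OF n0 p, of a] card_Inv[OF n0 periodic_comp[OF p periodic_SI], of a] by simp
qed

lemma card_Inv_SI_down:
  assumes n: "n \<ge> 2" and p: "periodic n f" and inj: "inj f" and down: "f (a + 1) < f a"
  shows "card (Inv n 1 f) = Suc (card (Inv n 1 (f \<circ> SI n a)))"
proof -
  have eq: "f = (f \<circ> SI n a) \<circ> SI n a" using SI_invol[OF n] by auto
  show ?thesis
    by (subst eq, rule card_Inv_SI_up[OF n periodic_comp[OF p periodic_SI]])
       (use inj_SI[OF n] inj down in \<open>auto simp: SI_self SI_Suc[OF n] inj_compose\<close>)
qed

lemma card_Inv_shift:
  assumes n: "n \<ge> 2" and p: "periodic n f"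
  shows "card (Inv n 1 (\<lambda>k. f (k + c))) = card (Inv n 1 f)"
proof -
  have "Inv n (1 + c) f = (\<lambda>(i, j). (i + c, j + c)) ` Inv n 1 (\<lambda>k. f (k + c))"
  proof (intro equalityI subsetI)
    fix x assume "x \<in> Inv n (1 + c) f"
    then show "x \<in> (\<lambda>(i, j). (i + c, j + c)) ` Inv n 1 (\<lambda>k. f (k + c))"
      by (intro image_eqI[of _ _ "(fst x - c, snd x - c)"]) (auto simp: Inv_def)
  qed (auto simp: Inv_def)
  moreover have "inj_on (\<lambda>(i, j). (i + c, j + c)) (Inv n 1 (\<lambda>k. f (k + c)))" by (auto simp: inj_on_def)
  ultimately show ?thesis using card_Inv[OF _ p, of "1 + c"] n by (simp add: card_image)
qed

text \<open>Descents are periodic, so n consecutive positions suffice.\<close>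

lemma increasing_if_no_descent:
  assumes n: "n \<ge> 2" and p: "periodic n f" and up: "\<And>k. 0 \<le> k \<Longrightarrow> k < int n \<Longrightarrow> f k < f (k + 1)"
  shows "f k < f (k + 1)"
proof -
  let ?r = "k mod int n" and ?m = "k div int n"
  have "f ?r < f (?r + 1)" using n by (intro up) simp_all
  moreover have "f k = f ?r + int n * ?m" using periodic_mult[OF p, of ?r ?m] by simp
  moreover have "f (k + 1) = f (?r + 1) + int n * ?m"
    using periodic_mult[OF p, of "?r + 1" ?m] by (simp add: algebra_simps)
  ultimately show ?thesis by simp
qed

lemma strict_increasing:
  assumes up: "\<And>k :: int. f k < (f (k + 1) :: int)" and "i < j"
  shows "f i < f j"
  using assms(2)
proof (induction j rule: int_gr_induct)
  case base
  show ?case by (rule up)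
next
  case (step k)
  then show ?case using up[of k] by simp
qed

text \<open>A jump by more than one would leave the value f k + 1 without a preimage.\<close>

lemma increasing_surj_shift:
  assumes up: "\<And>k :: int. f k < (f (k + 1) :: int)" and "surj f"
  shows "f k = k + f 0"
proof -
  have step: "f (k + 1) = f k + 1" for k
  proof (rule ccontr)
    assume "f (k + 1) \<noteq> f k + 1"
    then have gap: "f k + 1 < f (k + 1)" using up[of k] by simp
    obtain m where m: "f m = f k + 1" using \<open>surj f\<close> by (metis surjD)
    have "m \<noteq> k" "m \<noteq> k + 1" using m gap by auto
    then consider "m < k" | "k + 1 < m" by linarith
    then show False
      using m gap strict_increasing[of f m k, OF up] strict_increasing[of f "k + 1" m, OF up] by cases auto
  qed
  show ?thesis
  proof (induction k rule: int_induct[where k = 0])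
    case (step2 i)
    then show ?case using step[of "i - 1"] by simp
  qed (auto simp: step)
qed

definition Lw :: "nat \<Rightarrow> waff \<Rightarrow> nat" where
  "Lw n w = card (Inv n 1 (zp n w))"

text \<open>Conjugation by \<open>tau ^ j\<close> sends \<open>s_k\<close> to \<open>s_(k - j)\<close>.\<close>

definition shl :: "nat \<Rightarrow> int \<Rightarrow> nat list \<Rightarrow> nat list" where
  "shl n j = map (\<lambda>k. nat ((int k - j) mod int n))"

lemma length_shl [simp]: "length (shl n j is) = length is"
  by (simp add: shl_def)

lemma shl_Nil [simp]: "shl n j [] = []" by (simp add: shl_def)

lemma SI_cong: "(i - i') mod int n = 0 \<Longrightarrow> SI n i = SI n i'"
proof
  fix k assume "(i - i') mod int n = 0"
  then have "int n dvd i - i'" by (simp add: mod_eq_0_iff_dvd)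
  then obtain m where "i - i' = int n * m" by (rule dvdE)
  then have m: "i = i' + int n * m" by simp
  have "(k - i) mod int n = (k - i') mod int n" "(k - i - 1) mod int n = (k - i' - 1) mod int n"
    using mod_mult_self2[of "k - i" "int n" m] mod_mult_self2[of "k - i - 1" "int n" m] m
    by (simp_all add: algebra_simps)
  then show "SI n i k = SI n i' k" by (simp add: SI_def)
qed

context affine_sym
begin

lemma set_shl: "set (shl n j is) \<subseteq> {..<n}"
  using n2 by (auto simp: shl_def nat_less_iff)

lemma wpow_tau_in: "wpow (tau n) j \<in> Wset n"
proof -
  have "(wmul a ^^ m) wone \<in> Wset n" if "a \<in> Wset n" for a m
    by (induction m) (auto intro: wone_in wmul_in that)
  then show ?thesis unfolding wpow_def using tau_in winv_in by auto
qed

lemma zp_wpow_tau: "zp n (wpow (tau n) j) = (\<lambda>k. k - j)"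
proof -
  have 1: "zp n ((wmul a ^^ m) wone) = (\<lambda>k. k + c * int m) \<and> (wmul a ^^ m) wone \<in> Wset n"
    if "a \<in> Wset n" "zp n a = (\<lambda>k. k + c)" for a m c
  proof (induction m)
    case 0
    then show ?case by (auto simp: zp_wone wone_in)
  next
    case (Suc m)
    then show ?case using that by (auto simp: zp_wmul algebra_simps intro: wmul_in)
  qed
  have "zp n (winv (tau n)) (zp n (tau n) (k + 1)) = k + 1" for k
    using zp_winv_comp(1)[OF tau_in] .
  then have "zp n (winv (tau n)) = (\<lambda>k. k + 1)" by (simp add: zp_tau fun_eq_iff)
  then show ?thesis
    using 1[of "tau n" "-1" "nat j"] 1[of "winv (tau n)" 1 "nat (- j)"] tau_in winv_in[OF tau_in] zp_tau
    by (auto simp: wpow_def)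
qed

lemma wpow_tau_add: "wmul (wpow (tau n) i) (wpow (tau n) j) = wpow (tau n) (i + j)"
  by (rule zp_inj) (auto simp: wmul_in wpow_tau_in zp_wmul zp_wpow_tau)

lemma wpow_0 [simp]: "wpow w 0 = wone"
  by (simp add: wpow_def)

lemma wdeg_wpow_tau: "wdeg n (wpow (tau n) j) = j"
proof -
  have d1: "wdeg n (tau n) = 1"
  proof -
    have "snd (tau n) i = ex 1 i" for i by (simp add: tau_def wmul_def snd_wprodS)
    then show ?thesis using n2 by (simp add: wdeg_def ex_def)
  qed
  have d0: "wdeg n wone = 0" by (simp add: wdeg_def wone_def)
  have "wdeg n (winv (tau n)) = - 1"
    using wdeg_wmul[OF tau_in winv_in[OF tau_in]] d0 d1 wmul_winv[OF tau_in] by simp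
  moreover have 1: "wdeg n ((wmul a ^^ m) wone) = wdeg n a * int m \<and> (wmul a ^^ m) wone \<in> Wset n"
    if "a \<in> Wset n" for a m
    by (induction m) (use that in \<open>auto simp: d0 wdeg_wmul algebra_simps intro: wone_in wmul_in\<close>)
  ultimately show ?thesis
    using 1[of "tau n" "nat j"] 1[of "winv (tau n)" "nat (- j)"] tau_in winv_in[OF tau_in] d1
    by (auto simp: wpow_def)
qed

lemma wdeg_wprodA: "set is \<subseteq> {..<n} \<Longrightarrow> wdeg n (wprodA n is) = 0"
proof (induction "is")
  case (Cons k "is")
  have "(\<Sum>i = Suc 0..n. ex (Suc 0) i - ex n i) = 0" using n2 by (simp add: ex_def sum_subtractf)
  then have "wdeg n (sgen n k) = 0"
    by (auto simp: sgen_def sfin_def wdeg_def s0_def wmul_def snd_wprodS)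
  then show ?case using Cons by (simp add: wdeg_wmul wprodA_Cons sgen_in wprodA_in)
qed (simp add: wdeg_def wone_def wprodA_Nil)

lemma tau_sgen:
  assumes "k < n"
  shows "wmul (wpow (tau n) j) (sgen n k) = wmul (sgen n (nat ((int k - j) mod int n))) (wpow (tau n) j)"
proof (rule zp_inj)
  let ?k = "nat ((int k - j) mod int n)"
  have k: "?k < n" using n2 by (simp add: nat_less_iff)
  have ik: "int ?k = (int k - j) mod int n" using n2 by simp
  have S: "SI n (int ?k) = SI n (int k - j)"
    by (rule SI_cong) (simp only: ik, simp add: mod_diff_left_eq)
  have zk: "zp n (sgen n ?k) = SI n (int k - j)" using zp_sgen[OF k] S by (simp only:)
  then show "zp n (wmul (wpow (tau n) j) (sgen n k)) = zp n (wmul (sgen n ?k) (wpow (tau n) j))"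
    using assms k by (simp add: zp_wmul zp_wpow_tau zk zp_sgen[OF assms] sgen_in wpow_tau_in SI_def fun_eq_iff)
  show "wmul (wpow (tau n) j) (sgen n k) \<in> Wset n" "wmul (sgen n ?k) (wpow (tau n) j) \<in> Wset n"
    using assms k by (simp_all add: wmul_in wpow_tau_in sgen_in)
qed

lemma tau_wprodA:
  assumes "set is \<subseteq> {..<n}"
  shows "wmul (wpow (tau n) j) (wprodA n is) = wmul (wprodA n (shl n j is)) (wpow (tau n) j)"
  using assms
proof (induction "is")
  case Nil
  then show ?case by (simp add: wprodA_Nil wmul_one)
next
  case (Cons k "is")
  have "wmul (wpow (tau n) j) (wprodA n (k # is)) = wmul (wmul (wpow (tau n) j) (sgen n k)) (wprodA n is)"
    by (simp add: wprodA_Cons wmul_assoc)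
  also have "\<dots> = wmul (sgen n (nat ((int k - j) mod int n))) (wmul (wpow (tau n) j) (wprodA n is))"
    using Cons by (simp add: tau_sgen wmul_assoc)
  also have "\<dots> = wmul (wprodA n (shl n j (k # is))) (wpow (tau n) j)"
    using Cons by (simp add: shl_def wprodA_Cons wmul_assoc)
  finally show ?case .
qed

lemma Lw_sgen_up:
  assumes "w \<in> Wset n" "k < n" "zp n w (int k) < zp n w (int k + 1)"
  shows "Lw n (wmul w (sgen n k)) = Suc (Lw n w)"
  using card_Inv_SI_up[OF n2 periodic_zp inj_zp[OF assms(1)] assms(3)] assms
  by (simp add: Lw_def zp_wmul zp_sgen sgen_in)

lemma Lw_sgen_down:
  assumes "w \<in> Wset n" "k < n" "zp n w (int k + 1) < zp n w (int k)"
  shows "Suc (Lw n (wmul w (sgen n k))) = Lw n w"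
  using card_Inv_SI_down[OF n2 periodic_zp inj_zp[OF assms(1)] assms(3)] assms
  by (simp add: Lw_def zp_wmul zp_sgen sgen_in)

lemma zp_Suc_neq: "w \<in> Wset n \<Longrightarrow> zp n w (k + 1) \<noteq> zp n w k"
  using injD[OF inj_zp, of w "k + 1" k] by auto

lemma Lw_descent_iff:
  assumes "w \<in> Wset n" "k < n"
  shows "Lw n (wmul w (sgen n k)) < Lw n w \<longleftrightarrow> zp n w (int k + 1) < zp n w (int k)"
proof (cases "zp n w (int k) < zp n w (int k + 1)")
  case True
  then show ?thesis using Lw_sgen_up[OF assms] by simp
next
  case False
  then have "zp n w (int k + 1) < zp n w (int k)" using zp_Suc_neq[OF assms(1), of "int k"] by simp
  then show ?thesis using Lw_sgen_down[OF assms] by simp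
qed

lemma Lw_tau:
  assumes "w \<in> Wset n" shows "Lw n (wmul w (wpow (tau n) j)) = Lw n w"
  using card_Inv_shift[OF n2 periodic_zp, of w "- j"]
  by (simp add: Lw_def zp_wmul wpow_tau_in zp_wpow_tau comp_def)

lemma Lw_wone [simp]: "Lw n wone = 0"
proof -
  have "Inv n 1 id = {}" by (auto simp: Inv_def)
  then show ?thesis by (simp add: Lw_def zp_wone)
qed

lemma Lw_le_Suc: "w \<in> Wset n \<Longrightarrow> k < n \<Longrightarrow> Lw n (wmul w (sgen n k)) \<le> Suc (Lw n w)"
  using Lw_sgen_up[of w k] Lw_sgen_down[of w k] zp_Suc_neq[of w "int k"]
  by (cases "zp n w (int k) < zp n w (int k + 1)") (simp_all add: not_less le_less)

lemma Lw_word_le: "set is \<subseteq> {..<n} \<Longrightarrow> Lw n (wprodA n is) \<le> length is"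
proof (induction "is" rule: rev_induct)
  case (snoc k "is")
  then show ?case
    using Lw_le_Suc[of "wprodA n is" k] wprodA_in[of "is"]
    by (simp add: wprodA_append wprodA_Cons wprodA_Nil wmul_one)
qed (simp add: wprodA_Nil)

lemma sgen_sgen:
  assumes k: "k < n"
  shows "wmul (wmul w (sgen n k)) (sgen n k) = w"
proof -
  have "wmul (sgen n k) (sgen n k) = wone"
    by (rule zp_inj) (auto simp: k wmul_in sgen_in wone_in zp_wmul
      zp_sgen zp_wone SI_invol[OF n2])
  then show ?thesis by (simp add: wmul_assoc wmul_one)
qed

text \<open>Descents are removed one at a time. Without descents the affine permutation is
  increasing and onto, hence a translation, that is, a power of \<open>tau\<close>.\<close>

lemma reduced_exists:
  assumes "w \<in> Wset n"
  shows "\<exists>is j. length is = Lw n w \<and> set is \<subseteq> {..<n} \<and> w = wmul (wprodA n is) (wpow (tau n) j)"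
  using assms
proof (induction "Lw n w" arbitrary: w)
  case 0
  have up: "zp n w k < zp n w (k + 1)" for k
  proof (rule increasing_if_no_descent[OF n2 periodic_zp])
    fix k :: int assume k: "0 \<le> k" "k < int n"
    then have "\<not> zp n w (int (nat k) + 1) < zp n w (int (nat k))"
      using Lw_descent_iff[OF 0(2), of "nat k"] 0 by auto
    then show "zp n w k < zp n w (k + 1)" using zp_Suc_neq[OF 0(2), of k] k by simp
  qed
  have z: "zp n w k = k + zp n w 0" for k
    by (rule increasing_surj_shift[OF up surj_zp[OF 0(2)]])
  have "w = wpow (tau n) (- zp n w 0)"
    by (rule zp_inj[OF 0(2) wpow_tau_in], rule ext, subst z) (simp add: zp_wpow_tau)
  then show ?case using 0(1)
    by (intro exI[of _ "[]"] exI[of _ "- zp n w 0"]) (simp add: wprodA_Nil wmul_one)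
next
  case (Suc r)
  have "\<exists>k<n. zp n w (int k + 1) < zp n w (int k)"
  proof (rule ccontr)
    assume no: "\<not> ?thesis"
    have up: "zp n w k < zp n w (k + 1)" for k
    proof (rule increasing_if_no_descent[OF n2 periodic_zp])
      fix k :: int assume k: "0 \<le> k" "k < int n"
      then have "nat k < n" by simp
      then have "\<not> zp n w (int (nat k) + 1) < zp n w (int (nat k))" using no by blast
      then show "zp n w k < zp n w (k + 1)" using zp_Suc_neq[OF Suc(3), of k] k by simp
    qed
    have "\<not> zp n w j < zp n w i" if "i < j" for i j
      using strict_increasing[of "zp n w", OF up that] by simp
    then have "Inv n 1 (zp n w) = {}" by (auto simp: Inv_def dest: less_trans)
    then show False using Suc(2) by (simp add: Lw_def)
  qed
  then obtain k where k: "k < n" "zp n w (int k + 1) < zp n w (int k)" by blast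
  let ?v = "wmul w (sgen n k)"
  have v: "?v \<in> Wset n" using Suc k by (simp add: wmul_in sgen_in)
  have "r = Lw n ?v" using Lw_sgen_down[OF Suc(3) k] Suc(2) by simp
  from Suc(1)[OF this v] obtain "is" j where w: "length is = Lw n ?v" "set is \<subseteq> {..<n}"
    "?v = wmul (wprodA n is) (wpow (tau n) j)" by blast
  have "w = wmul ?v (sgen n k)" using sgen_sgen k by simp
  \<comment> \<open>The last letter stands behind \<open>tau ^ j\<close>; moved in front of it, k
    becomes k - j modulo n.\<close>
  also have "\<dots> = wmul (wprodA n (is @ shl n j [k])) (wpow (tau n) j)"
    using w(3) tau_wprodA[of "[k]" j] k
    by (simp add: wprodA_append wprodA_Cons wprodA_Nil wmul_one wmul_assoc)
  finally have eq: "w = wmul (wprodA n (is @ shl n j [k])) (wpow (tau n) j)" .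
  show ?case
    using eq w \<open>r = Lw n ?v\<close> Suc(2) set_shl[of j "[k]"]
    by (intro exI[of _ "is @ shl n j [k]"] exI[of _ j]) auto
qed

lemma lenW_eq_Lw: "w \<in> Wset n \<Longrightarrow> lenW n w = Lw n w"
  unfolding lenW_def
proof (rule Least_equality)
  assume w: "w \<in> Wset n"
  show "\<exists>is j. length is = Lw n w \<and> set is \<subseteq> {..<n} \<and> w = wmul (wprodA n is) (wpow (tau n) j)"
    using reduced_exists[OF w] .
  fix r assume "\<exists>is j. length is = r \<and> set is \<subseteq> {..<n} \<and> w = wmul (wprodA n is) (wpow (tau n) j)"
  then obtain "is" j where *: "length is = r" "set is \<subseteq> {..<n}" "w = wmul (wprodA n is) (wpow (tau n) j)"
    by blast
  then show "Lw n w \<le> r" using Lw_word_le[OF *(2)] Lw_tau[OF wprodA_in[OF *(2)]] by simp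
qed

lemma reduced_word_deg_0:
  assumes "w \<in> Wset n" "wdeg n w = 0"
  obtains "is" where "length is = Lw n w" "set is \<subseteq> {..<n}" "w = wprodA n is"
proof -
  obtain "is" j where i: "length is = Lw n w" "set is \<subseteq> {..<n}" "w = wmul (wprodA n is) (wpow (tau n) j)"
    using reduced_exists[OF assms(1)] by blast
  then have "j = 0"
    using assms(2) wdeg_wmul[OF wprodA_in[OF i(2)] wpow_tau_in] wdeg_wprodA[OF i(2)] by (simp add: wdeg_wpow_tau)
  then show ?thesis using i that by (simp add: wmul_one)
qed

end

subsection \<open>Reduced words and braid moves\<close>

text \<open>Equivalence of words under the braid moves of the affine diagram, a cycle of n nodes.
  For n = 2 the two generators satisfy neither a commutation nor a braid relation, and no move
  applies.\<close>

inductive breq :: "nat \<Rightarrow> nat list \<Rightarrow> nat list \<Rightarrow> bool" for n where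
  breq_refl: "breq n u u"
| breq_sym: "breq n u v \<Longrightarrow> breq n v u"
| breq_trans: "breq n u v \<Longrightarrow> breq n v w \<Longrightarrow> breq n u w"
| breq_ctx: "breq n u v \<Longrightarrow> breq n (x @ u @ y) (x @ v @ y)"
| breq_comm: "a < n \<Longrightarrow> b < n \<Longrightarrow> a \<noteq> b \<Longrightarrow> (a + 1) mod n \<noteq> b \<Longrightarrow> (b + 1) mod n \<noteq> a \<Longrightarrow> breq n [a, b] [b, a]"
| breq_braid: "n \<ge> 3 \<Longrightarrow> a < n \<Longrightarrow> b = (a + 1) mod n \<Longrightarrow> breq n [a, b, a] [b, a, b]"

lemma breq_set: "breq n u v \<Longrightarrow> set u = set v"
  by (induction rule: breq.induct) auto

lemma breq_append: "breq n u v \<Longrightarrow> breq n (u @ y) (v @ y)"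
  using breq_ctx[of n u v "[]" y] by simp

lemma breq_prepend: "breq n u v \<Longrightarrow> breq n (x @ u) (x @ v)"
  using breq_ctx[of n u v x "[]"] by simp

lemma SI_fix: "(k - i) mod int n \<noteq> 0 \<Longrightarrow> (k - i - 1) mod int n \<noteq> 0 \<Longrightarrow> SI n i k = k"
  by (simp add: SI_def)

context affine_sym
begin

lemma periodic_desc_cong:
  assumes "periodic n f" "(i - i') mod int n = 0"
  shows "f (i + 1) < f i \<longleftrightarrow> f (i' + 1) < f i'"
proof -
  have "int n dvd i - i'" using assms(2) by (simp add: mod_eq_0_iff_dvd)
  then obtain m where "i - i' = int n * m" by (rule dvdE)
  then have m: "i = i' + int n * m" by simp
  have m1: "i + 1 = (i' + 1) + int n * m" using m by simp
  show ?thesis unfolding m1 unfolding m periodic_mult[OF assms(1)] by simp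
qed

lemma zp_wmul_sgen: "w \<in> Wset n \<Longrightarrow> k < n \<Longrightarrow> zp n (wmul w (sgen n k)) x = zp n w (SI n (int k) x)"
  by (simp add: zp_wmul sgen_in zp_sgen)

lemma word_deg_0:
  assumes "w \<in> Wset n" "k < n" "wdeg n w = 0" shows "wdeg n (wmul w (sgen n k)) = 0"
  using assms wdeg_wmul[OF assms(1) sgen_in[OF assms(2)]] wdeg_wprodA[of "[k]"] by (simp add: wprodA_Cons wprodA_Nil)

lemma wmul_sgen_in: "w \<in> Wset n \<Longrightarrow> k < n \<Longrightarrow> wmul w (sgen n k) \<in> Wset n"
  by (simp add: wmul_in sgen_in)

lemma wprodA_snoc: "wprodA n (is @ [k]) = wmul (wprodA n is) (sgen n k)"
  by (simp add: wprodA_append wprodA_Cons wprodA_Nil)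

lemma sgen_comm:
  assumes "a < n" "b < n" "a \<noteq> b" "(a + 1) mod n \<noteq> b" "(b + 1) mod n \<noteq> a"
  shows "SI n (int a) (int b) = int b" "SI n (int a) (int b + 1) = int b + 1"
    "wmul (sgen n a) (sgen n b) = wmul (sgen n b) (sgen n a)"
proof -
  have d: "\<not> int n dvd int b - int a" "\<not> int n dvd int b - int a - 1" "\<not> int n dvd int b - int a + 1"
  proof -
    show "\<not> int n dvd int b - int a"
    proof
      assume "int n dvd int b - int a"
      then have "int b - int a = 0" by (rule small_multiple) (use assms in linarith)
      then show False using assms by simp
    qed
    show "\<not> int n dvd int b - int a - 1"
    proof
      assume "int n dvd int b - int a - 1"
      then have "int n dvd int b - int (a + 1)" by (simp add: algebra_simps)
      then have "int b mod int n = int (a + 1) mod int n" by (simp only: mod_eq_dvd_iff)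
      then have "b mod n = (a + 1) mod n" by (metis of_nat_mod of_nat_eq_iff)
      then show False using assms by simp
    qed
    show "\<not> int n dvd int b - int a + 1"
    proof
      assume "int n dvd int b - int a + 1"
      then have "int n dvd int (b + 1) - int a" by (simp add: algebra_simps)
      then have "int (b + 1) mod int n = int a mod int n" by (simp only: mod_eq_dvd_iff)
      then have "(b + 1) mod n = a mod n" by (metis of_nat_mod of_nat_eq_iff)
      then show False using assms by simp
    qed
  qed
  show 1: "SI n (int a) (int b) = int b" "SI n (int a) (int b + 1) = int b + 1"
    using d by (auto intro!: SI_fix simp: mod_eq_0_iff_dvd algebra_simps)
  \<comment> \<open>Two congruences for one x subtract to a congruence for b - a, and
    \<open>d\<close> excludes the small values. The instances below rule out that the points moved
    by the two reflections meet.\<close>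
  have key: "int n dvd x - int a - e \<Longrightarrow> int n dvd x - int b - f \<Longrightarrow> int n dvd int b - int a + f - e" for x e f
    using dvd_diff[of "int n" "x - int a - e" "x - int b - f"] by (simp add: algebra_simps)
  have "SI n (int a) (SI n (int b) x) = SI n (int b) (SI n (int a) x)" for x
    using d key[of x 0 0] key[of x 1 0] key[of x 0 1] key[of x 1 1] key[of "x+1" 1 0]
      key[of "x + 1" 0 0] key[of "x + 1" 0 1] key[of "x + 1" 1 1]
      key[of "x - 1" 0 0] key[of "x - 1" 0 1] key[of "x - 1" 1 1] key[of "x - 1" 1 0]
      key[of x "-1" 0] key[of x 0 "-1"] key[of x 1 "2"] key[of x 2 1]
    by (auto simp: SI_def mod_eq_0_iff_dvd algebra_simps)
  then show "wmul (sgen n a) (sgen n b) = wmul (sgen n b) (sgen n a)"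
    using assms by (intro zp_inj) (auto simp: wmul_in sgen_in zp_wmul zp_sgen)
qed

text \<open>One letter changes the length by at most one, so an initial part of a reduced word is
  reduced and the letter dropped is a descent.\<close>

lemma Lw_word_init:
  assumes "set (is @ [k]) \<subseteq> {..<n}" "Lw n (wprodA n (is @ [k])) = length (is @ [k])"
  shows "Lw n (wprodA n is) = length is"
    "zp n (wprodA n (is @ [k])) (int k + 1) < zp n (wprodA n (is @ [k])) (int k)"
    "wprodA n is = wmul (wprodA n (is @ [k])) (sgen n k)"
proof -
  let ?w = "wprodA n is"
  have w: "?w \<in> Wset n" and k: "k < n" using assms(1) wprodA_in[of "is"] by auto
  have le: "Lw n ?w \<le> length is" using Lw_word_le[of "is"] assms(1) by simp
  show eq: "?w = wmul (wprodA n (is @ [k])) (sgen n k)"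
    using sgen_sgen[OF k] by (simp add: wprodA_snoc)
  show 1: "Lw n ?w = length is"
    using le Lw_le_Suc[OF w k] assms(2) by (simp add: wprodA_snoc)
  have "Lw n (wmul (wprodA n (is @ [k])) (sgen n k)) < Lw n (wprodA n (is @ [k]))"
    using eq 1 assms(2) by simp
  then show "zp n (wprodA n (is @ [k])) (int k + 1) < zp n (wprodA n (is @ [k])) (int k)"
    using Lw_descent_iff[OF wprodA_in[OF assms(1)] k] by simp
qed

text \<open>With descents at a and a + 1 the element reverses the three points a, a + 1, a + 2, so
  it factors as x times \<open>s_a s_b s_a\<close> with lengths adding. Each word is connected, by
  the induction hypothesis for its initial part, to a reduced word of x followed by one of the two
  forms of the braid.\<close>

lemma Matsumoto_adjacent:
  assumes IH: "\<And>is js. length is = r \<Longrightarrow> length js = r \<Longrightarrow> set is \<subseteq> {..<n} \<Longrightarrow> set js \<subseteq> {..<n} \<Longrightarrow>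
      wprodA n is = wprodA n js \<Longrightarrow> Lw n (wprodA n is) = r \<Longrightarrow> breq n is js"
    and len: "length is = r" "length js = r" and sets: "set (is @ [a]) \<subseteq> {..<n}" "set (js @ [b]) \<subseteq> {..<n}"
    and eq: "wprodA n (is @ [a]) = wprodA n (js @ [b])" and L: "Lw n (wprodA n (is @ [a])) = Suc r"
    and b: "b = (a + 1) mod n"
  shows "breq n (is @ [a]) (js @ [b])"
proof -
  define w where "w = wprodA n (is @ [a])"
  have a: "a < n" and bn: "b < n" using sets by auto
  have w: "w \<in> Wset n" unfolding w_def by (rule wprodA_in[OF sets(1)])
  have wb: "w = wprodA n (js @ [b])" using eq w_def by simp
  note I = Lw_word_init[OF sets(1), folded w_def]
  note J = Lw_word_init[OF sets(2), folded wb]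
  have Lw: "Lw n w = Suc r" using L w_def by simp
  have Ia: "zp n w (int a + 1) < zp n w (int a)" using I(2) Lw len by simp
  have cong: "(int b - (int a + 1)) mod int n = 0"
    unfolding b of_nat_mod by (simp add: mod_diff_left_eq add.commute)
  have SIb: "SI n (int b) = SI n (int a + 1)" by (rule SI_cong[OF cong])
  have "zp n w (int b + 1) < zp n w (int b)" using J(2) Lw len by simp
  then have Jb: "zp n w (int a + 2) < zp n w (int a + 1)"
    using periodic_desc_cong[OF periodic_zp cong, of w] by (simp add: add.assoc)
  \<comment> \<open>For n = 2 the two descents would give w (a + 2) < w a, against w (a + 2) = w a +
    2.\<close>
  have n3: "n \<ge> 3"
  proof (rule ccontr)
    assume "\<not> n \<ge> 3"
    then have "n = 2" using n2 by simp
    then show False using Ia Jb periodic_zp[of w] by (simp add: periodic_def)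
  qed
  have small: "\<not> int n dvd x" if "x = 1 \<or> x = 2" for x
    using that n3 small_multiple[of n x] by auto
  have d1: "(int a - (int a + 1)) mod int n \<noteq> 0" "(int a - (int a + 1) - 1) mod int n \<noteq> 0"
     "(int a + 2 - int a) mod int n \<noteq> 0" "(int a + 2 - int a - 1) mod int n \<noteq> 0"
    using small[of 1] small[of 2] by (auto simp: mod_eq_0_iff_dvd)
  have Sa: "SI n (int a) (int a) = int a + 1" "SI n (int a) (int a + 1) = int a" "SI n (int a) (int a + 2) = int a + 2"
    using SI_self SI_Suc[OF n2] d1 by (auto intro: SI_fix)
  have Sb: "SI n (int b) (int a) = int a" "SI n (int b) (int a + 1) = int a + 2" "SI n (int b) (int a + 2) = int a + 1"
  proof -
    have 2: "int a + 2 = (int a + 1) + 1" by simp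
    show "SI n (int b) (int a) = int a" unfolding SIb using d1 by (intro SI_fix)
    show "SI n (int b) (int a + 1) = int a + 2" unfolding SIb 2 by (rule SI_self)
    show "SI n (int b) (int a + 2) = int a + 1" unfolding SIb 2 by (rule SI_Suc[OF n2])
  qed
  define wa where "wa = wmul w (sgen n a)"
  define wab where "wab = wmul wa (sgen n b)"
  define x where "x = wmul wab (sgen n a)"
  have in1: "wa \<in> Wset n" "wab \<in> Wset n" "x \<in> Wset n"
    unfolding wa_def wab_def x_def using w a bn by (simp_all add: wmul_sgen_in)
  have zwa: "zp n wa y = zp n w (SI n (int a) y)" and zwab: "zp n wab y = zp n wa (SI n (int b) y)" for y
    using zp_wmul_sgen w a bn in1 by (simp_all add: wa_def wab_def)
  have "Suc (Lw n wa) = Lw n w"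
    unfolding wa_def by (rule Lw_sgen_down[OF w a Ia])
  have desc_b: "zp n wa (int b + 1) < zp n wa (int b)"
    using periodic_desc_cong[OF periodic_zp cong, of wa] Ia Jb by (simp add: zwa Sa add.assoc)
  have "Suc (Lw n wab) = Lw n wa"
    unfolding wab_def by (rule Lw_sgen_down[OF in1(1) bn desc_b])
  have desc_a: "zp n wab (int a + 1) < zp n wab (int a)"
    using Jb by (simp add: zwab zwa Sa Sb)
  have "Suc (Lw n x) = Lw n wab"
    unfolding x_def by (rule Lw_sgen_down[OF in1(2) a desc_a])
  have deg: "wdeg n x = 0"
    unfolding x_def wab_def wa_def using w a bn wdeg_wprodA[OF sets(1)] in1
    by (simp add: word_deg_0 wmul_sgen_in w_def wprodA_in[OF sets(1)])
  obtain u where u: "length u = Lw n x" "set u \<subseteq> {..<n}" "x = wprodA n u"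
    using reduced_word_deg_0[OF in1(3) deg] by blast
  have sab: "wmul (wmul (sgen n a) (sgen n b)) (sgen n a) = wmul (wmul (sgen n b) (sgen n a)) (sgen n b)"
  proof (rule zp_inj)
    have per: "SI n (int a) (SI n (int b) (SI n (int a) y)) = SI n (int b) (SI n (int a) (SI n (int b) y))" for y
    proof -
      consider "int n dvd y - int a" | "int n dvd y - (int a + 1)" | "int n dvd y - (int a + 2)"
        | "\<not> int n dvd y - int a" "\<not> int n dvd y - (int a + 1)" "\<not> int n dvd y - (int a + 2)" by blast
      then show ?thesis
      proof cases
        case 4
        then show ?thesis by (simp add: SIb SI_def mod_eq_0_iff_dvd algebra_simps)
      next
        case 1
        then obtain m where "y = int a + int n * m" by (metis dvdE diff_eq_eq add.commute)
        then show ?thesis by (simp add: periodic_mult[OF periodic_SI] Sa Sb)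
      next
        case 2
        then obtain m where "y = int a + 1 + int n * m" by (metis dvdE diff_eq_eq add.commute)
        then show ?thesis by (simp add: periodic_mult[OF periodic_SI] Sa Sb)
      next
        case 3
        then obtain m where "y = int a + 2 + int n * m" by (metis dvdE diff_eq_eq add.commute)
        then show ?thesis by (simp add: periodic_mult[OF periodic_SI] Sa Sb)
      qed
    qed
    then show "zp n (wmul (wmul (sgen n a) (sgen n b)) (sgen n a)) = zp n (wmul (wmul (sgen n b) (sgen n a)) (sgen n b))"
      using a bn by (auto simp: zp_wmul wmul_in sgen_in zp_sgen)
  qed (use a bn in \<open>simp_all add: wmul_in sgen_in\<close>)
  have 1: "wprodA n is = wprodA n (u @ [a, b])"
  proof -
    have "wprodA n is = wa" using I(3) Lw len by (simp add: wa_def)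
    also have "\<dots> = wmul (wmul x (sgen n a)) (sgen n b)"
      using sgen_sgen a bn by (simp add: x_def wab_def)
    finally show ?thesis using u by (simp add: wprodA_append wprodA_Cons wprodA_Nil wmul_assoc)
  qed
  have 2: "wprodA n js = wprodA n (u @ [b, a])"
  proof -
    have "w = wmul x (wmul (wmul (sgen n a) (sgen n b)) (sgen n a))"
      using sgen_sgen a bn by (simp add: x_def wab_def wa_def flip: wmul_assoc)
    then have "w = wmul (wmul (wmul x (sgen n b)) (sgen n a)) (sgen n b)"
      unfolding sab by (simp only: wmul_assoc)
    moreover have "wprodA n js = wmul w (sgen n b)" using J(3) Lw len by simp
    ultimately have "wprodA n js = wmul (wmul x (sgen n b)) (sgen n a)"
      using sgen_sgen[OF bn] by simp
    then show ?thesis using u by (simp add: wprodA_append wprodA_Cons wprodA_Nil wmul_assoc)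
  qed
  have Lx: "length (u @ [a, b]) = r"
    using u \<open>Suc (Lw n wa) = Lw n w\<close> \<open>Suc (Lw n wab) = Lw n wa\<close> \<open>Suc (Lw n x) = Lw n wab\<close> Lw by simp
  have "breq n is (u @ [a, b])"
    using Lx len sets u a bn I(1) Lw 1 by (intro IH) auto
  then have e1: "breq n (is @ [a]) (u @ [a, b, a])" using breq_append[of n "is" "u @ [a, b]" "[a]"] by simp
  have "breq n js (u @ [b, a])"
    using Lx len sets u a bn J(1) Lw 2 by (intro IH) auto
  then have e2: "breq n (js @ [b]) (u @ [b, a, b])" using breq_append[of n js "u @ [b, a]" "[b]"] by simp
  have "breq n (u @ [a, b, a]) (u @ [b, a, b])"
    by (rule breq_prepend[OF breq_braid[OF n3 a b]])
  then show ?thesis using e1 e2 breq_trans breq_sym by metis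
qed

text \<open>The commuting counterpart: both last letters are descents, so the element is x times
  \<open>s_a s_b\<close> with lengths adding, and both words are compared with that.\<close>

lemma Matsumoto_far:
  assumes IH: "\<And>is js. length is = r \<Longrightarrow> length js = r \<Longrightarrow> set is \<subseteq> {..<n} \<Longrightarrow> set js \<subseteq> {..<n} \<Longrightarrow>
      wprodA n is = wprodA n js \<Longrightarrow> Lw n (wprodA n is) = r \<Longrightarrow> breq n is js"
    and len: "length is = r" "length js = r" and sets: "set (is @ [a]) \<subseteq> {..<n}" "set (js @ [b]) \<subseteq> {..<n}"
    and eq: "wprodA n (is @ [a]) = wprodA n (js @ [b])" and L: "Lw n (wprodA n (is @ [a])) = Suc r"
    and far: "a \<noteq> b" "(a + 1) mod n \<noteq> b" "(b + 1) mod n \<noteq> a"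
  shows "breq n (is @ [a]) (js @ [b])"
proof -
  define w where "w = wprodA n (is @ [a])"
  have a: "a < n" and bn: "b < n" using sets by auto
  have w: "w \<in> Wset n" unfolding w_def by (rule wprodA_in[OF sets(1)])
  have wb: "w = wprodA n (js @ [b])" using eq w_def by simp
  note I = Lw_word_init[OF sets(1), folded w_def]
  note J = Lw_word_init[OF sets(2), folded wb]
  note S = sgen_comm[OF a bn far]
  have Lw: "Lw n w = Suc r" using L w_def by simp
  have Ia: "zp n w (int a + 1) < zp n w (int a)" using I(2) Lw len by simp
  have Jb: "zp n w (int b + 1) < zp n w (int b)" using J(2) Lw len by simp
  define wa where "wa = wmul w (sgen n a)"
  define x where "x = wmul wa (sgen n b)"
  have in1: "wa \<in> Wset n" "x \<in> Wset n"
    unfolding wa_def x_def using w a bn by (simp_all add: wmul_sgen_in)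
  have zwa: "zp n wa y = zp n w (SI n (int a) y)" for y
    using zp_wmul_sgen w a by (simp add: wa_def)
  have L1: "Suc (Lw n wa) = Lw n w"
    unfolding wa_def by (rule Lw_sgen_down[OF w a Ia])
  have desc_b: "zp n wa (int b + 1) < zp n wa (int b)" using Jb by (simp add: zwa S)
  have L2: "Suc (Lw n x) = Lw n wa"
    unfolding x_def by (rule Lw_sgen_down[OF in1(1) bn desc_b])
  have deg: "wdeg n x = 0"
    unfolding x_def wa_def using w a bn wdeg_wprodA[OF sets(1)] in1
    by (simp add: word_deg_0 wmul_sgen_in w_def wprodA_in[OF sets(1)])
  obtain u where u: "length u = Lw n x" "set u \<subseteq> {..<n}" "x = wprodA n u"
    using reduced_word_deg_0[OF in1(2) deg] by blast
  have 1: "wprodA n is = wprodA n (u @ [b])"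
  proof -
    have "wprodA n is = wa" using I(3) Lw len by (simp add: wa_def)
    also have "\<dots> = wmul x (sgen n b)" using sgen_sgen bn by (simp add: x_def)
    finally show ?thesis using u by (simp add: wprodA_snoc)
  qed
  have 2: "wprodA n js = wprodA n (u @ [a])"
  proof -
    have "wprodA n js = wmul w (sgen n b)" using J(3) Lw len by simp
    also have "\<dots> = wmul (wmul (wmul w (sgen n b)) (sgen n a)) (sgen n a)" by (simp add: sgen_sgen a)
    also have "\<dots> = wmul x (sgen n a)"
      by (simp add: x_def wa_def wmul_assoc) (simp add: S(3) flip: wmul_assoc)
    finally show ?thesis using u by (simp add: wprodA_snoc)
  qed
  have Lx: "length (u @ [b]) = r" "length (u @ [a]) = r" using u L1 L2 Lw by simp_all
  have "breq n is (u @ [b])"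
    using Lx len sets u a bn I(1) Lw 1 by (intro IH) auto
  then have e1: "breq n (is @ [a]) (u @ [b, a])" using breq_append[of n "is" "u @ [b]" "[a]"] by simp
  have "breq n js (u @ [a])"
    using Lx len sets u a bn J(1) Lw 2 by (intro IH) auto
  then have e2: "breq n (js @ [b]) (u @ [a, b])" using breq_append[of n js "u @ [a]" "[b]"] by simp
  have "breq n (u @ [a, b]) (u @ [b, a])"
    by (rule breq_prepend[OF breq_comm[OF a bn far]])
  then show ?thesis using e1 e2 breq_trans breq_sym by metis
qed

text \<open>Induction on the length, by comparing the last letters of the two words.\<close>

theorem Matsumoto:
  assumes "length is = length js" "set is \<subseteq> {..<n}" "set js \<subseteq> {..<n}"
    "wprodA n is = wprodA n js" "Lw n (wprodA n is) = length is"
  shows "breq n is js"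
proof -
  have "length is = r \<Longrightarrow> length js = r \<Longrightarrow> set is \<subseteq> {..<n} \<Longrightarrow> set js \<subseteq> {..<n} \<Longrightarrow>
      wprodA n is = wprodA n js \<Longrightarrow> Lw n (wprodA n is) = r \<Longrightarrow> breq n is js" for r "is" js
  proof (induction r arbitrary: "is" js)
    case 0
    then show ?case by (simp add: breq_refl)
  next
    case (Suc r)
    obtain is' a where i: "is = is' @ [a]" using Suc(2) by (cases "is" rule: rev_cases) auto
    obtain js' b where j: "js = js' @ [b]" using Suc(3) by (cases js rule: rev_cases) auto
    have len: "length is' = r" "length js' = r" using Suc i j by auto
    have sets: "set (is' @ [a]) \<subseteq> {..<n}" "set (js' @ [b]) \<subseteq> {..<n}" using Suc i j by auto
    have eq: "wprodA n (is' @ [a]) = wprodA n (js' @ [b])" and L: "Lw n (wprodA n (is' @ [a])) = Suc r"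
      using Suc i j by auto
    consider "a = b" | "b = (a + 1) mod n" | "a = (b + 1) mod n"
      | "a \<noteq> b" "(a + 1) mod n \<noteq> b" "(b + 1) mod n \<noteq> a" by blast
    then show ?case
    proof cases
      case 1
      have L': "Lw n (wprodA n (is' @ [a])) = length (is' @ [a])" using L len by simp
      have "wprodA n is' = wprodA n js'"
        using Lw_word_init(3)[OF sets(1) L'] sgen_sgen[of b "wprodA n js'"] eq sets 1 by (simp add: wprodA_snoc)
      moreover have "Lw n (wprodA n is') = r" using Lw_word_init(1)[OF sets(1) L'] len by simp
      ultimately have "breq n is' js'" using sets len by (intro Suc.IH) auto
      then show ?thesis using 1 i j by (simp add: breq_append)
    next
      case 2
      show ?thesis unfolding i j by (rule Matsumoto_adjacent[OF Suc.IH len sets eq L 2])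
    next
      case 3
      have "Lw n (wprodA n (js' @ [b])) = Suc r" using L eq by simp
      then have "breq n (js' @ [b]) (is' @ [a])"
        by (intro Matsumoto_adjacent[OF Suc.IH len(2,1) sets(2,1) eq[symmetric] _ 3])
      then show ?thesis unfolding i j by (rule breq_sym)
    next
      case 4
      show ?thesis unfolding i j by (rule Matsumoto_far[OF Suc.IH len sets eq L 4])
    qed
  qed
  then show ?thesis using assms by metis
qed

end

subsection \<open>Parabolic subgroups and double cosets\<close>

lemma WK_mono: "J \<subseteq> K \<Longrightarrow> WK J \<subseteq> WK K"
  by (auto simp: WK_def)

context affine_sym
begin

text \<open>Minimality of w in the coset \<open>w W_J\<close>, expressed on the integers: no j in J
  is a right descent.\<close>

definition increasing_on :: "nat set \<Rightarrow> waff \<Rightarrow> bool" where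
  "increasing_on J w \<longleftrightarrow> (\<forall>j\<in>J. zp n w (int j) < zp n w (int j + 1))"

lemma wprodS_eq_wprodA: "set is \<subseteq> {1..<n} \<Longrightarrow> wprodS is = wprodA n is"
  by (induction "is") (auto simp: wprodS_Nil wprodA_Nil wprodS_Cons wprodA_Cons sgen_def)

lemma sfin_eq_sgen: "1 \<le> i \<Longrightarrow> sfin i = sgen n i"
  by (simp add: sgen_def)

lemma WK_in: "J \<subseteq> {1..<n} \<Longrightarrow> u \<in> WK J \<Longrightarrow> u \<in> Wset n"
  unfolding WK_def using wprodS_in by blast

lemma WK_one: "wone \<in> WK J"
  unfolding WK_def using wprodS_Nil by (metis (mono_tags, lifting) empty_set empty_subsetI mem_Collect_eq)

lemma WK_mult: "u \<in> WK J \<Longrightarrow> v \<in> WK J \<Longrightarrow> wmul u v \<in> WK J"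
proof -
  assume "u \<in> WK J" "v \<in> WK J"
  then obtain "is" js where "u = wprodS is" "v = wprodS js" "set is \<subseteq> J" "set js \<subseteq> J" by (auto simp: WK_def)
  then have "wmul u v = wprodS (is @ js)" "set (is @ js) \<subseteq> J" by (auto simp: wprodS_append)
  then show "wmul u v \<in> WK J" unfolding WK_def by blast
qed

lemma WK_gen: "j \<in> J \<Longrightarrow> sfin j \<in> WK J"
proof -
  assume "j \<in> J"
  moreover have "sfin j = wprodS [j]" by (simp add: wprodS_Cons wprodS_Nil wmul_one)
  ultimately show "sfin j \<in> WK J" unfolding WK_def by (metis (mono_tags, lifting) empty_set list.simps(15) mem_Collect_eq
    empty_subsetI insert_subset)
qed

lemma winv_unique: "a \<in> Wset n \<Longrightarrow> b \<in> Wset n \<Longrightarrow> wmul a b = wone \<Longrightarrow> winv a = b"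
  by (metis wmul_assoc wmul_one wmul_winv(2))

lemma winv_wmul: "a \<in> Wset n \<Longrightarrow> b \<in> Wset n \<Longrightarrow> winv (wmul a b) = wmul (winv b) (winv a)"
proof -
  assume a: "a \<in> Wset n" and b: "b \<in> Wset n"
  have "wmul (wmul a b) (wmul (winv b) (winv a)) = wmul (wmul a (wmul b (winv b))) (winv a)"
    by (simp only: wmul_assoc)
  also have "\<dots> = wone" using a b by (simp add: wmul_winv wmul_one)
  finally show "winv (wmul a b) = wmul (winv b) (winv a)"
    using a b by (intro winv_unique) (simp_all add: wmul_in winv_in)
qed

lemma winv_winv: "a \<in> Wset n \<Longrightarrow> winv (winv a) = a"
  by (intro winv_unique) (simp_all add: winv_in wmul_winv)

lemma winv_wone: "winv wone = wone"
  by (intro winv_unique) (simp_all add: wone_in wmul_one)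

lemma winv_sgen: "k < n \<Longrightarrow> winv (sgen n k) = sgen n k"
  using sgen_sgen[of k wone] by (intro winv_unique) (simp_all add: sgen_in wmul_one)

lemma winv_wprodA: "set is \<subseteq> {..<n} \<Longrightarrow> winv (wprodA n is) = wprodA n (rev is)"
proof (induction "is")
  case (Cons k "is")
  then have "winv (wprodA n (k # is)) = wmul (winv (wprodA n is)) (winv (sgen n k))"
    by (simp add: wprodA_Cons winv_wmul sgen_in wprodA_in)
  then show ?case using Cons by (simp add: wprodA_snoc winv_sgen)
qed (simp add: wprodA_Nil winv_wone)

lemma winv_wpow_tau: "winv (wpow (tau n) j) = wpow (tau n) (- j)"
  by (intro winv_unique) (simp_all add: wpow_tau_in wpow_tau_add)

lemma WK_inv:
  assumes J: "J \<subseteq> {1..<n}" and "u \<in> WK J"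
  shows "winv u \<in> WK J"
proof -
  obtain "is" where i: "u = wprodS is" "set is \<subseteq> J" using assms(2) by (auto simp: WK_def)
  have "set is \<subseteq> {1..<n}" "set (rev is) \<subseteq> {1..<n}" "set is \<subseteq> {..<n}" using i J by auto
  then have "winv u = wprodS (rev is)" using i winv_wprodA by (simp add: wprodS_eq_wprodA)
  then show ?thesis using i unfolding WK_def by (metis (mono_tags, lifting) mem_Collect_eq set_rev)
qed

text \<open>The inverse is given by the reversed word; the power of \<open>tau\<close> then stands
  in front, and moving it to the end only renames the letters.\<close>

lemma Lw_winv_le: "w \<in> Wset n \<Longrightarrow> Lw n (winv w) \<le> Lw n w"
proof -
  assume w: "w \<in> Wset n"
  obtain "is" j where i: "length is = Lw n w" "set is \<subseteq> {..<n}" "w = wmul (wprodA n is) (wpow (tau n) j)"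
    using reduced_exists[OF w] by blast
  have s: "set (rev is) \<subseteq> {..<n}" using i by simp
  have "winv w = wmul (wpow (tau n) (- j)) (wprodA n (rev is))"
    using i by (simp add: winv_wmul wprodA_in wpow_tau_in winv_wpow_tau winv_wprodA)
  also have "\<dots> = wmul (wprodA n (shl n (- j) (rev is))) (wpow (tau n) (- j))"
    by (rule tau_wprodA[OF s])
  finally have "Lw n (winv w) = Lw n (wprodA n (shl n (- j) (rev is)))"
    by (simp add: Lw_tau wprodA_in set_shl)
  then show "Lw n (winv w) \<le> Lw n w" using Lw_word_le[OF set_shl, of "- j" "rev is"] i by simp
qed

lemma Lw_winv: "w \<in> Wset n \<Longrightarrow> Lw n (winv w) = Lw n w"
  using Lw_winv_le[of w] Lw_winv_le[of "winv w"] by (simp add: winv_in winv_winv)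

lemma increasing_on_sgen:
  assumes "w \<in> Wset n" "k < n"
  shows "zp n w (int k) < zp n w (int k + 1) \<longleftrightarrow> Lw n w \<le> Lw n (wmul w (sgen n k))"
  using Lw_descent_iff[OF assms] zp_Suc_neq[OF assms(1), of "int k"] by auto

text \<open>An element of \<open>WK J\<close> stabilises every set of integers \<open>\<le> z\<close> whose end point is not
  in \<open>J\<close> modulo \<open>n\<close>.\<close>

lemma WK_block:
  assumes J: "J \<subseteq> {1..<n}" and u: "u \<in> WK J" and z: "z mod int n \<notin> int ` J"
  shows "zp n u x \<le> z \<longleftrightarrow> x \<le> z"
proof -
  obtain "is" where i: "u = wprodS is" "set is \<subseteq> J" using u by (auto simp: WK_def)
  have S: "SI n (int j) y \<le> z \<longleftrightarrow> y \<le> z" if j: "j \<in> J" for j y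
  proof -
    have "(z - int j) mod int n \<noteq> 0"
    proof
      assume "(z - int j) mod int n = 0"
      then have "z mod int n = int j mod int n" by (simp add: mod_eq_dvd_iff mod_eq_0_iff_dvd)
      then have "z mod int n = int j" using j J by auto
      then show False using z j by auto
    qed
    then have "y \<noteq> z" if "(y - int j) mod int n = 0" using that by auto
    moreover have "y \<noteq> z + 1" if "(y - int j - 1) mod int n = 0"
      using that \<open>(z - int j) mod int n \<noteq> 0\<close> by (auto simp: algebra_simps)
    ultimately show ?thesis by (auto simp: SI_def)
  qed
  have "zp n (wprodS is) x \<le> z \<longleftrightarrow> x \<le> z" if "set is \<subseteq> J" for "is"
    using that
  proof (induction "is")
    case (Cons j "is")
    then have "set is \<subseteq> {1..<n}" "1 \<le> j" "j < n" using J by auto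
    then have "zp n (wprodS (j # is)) x = SI n (int j) (zp n (wprodS is) x)"
      by (simp add: wprodS_Cons zp_wmul wprodS_in zp_sfin)
    then show ?case using Cons S by simp
  qed (simp add: wprodS_Nil zp_wone)
  then show ?thesis using i by simp
qed

text \<open>Strict increase in the integers means growth by at least one per step. Besides
  monotonicity of d along a block of J, this bounds gaps when applied to
  \<open>winv d\<close>.\<close>

lemma increasing_chain:
  assumes "periodic n f" "x < y" and up: "\<And>j. j \<in> J \<Longrightarrow> f (int j) < f (int j + 1)"
    and J: "\<And>z. x \<le> z \<Longrightarrow> z < y \<Longrightarrow> z mod int n \<in> int ` J"
  shows "f x + (y - x) \<le> f y"
proof -
  have step: "f z < f (z + 1)" if zJ: "z mod int n \<in> int ` J" for z
  proof -
    obtain j where j: "z mod int n = int j" "j \<in> J" using zJ by auto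
    have "z = int j + int n * (z div int n)" using mod_mult_div_eq[of z "int n"] j(1) by simp
    then obtain m where "z = int j + int n * m" by blast
    then have z: "z = int j + int n * m" "z + 1 = (int j + 1) + int n * m" by simp_all
    show ?thesis unfolding z(2) unfolding z(1) periodic_mult[OF assms(1)] using up[OF j(2)] by simp
  qed
  show ?thesis
    using assms(2) J
  proof (induction y rule: int_gr_induct)
    case base
    then show ?case using step[of x] by simp
  next
    case (step y)
    have "f y < f (y + 1)" using step(1) step(3)[of y] by (intro \<open>\<And>z. z mod int n \<in> int ` J \<Longrightarrow> f z < f (z + 1)\<close>) simp
    then show ?case using step by simp
  qed
qed

text \<open>An index k outside J ends a J-block, so by \<open>WK_block\<close> u keeps k and k + 1
  on their sides of it.\<close>

lemma WK_descent_in: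
  assumes J: "J \<subseteq> {1..<n}" and u: "u \<in> WK J" and k: "k < n" "zp n u (int k + 1) < zp n u (int k)"
  shows "k \<in> J"
proof (rule ccontr)
  assume "k \<notin> J"
  then have "int k mod int n \<notin> int ` J" using k by auto
  then show False using WK_block[OF J u, of "int k" "int k"] WK_block[OF J u, of "int k" "int k + 1"] k by simp
qed

text \<open>By \<open>WK_block\<close>, no end of a J-block separates the values of u at k and k +
  1, and d is increasing along such a stretch.\<close>

lemma WK_step_increasing:
  assumes J: "J \<subseteq> {1..<n}" and u: "u \<in> WK J" and k: "k \<in> J" "zp n u (int k) < zp n u (int k + 1)"
    and d: "d \<in> Wset n" "increasing_on J d"
  shows "zp n d (zp n u (int k)) < zp n d (zp n u (int k + 1))"
proof -
  have inJ: "z mod int n \<in> int ` J" if z: "zp n u (int k) \<le> z" "z < zp n u (int k + 1)" for z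
  proof (rule ccontr)
    assume nz: "z mod int n \<notin> int ` J"
    have "int k \<le> z" "z < int k + 1"
      using WK_block[OF J u nz, of "int k"] WK_block[OF J u nz, of "int k + 1"] z by auto
    then have "z = int k" by simp
    then show False using nz k J by auto
  qed
  have "zp n d (zp n u (int k)) + (zp n u (int k + 1) - zp n u (int k)) \<le> zp n d (zp n u (int k + 1))"
    by (rule increasing_chain[OF periodic_zp k(2) _ inJ]) (use d(2) in \<open>auto simp: increasing_on_def\<close>)
  then show ?thesis using k by simp
qed

lemma Lw_0_WK:
  assumes J: "J \<subseteq> {1..<n}" and u: "u \<in> WK J" and "Lw n u = 0"
  shows "u = wone"
proof -
  have uin: "u \<in> Wset n" using WK_in[OF J u] .
  obtain "is" where "u = wprodS is" "set is \<subseteq> J" using u by (auto simp: WK_def)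
  then have "u = wprodA n is" "set is \<subseteq> {..<n}" using wprodS_eq_wprodA[of "is"] J by auto
  then have "wdeg n u = 0" by (simp add: wdeg_wprodA)
  then obtain js where "length js = Lw n u" "set js \<subseteq> {..<n}" "u = wprodA n js"
    using reduced_word_deg_0[OF uin] by blast
  then show ?thesis using assms by (simp add: wprodA_Nil)
qed

lemma WK_descent_exists:
  assumes J: "J \<subseteq> {1..<n}" and u: "u \<in> WK J" and "Lw n u \<noteq> 0"
  obtains k where "k \<in> J" "zp n u (int k + 1) < zp n u (int k)"
    "Suc (Lw n (wmul u (sfin k))) = Lw n u" "wmul u (sfin k) \<in> WK J" "wmul (wmul u (sfin k)) (sfin k) = u"
    "zp n (wmul u (sfin k)) (int k) < zp n (wmul u (sfin k)) (int k + 1)"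
proof -
  have uin: "u \<in> Wset n" using WK_in[OF J u] .
  have "\<exists>k<n. zp n u (int k + 1) < zp n u (int k)"
  proof (rule ccontr)
    assume no: "\<not> ?thesis"
    have up: "zp n u k < zp n u (k + 1)" for k
    proof (rule increasing_if_no_descent[OF n2 periodic_zp])
      fix k :: int assume k: "0 \<le> k" "k < int n"
      then have "nat k < n" by simp
      then have "\<not> zp n u (int (nat k) + 1) < zp n u (int (nat k))" using no by blast
      then show "zp n u k < zp n u (k + 1)" using zp_Suc_neq[OF uin, of k] k by simp
    qed
    have "\<not> zp n u j < zp n u i" if "i < j" for i j
      using strict_increasing[of "zp n u", OF up that] by simp
    then have "Inv n 1 (zp n u) = {}" by (auto simp: Inv_def)
    then show False using assms(3) by (simp add: Lw_def)
  qed
  then obtain k where k: "k < n" "zp n u (int k + 1) < zp n u (int k)" by blast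
  have kJ: "k \<in> J" by (rule WK_descent_in[OF J u k])
  then have s: "sfin k = sgen n k" using J by (intro sfin_eq_sgen) auto
  show ?thesis
  proof (rule that[OF kJ k(2)])
    show "Suc (Lw n (wmul u (sfin k))) = Lw n u" unfolding s by (rule Lw_sgen_down[OF uin k])
    show "wmul u (sfin k) \<in> WK J" by (intro WK_mult u WK_gen kJ)
    show "wmul (wmul u (sfin k)) (sfin k) = u" unfolding s by (rule sgen_sgen[OF k(1)])
    show "zp n (wmul u (sfin k)) (int k) < zp n (wmul u (sfin k)) (int k + 1)"
      unfolding s zp_wmul_sgen[OF uin k(1)] using k(2) by (simp add: SI_self SI_Suc[OF n2])
  qed
qed

text \<open>Induction on the length of u: an ascent inside \<open>W_J\<close> remains an ascent
  after multiplication by d on the left.\<close>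

theorem Lw_coset:
  assumes J: "J \<subseteq> {1..<n}" and d: "d \<in> Wset n" "increasing_on J d" and u: "u \<in> WK J"
  shows "Lw n (wmul d u) = Lw n d + Lw n u"
  using u
proof (induction "Lw n u" arbitrary: u)
  case 0
  then show ?case using Lw_0_WK[OF J 0(2)] by (simp add: wmul_one)
next
  case (Suc r)
  then have "Lw n u \<noteq> 0" by simp
  then obtain k where k: "k \<in> J" "zp n u (int k + 1) < zp n u (int k)"
    "Suc (Lw n (wmul u (sfin k))) = Lw n u" "wmul u (sfin k) \<in> WK J" "wmul (wmul u (sfin k)) (sfin k) = u"
    "zp n (wmul u (sfin k)) (int k) < zp n (wmul u (sfin k)) (int k + 1)"
    using WK_descent_exists[OF J Suc(3)] by blast
  let ?v = "wmul u (sfin k)"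
  have kn: "1 \<le> k" "k < n" using k J by auto
  have vin: "?v \<in> Wset n" using WK_in[OF J k(4)] .
  have IH: "Lw n (wmul d ?v) = Lw n d + Lw n ?v" using Suc(1)[of ?v] Suc(2) k by simp
  have "zp n (wmul d ?v) (int k) < zp n (wmul d ?v) (int k + 1)"
    using WK_step_increasing[OF J k(4) k(1) k(6) d] by (simp add: zp_wmul vin)
  then have "Lw n (wmul (wmul d ?v) (sgen n k)) = Suc (Lw n (wmul d ?v))"
    using kn by (intro Lw_sgen_up) (simp_all add: wmul_in d vin)
  moreover have "wmul (wmul d ?v) (sgen n k) = wmul d u"
    using k(5) kn by (simp add: wmul_assoc sfin_eq_sgen)
  ultimately show ?case using IH k(3) by simp
qed

text \<open>Descents of an element of \<open>W_J\<close> lie in J, so removing them one after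
  another never leaves J.\<close>

lemma WK_reduced:
  assumes J: "J \<subseteq> {1..<n}" and u: "u \<in> WK J"
  shows "\<exists>is. set is \<subseteq> J \<and> length is = Lw n u \<and> u = wprodS is"
  using u
proof (induction "Lw n u" arbitrary: u)
  case 0
  then show ?case using Lw_0_WK[OF J 0(2)] by (intro exI[of _ "[]"]) (simp add: wprodS_Nil)
next
  case (Suc r)
  then have "Lw n u \<noteq> 0" by simp
  then obtain k where k: "k \<in> J"
    "Suc (Lw n (wmul u (sfin k))) = Lw n u" "wmul u (sfin k) \<in> WK J" "wmul (wmul u (sfin k)) (sfin k) = u"
    using WK_descent_exists[OF J Suc(3)] by metis
  then obtain "is" where i: "set is \<subseteq> J" "length is = Lw n (wmul u (sfin k))" "wmul u (sfin k) = wprodS is"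
    using Suc(1)[of "wmul u (sfin k)"] Suc(2) by auto
  have "u = wprodS (is @ [k])"
    using k(4) i(3) by (simp add: wprodS_append wprodS_Cons wprodS_Nil wmul_one)
  then show ?case using i k by (intro exI[of _ "is @ [k]"]) auto
qed

lemma Lw_coset_left:
  assumes K: "K \<subseteq> {1..<n}" and d: "d \<in> Wset n" "increasing_on K (winv d)" and a: "a \<in> WK K"
  shows "Lw n (wmul a d) = Lw n a + Lw n d"
proof -
  have ain: "a \<in> Wset n" using WK_in[OF K a] .
  have "Lw n (wmul (winv d) (winv a)) = Lw n (winv d) + Lw n (winv a)"
    by (rule Lw_coset[OF K winv_in[OF d(1)] d(2) WK_inv[OF K a]])
  then have "Lw n (winv (wmul a d)) = Lw n d + Lw n a"
    using d ain by (simp add: winv_wmul Lw_winv)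
  then show ?thesis using d ain by (simp add: Lw_winv wmul_in)
qed

text \<open>If f = g w with w in \<open>W_J\<close>, additivity of the length in both directions
  gives l(f) = l(g) + l(w) and l(g) = l(f) + l(w'), where w' is the inverse of w; so w has length
  0.\<close>

lemma coset_unique:
  assumes J: "J \<subseteq> {1..<n}" and f: "f \<in> Wset n" "increasing_on J f" and g: "g \<in> Wset n" "increasing_on J g"
    and u: "u \<in> WK J" and v: "v \<in> WK J" and eq: "wmul f u = wmul g v"
  shows "f = g \<and> u = v"
proof -
  have uin: "u \<in> Wset n" "v \<in> Wset n" using WK_in[OF J] u v by auto
  define w where "w = wmul v (winv u)"
  have w: "w \<in> WK J" unfolding w_def by (intro WK_mult v WK_inv J u)
  have win: "w \<in> Wset n" using WK_in[OF J w] .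
  have "f = wmul (wmul f u) (winv u)" using uin by (simp add: wmul_assoc wmul_winv wmul_one)
  then have fg: "f = wmul g w" unfolding eq by (simp add: w_def wmul_assoc)
  then have gf: "g = wmul f (winv w)" using win by (simp add: wmul_assoc wmul_winv wmul_one)
  have "Lw n f = Lw n g + Lw n w" using Lw_coset[OF J g w] fg by simp
  moreover have "Lw n g = Lw n f + Lw n (winv w)" using Lw_coset[OF J f WK_inv[OF J w]] gf by simp
  ultimately have "Lw n w = 0" by simp
  then have "w = wone" by (rule Lw_0_WK[OF J w])
  then have "f = g" using fg by (simp add: wmul_one)
  then show ?thesis using eq wmul_cancel_left[OF f(1)] by simp
qed

lemma coset_exists:
  assumes J: "J \<subseteq> {1..<n}" and w: "w \<in> Wset n"
  obtains d u where "d \<in> Wset n" "increasing_on J d" "u \<in> WK J" "w = wmul d u"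
    "\<And>v. v \<in> WK J \<Longrightarrow> Lw n d \<le> Lw n (wmul d v)"
proof -
  obtain b where b: "b \<in> WK J" "\<And>v. v \<in> WK J \<Longrightarrow> Lw n (wmul w b) \<le> Lw n (wmul w v)"
    using arg_min_nat_lemma[of "\<lambda>v. v \<in> WK J" wone "\<lambda>v. Lw n (wmul w v)"] WK_one by blast
  have bin: "b \<in> Wset n" using WK_in[OF J b(1)] .
  define d where "d = wmul w b"
  have din: "d \<in> Wset n" using w bin by (simp add: d_def wmul_in)
  have min: "Lw n d \<le> Lw n (wmul d v)" if "v \<in> WK J" for v
    using b(2)[OF WK_mult[OF b(1) that]] by (simp add: d_def wmul_assoc)
  have "increasing_on J d"
    unfolding increasing_on_def
  proof
    fix j assume j: "j \<in> J"
    then have "sfin j = sgen n j" "j < n" using J sfin_eq_sgen[of j] by auto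
    then show "zp n d (int j) < zp n d (int j + 1)"
      using increasing_on_sgen[OF din, of j] min[OF WK_gen[OF j]] by simp
  qed
  moreover have "w = wmul d (winv b)" using bin by (simp add: d_def wmul_assoc wmul_winv wmul_one)
  ultimately show ?thesis using that din WK_inv[OF J b(1)] min by blast
qed

lemma Dset_increasing:
  assumes J: "J \<subseteq> {1..<n}" and K: "K \<subseteq> {1..<n}" and d: "d \<in> Dset n K J"
  shows "d \<in> Wset n" "increasing_on J d" "increasing_on K (winv d)"
proof -
  show din: "d \<in> Wset n" using d by (simp add: Dset_def)
  have min: "Lw n d \<le> Lw n (wmul (wmul u d) v)" if "u \<in> WK K" "v \<in> WK J" for u v
  proof -
    have "u \<in> Wset n" "v \<in> Wset n" using that WK_in J K by auto
    then have "wmul (wmul u d) v \<in> Wset n" using din by (simp add: wmul_in)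
    moreover have "lenW n d \<le> lenW n (wmul (wmul u d) v)" using d that by (simp add: Dset_def)
    ultimately show ?thesis using din by (simp add: lenW_eq_Lw)
  qed
  show "increasing_on J d"
    unfolding increasing_on_def
  proof
    fix j assume j: "j \<in> J"
    then have "sfin j = sgen n j" "j < n" using J sfin_eq_sgen[of j] by auto
    then show "zp n d (int j) < zp n d (int j + 1)"
      using increasing_on_sgen[OF din, of j] min[OF WK_one WK_gen[OF j]] by (simp add: wmul_one)
  qed
  show "increasing_on K (winv d)"
    unfolding increasing_on_def
  proof
    fix k assume k: "k \<in> K"
    then have s: "sfin k = sgen n k" "k < n" using K sfin_eq_sgen[of k] by auto
    have "Lw n d \<le> Lw n (wmul (sgen n k) d)" using min[OF WK_gen[OF k] WK_one] s by (simp add: wmul_one)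
    moreover have "winv (wmul (sgen n k) d) = wmul (winv d) (sgen n k)"
      using din s by (simp add: winv_wmul sgen_in winv_sgen)
    moreover have "Lw n (winv (wmul (sgen n k) d)) = Lw n (wmul (sgen n k) d)"
      using din s by (intro Lw_winv) (simp add: wmul_in sgen_in)
    ultimately have "Lw n (winv d) \<le> Lw n (wmul (winv d) (sgen n k))" using din by (simp add: Lw_winv)
    then show "zp n (winv d) (int k) < zp n (winv d) (int k + 1)"
      using increasing_on_sgen[OF winv_in[OF din] s(2)] by simp
  qed
qed

lemma Dleft_increasing:
  assumes K: "K \<subseteq> {1..<n}" and L: "L \<subseteq> K" and a: "a \<in> Dleft n K L"
  shows "a \<in> WK K" "a \<in> Wset n" "increasing_on L a"
proof -
  show aK: "a \<in> WK K" using a by (simp add: Dleft_def)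
  show ain: "a \<in> Wset n" using WK_in[OF K aK] .
  show "increasing_on L a"
    unfolding increasing_on_def
  proof
    fix j assume j: "j \<in> L"
    then have s: "sfin j = sgen n j" "j < n" using K L sfin_eq_sgen[of j] by auto
    have "lenW n a \<le> lenW n (wmul a (sfin j))" using a WK_gen[OF j] by (simp add: Dleft_def)
    then have "Lw n a \<le> Lw n (wmul a (sgen n j))"
      using ain s by (simp add: lenW_eq_Lw wmul_in sgen_in)
    then show "zp n a (int j) < zp n a (int j + 1)" using increasing_on_sgen[OF ain s(2)] by simp
  qed
qed

text \<open>Conjugation of a simple reflection: f carries the pairs exchanged at j to those
  exchanged at f j as soon as f j and f (j + 1) are neighbours.\<close>

lemma periodic_inj_SI:
  assumes p: "periodic n f" and inj: "inj f" and s: "f (j + 1) = f j + 1"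
  shows "SI n (f j) (f t) = f (SI n j t)"
proof -
  have 1: "int n dvd f t - f i \<longleftrightarrow> int n dvd t - i" for i
  proof
    assume "int n dvd f t - f i"
    then obtain m where "f t - f i = int n * m" by (rule dvdE)
    then have "f t = f (i + int n * m)" by (simp add: periodic_mult[OF p])
    then have "t = i + int n * m" using inj by (simp add: inj_eq)
    then show "int n dvd t - i" by simp
  next
    assume "int n dvd t - i"
    then obtain m where "t - i = int n * m" by (rule dvdE)
    then have "t = i + int n * m" by simp
    then have "f t = f i + int n * m" by (simp add: periodic_mult[OF p])
    then show "int n dvd f t - f i" by simp
  qed
  show ?thesis
  proof (cases "int n dvd t - j")
    case True
    then obtain m where "t - j = int n * m" by (rule dvdE)
    then have t: "t = j + int n * m" by simp
    show ?thesis using s unfolding t by (simp add: periodic_mult[OF p] periodic_mult[OF periodic_SI] SI_self)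
  next
    case F: False
    show ?thesis
    proof (cases "int n dvd t - (j + 1)")
      case True
      then obtain m where "t - (j + 1) = int n * m" by (rule dvdE)
      then have t: "t = (j + 1) + int n * m" by simp
      show ?thesis unfolding t periodic_mult[OF p] periodic_mult[OF periodic_SI] s SI_Suc[OF n2] ..
    next
      case False
      then have "\<not> int n dvd f t - f j" "\<not> int n dvd f t - f j - 1"
        using 1[of j] 1[of "j + 1"] F s by (simp_all add: algebra_simps)
      then show ?thesis using F False by (simp add: SI_fix mod_eq_0_iff_dvd algebra_simps)
    qed
  qed
qed

text \<open>The images of j and j + 1 under d are either separated by the end of a K-block, which a
  respects, or lie in one block. In the second case monotonicity of the inverse of d forces them to
  be neighbours, so d conjugates \<open>s_j\<close> into a generator in K, and a is increasing there
  by its minimality for \<open>capd K d J\<close>.\<close>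

lemma double_coset_increasing:
  assumes J: "J \<subseteq> {1..<n}" and K: "K \<subseteq> {1..<n}" and d: "d \<in> Dset n K J"
    and a: "a \<in> Dleft n K (capd K d J)"
  shows "increasing_on J (wmul a d)"
  unfolding increasing_on_def
proof
  fix j assume j: "j \<in> J"
  note D = Dset_increasing[OF J K d]
  have L: "capd K d J \<subseteq> K" by (auto simp: capd_def)
  note A = Dleft_increasing[OF K L a]
  let ?x = "zp n d (int j)" and ?y = "zp n d (int j + 1)"
  have xy: "?x < ?y" using D(2) j by (simp add: increasing_on_def)
  show "zp n (wmul a d) (int j) < zp n (wmul a d) (int j + 1)"
  proof (cases "\<exists>z. ?x \<le> z \<and> z < ?y \<and> z mod int n \<notin> int ` K")
    case True
    then obtain z where z: "?x \<le> z" "z < ?y" "z mod int n \<notin> int ` K" by blast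
    have "zp n a ?x \<le> z" "\<not> zp n a ?y \<le> z" using WK_block[OF K A(1) z(3)] z by auto
    then show ?thesis using D(1) by (simp add: zp_wmul)
  next
    case False
    then have inK: "z mod int n \<in> int ` K" if "?x \<le> z" "z < ?y" for z using that by blast
    \<comment> \<open>The preimages of the two points are j and j + 1, so this leaves a gap of at
      most one.\<close>
    have "zp n (winv d) ?x + (?y - ?x) \<le> zp n (winv d) ?y"
      using D(3) by (intro increasing_chain[OF periodic_zp xy _ inK]) (auto simp: increasing_on_def)
    then have y: "?y = ?x + 1" using xy by (simp add: zp_winv_comp(1)[OF D(1)])
    obtain k where k: "?x mod int n = int k" "k \<in> K" using inK[of ?x] xy by auto
    then have kn: "1 \<le> k" "k < n" using K by auto
    have xk: "(int k - ?x) mod int n = 0" using k(1) by (metis mod_diff_left_eq diff_self mod_0)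
    have jn: "1 \<le> j" "j < n" using j J by auto
    have "wmul (wmul (winv d) (sfin k)) d = sfin j"
    proof (rule zp_inj)
      have "zp n (wmul (wmul (winv d) (sfin k)) d) t = zp n (sfin j) t" for t
      proof -
        have "zp n (wmul (wmul (winv d) (sfin k)) d) t = zp n (winv d) (SI n (int k) (zp n d t))"
          using D(1) kn by (simp add: zp_wmul wmul_in winv_in sfin_in zp_sfin)
        also have "SI n (int k) = SI n ?x" by (rule SI_cong[OF xk])
        also have "SI n ?x (zp n d t) = zp n d (SI n (int j) t)"
          by (rule periodic_inj_SI[OF periodic_zp inj_zp[OF D(1)] y])
        finally show ?thesis using D(1) jn by (simp add: zp_winv_comp zp_sfin)
      qed
      then show "zp n (wmul (wmul (winv d) (sfin k)) d) = zp n (sfin j)" by (rule ext)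
    qed (use D(1) kn jn in \<open>simp_all add: wmul_in winv_in sfin_in\<close>)
    then have "k \<in> capd K d J" using k(2) j by (auto simp: capd_def)
    then have "zp n a (int k) < zp n a (int k + 1)" using A(3) by (simp add: increasing_on_def)
    moreover have "(?x - int k) mod int n = 0" using k(1) kn by (metis mod_diff_left_eq diff_self mod_0)
    ultimately have "\<not> zp n a (?x + 1) < zp n a ?x" using periodic_desc_cong[OF periodic_zp, of ?x "int k" a] by simp
    then show ?thesis using D(1) y zp_Suc_neq[OF A(2), of ?x] by (simp add: zp_wmul)
  qed
qed

text \<open>Conjugation by d turns each generator in \<open>capd K d J\<close> into one in
  J.\<close>

lemma capd_conj:
  assumes J: "J \<subseteq> {1..<n}" and K: "K \<subseteq> {1..<n}" and d: "d \<in> Wset n" and b: "b \<in> WK (capd K d J)"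
  shows "\<exists>b'\<in>WK J. wmul b d = wmul d b'"
proof -
  have "\<exists>b'\<in>WK J. wmul (wprodS is) d = wmul d b'" if "set is \<subseteq> capd K d J" for "is"
    using that
  proof (induction "is")
    case Nil
    then show ?case using WK_one by (intro bexI[of _ wone]) (simp_all add: wprodS_Nil wmul_one)
  next
    case (Cons k "is")
    then obtain b' where b': "b' \<in> WK J" "wmul (wprodS is) d = wmul d b'" by auto
    obtain j where j: "j \<in> J" "wmul (wmul (winv d) (sfin k)) d = sfin j" using Cons by (auto simp: capd_def)
    have "wmul (sfin k) d = wmul (wmul d (winv d)) (wmul (sfin k) d)" using d by (simp add: wmul_winv wmul_one)
    also have "\<dots> = wmul d (sfin j)" unfolding j(2)[symmetric] by (simp only: wmul_assoc)
    finally have "wmul (wprodS (k # is)) d = wmul d (wmul (sfin j) b')"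
      using b' by (simp add: wprodS_Cons wmul_assoc) (simp flip: wmul_assoc)
    then show ?case using WK_mult[OF WK_gen[OF j(1)] b'(1)] by blast
  qed
  then show ?thesis using b by (auto simp: WK_def)
qed

text \<open>Surjectivity: the left factor splits as a b along \<open>capd K d J\<close>, and b moves
  across d into \<open>W_J\<close>. Injectivity: a d is the minimal element of its coset modulo
  \<open>W_J\<close>, hence determined by the product.\<close>

theorem double_coset_bij:
  assumes J: "J \<subseteq> {1..<n}" and K: "K \<subseteq> {1..<n}" and d: "d \<in> Dset n K J"
  shows "bij_betw (\<lambda>(a, u). wmul (wmul a d) u) (Dleft n K (capd K d J) \<times> WK J)
     {wmul (wmul u d) w | u w. u \<in> WK K \<and> w \<in> WK J}"
    "a \<in> Dleft n K (capd K d J) \<Longrightarrow> u \<in> WK J \<Longrightarrow> Lw n (wmul (wmul a d) u) = Lw n (wmul a d) + Lw n u"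
    "a \<in> Dleft n K (capd K d J) \<Longrightarrow> Lw n (wmul a d) = Lw n a + Lw n d"
proof -
  note D = Dset_increasing[OF J K d]
  have L: "capd K d J \<subseteq> K" by (auto simp: capd_def)
  have Ln: "capd K d J \<subseteq> {1..<n}" using L K by auto
  note A = Dleft_increasing[OF K L]
  show 3: "Lw n (wmul a d) = Lw n a + Lw n d" if "a \<in> Dleft n K (capd K d J)" for a
    using Lw_coset_left[OF K D(1,3)] A(1)[OF that] by blast
  show "Lw n (wmul (wmul a d) u) = Lw n (wmul a d) + Lw n u" if "a \<in> Dleft n K (capd K d J)" "u \<in> WK J" for a u
    using Lw_coset[OF J _ double_coset_increasing[OF J K d that(1)] that(2)] A(2)[OF that(1)] D(1)
    by (simp add: wmul_in)
  show "bij_betw (\<lambda>(a, u). wmul (wmul a d) u) (Dleft n K (capd K d J) \<times> WK J)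
     {wmul (wmul u d) w | u w. u \<in> WK K \<and> w \<in> WK J}"
  proof (rule bij_betw_imageI)
    show "inj_on (\<lambda>(a, u). wmul (wmul a d) u) (Dleft n K (capd K d J) \<times> WK J)"
    proof (rule inj_onI; clarify)
      fix a u b v
      assume as: "a \<in> Dleft n K (capd K d J)" "u \<in> WK J" "b \<in> Dleft n K (capd K d J)" "v \<in> WK J"
        "wmul (wmul a d) u = wmul (wmul b d) v"
      have "wmul a d = wmul b d \<and> u = v"
        using as A(2)[OF as(1)] A(2)[OF as(3)] D(1)
        by (intro coset_unique[OF J _ double_coset_increasing[OF J K d as(1)] _ double_coset_increasing[OF J K d as(3)]])
           (simp_all add: wmul_in)
      then show "a = b \<and> u = v" using wmul_cancel_right[OF D(1)] by blast
    qed
    show "(\<lambda>(a, u). wmul (wmul a d) u) ` (Dleft n K (capd K d J) \<times> WK J) =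
      {wmul (wmul u d) w | u w. u \<in> WK K \<and> w \<in> WK J}"
    proof (intro equalityI subsetI)
      fix x assume "x \<in> (\<lambda>(a, u). wmul (wmul a d) u) ` (Dleft n K (capd K d J) \<times> WK J)"
      then obtain a u where "x = wmul (wmul a d) u" "a \<in> Dleft n K (capd K d J)" "u \<in> WK J" by auto
      then show "x \<in> {wmul (wmul u d) w | u w. u \<in> WK K \<and> w \<in> WK J}" using A(1) by blast
    next
      fix x assume "x \<in> {wmul (wmul u d) w | u w. u \<in> WK K \<and> w \<in> WK J}"
      then obtain u w where uw: "x = wmul (wmul u d) w" "u \<in> WK K" "w \<in> WK J" by blast
      have uin: "u \<in> Wset n" using WK_in[OF K uw(2)] .
      obtain a b where ab: "a \<in> Wset n" "b \<in> WK (capd K d J)" "u = wmul a b"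
        "\<And>v. v \<in> WK (capd K d J) \<Longrightarrow> Lw n a \<le> Lw n (wmul a v)"
        using coset_exists[OF Ln uin] by metis
      have bin: "b \<in> Wset n" using WK_in[OF Ln ab(2)] .
      have "a = wmul u (winv b)" using ab(3) bin by (simp add: wmul_assoc wmul_winv wmul_one)
      then have "a \<in> WK K" using WK_mult[OF uw(2)] WK_inv[OF Ln ab(2)] WK_mono[OF L] by blast
      then have aD: "a \<in> Dleft n K (capd K d J)"
        using ab(1,4) WK_in[OF Ln] by (auto simp: Dleft_def lenW_eq_Lw wmul_in)
      obtain b' where b': "b' \<in> WK J" "wmul b d = wmul d b'" using capd_conj[OF J K D(1) ab(2)] by blast
      have "x = wmul (wmul a d) (wmul b' w)"
        unfolding uw(1) ab(3) by (simp add: wmul_assoc) (simp add: b'(2) flip: wmul_assoc)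
      then show "x \<in> (\<lambda>(a, u). wmul (wmul a d) u) ` (Dleft n K (capd K d J) \<times> WK J)"
        using aD WK_mult[OF b'(1) uw(3)] by force
    qed
  qed
qed

lemma finite_WK:
  assumes "J \<subseteq> {1..<n}" shows "finite (WK J)"
proof (rule finite_subset)
  show "WK J \<subseteq> {\<sigma>. \<sigma> permutes {1..n}} \<times> {\<lambda>_. 0}"
  proof
    fix w assume w: "w \<in> WK J"
    then have "fst w permutes {1..n}" using WK_in[OF assms w] by (simp add: Wset_def)
    moreover have "snd w = (\<lambda>_. 0)" using w by (auto simp: WK_def snd_wprodS)
    ultimately show "w \<in> {\<sigma>. \<sigma> permutes {1..n}} \<times> {\<lambda>_. 0}" by (cases w) auto
  qed
qed (simp add: finite_permutations)

end

subsection \<open>A basis of the affine Hecke algebra\<close>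

locale affine_hecke = affine_sym n for n :: nat +
  fixes q :: nat and Q :: "'k::field"
  assumes Q_def: "Q = of_nat q" and Q0: "Q \<noteq> 0"
begin

abbreviation hq :: "'k falg \<Rightarrow> 'k falg \<Rightarrow> bool" (infix "\<simeq>" 50) where
  "x \<simeq> y \<equiv> heq n q x y"

section \<open>The defining relations as congruences\<close>

lemma relation_invalid: "\<not> valid_gen n g \<Longrightarrow> fgen g \<in> (relations n q :: 'k falg set)"
  unfolding relations_def by (rule UnI1, rule UnI1, rule UnI1, rule UnI1, rule UnI1, rule UnI1, rule UnI1, rule UnI1) blast

lemma relation_quadratic: "1 \<le> i \<and> i < n \<Longrightarrow> fmul (TG i - fsc (of_nat q)) (TG i + fsc 1) \<in> (relations n q :: 'k falg set)"
  unfolding relations_def by (rule UnI1, rule UnI1, rule UnI1, rule UnI1, rule UnI1, rule UnI1, rule UnI1, rule UnI2) blast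

lemma relation_braid: "1 \<le> i \<and> Suc i < n \<Longrightarrow> fprod [TG i, TG (Suc i), TG i] - fprod [TG (Suc i), TG i, TG (Suc i)] \<in> (relations n q :: 'k falg set)"
  unfolding relations_def by (rule UnI1, rule UnI1, rule UnI1, rule UnI1, rule UnI1, rule UnI1, rule UnI2) blast

lemma relation_comm: "1 \<le> i \<and> i < n \<and> 1 \<le> j \<and> j < n \<and> Suc i < j \<Longrightarrow> fmul (TG i) (TG j) - fmul (TG j) (TG i) \<in> (relations n q :: 'k falg set)"
  unfolding relations_def by (rule UnI1, rule UnI1, rule UnI1, rule UnI1, rule UnI1, rule UnI2) blast

lemma relation_X_Xi: "1 \<le> j \<and> j \<le> n \<Longrightarrow> fmul (XG j) (XiG j) - fsc 1 \<in> (relations n q :: 'k falg set)"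
  unfolding relations_def by (rule UnI1, rule UnI1, rule UnI1, rule UnI1, rule UnI2) blast

lemma relation_Xi_X: "1 \<le> j \<and> j \<le> n \<Longrightarrow> fmul (XiG j) (XG j) - fsc 1 \<in> (relations n q :: 'k falg set)"
  unfolding relations_def by (rule UnI1, rule UnI1, rule UnI1, rule UnI2) blast

lemma relation_X_X: "1 \<le> j \<and> j \<le> n \<and> 1 \<le> k \<and> k \<le> n \<Longrightarrow> fmul (XG j) (XG k) - fmul (XG k) (XG j) \<in> (relations n q :: 'k falg set)"
  unfolding relations_def by (rule UnI1, rule UnI1, rule UnI2) blast

lemma relation_T_X: "1 \<le> i \<and> i < n \<and> 1 \<le> j \<and> j \<le> n \<and> j \<noteq> i \<and> j \<noteq> Suc i \<Longrightarrow> fmul (TG i) (XG j) - fmul (XG j) (TG i) \<in> (relations n q :: 'k falg set)"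
  unfolding relations_def by (rule UnI1, rule UnI2) blast

lemma relation_TXT: "1 \<le> i \<and> i < n \<Longrightarrow> fprod [TG i, XG i, TG i] - fmul (fsc (of_nat q)) (XG (Suc i)) \<in> (relations n q :: 'k falg set)"
  unfolding relations_def by (rule UnI2) blast

lemma heq_rel: "a - b \<in> relations n q \<Longrightarrow> a \<simeq> b"
  by (simp add: heq_def hideal_relation)

lemma heq_TT:
  assumes "1 \<le> i" "i < n" shows "TG i * TG i \<simeq> fsc (Q - 1) * TG i + fsc Q"
proof (rule heq_rel)
  have "TG i * TG i - (fsc (Q - 1) * TG i + fsc Q) = fmul (TG i - fsc (of_nat q)) (TG i + fsc (1::'k))"
    by (simp add: fmul_eq_times Q_def fsc_diff algebra_simps fsc_commute)
  then show "TG i * TG i - (fsc (Q - 1) * TG i + fsc Q) \<in> relations n q"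
    using relation_quadratic[of i] assms by (simp only:)
qed

lemma heq_braid: "1 \<le> i \<Longrightarrow> Suc i < n \<Longrightarrow> TG i * (TG (Suc i) * TG i) \<simeq> TG (Suc i) * (TG i * TG (Suc i))"
  using heq_rel[OF relation_braid[of i]] by (simp add: fprod_eq_prod_list)

lemma heq_comm_TT: "1 \<le> i \<Longrightarrow> i < n \<Longrightarrow> 1 \<le> j \<Longrightarrow> j < n \<Longrightarrow> Suc i < j \<Longrightarrow> TG i * TG j \<simeq> TG j * TG i"
  using heq_rel[OF relation_comm[of i j]] by (simp add: fmul_eq_times)

lemma heq_X_Xi: "1 \<le> j \<Longrightarrow> j \<le> n \<Longrightarrow> XG j * XiG j \<simeq> 1"
  using heq_rel[OF relation_X_Xi[of j]] by (simp add: fmul_eq_times)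

lemma heq_Xi_X: "1 \<le> j \<Longrightarrow> j \<le> n \<Longrightarrow> XiG j * XG j \<simeq> 1"
  using heq_rel[OF relation_Xi_X[of j]] by (simp add: fmul_eq_times)

lemma heq_X_X: "1 \<le> j \<Longrightarrow> j \<le> n \<Longrightarrow> 1 \<le> k \<Longrightarrow> k \<le> n \<Longrightarrow> XG j * XG k \<simeq> XG k * XG j"
  using heq_rel[OF relation_X_X[of j k]] by (simp add: fmul_eq_times)

lemma heq_T_X:
  "1 \<le> i \<Longrightarrow> i < n \<Longrightarrow> 1 \<le> j \<Longrightarrow> j \<le> n \<Longrightarrow> j \<noteq> i \<Longrightarrow> j \<noteq> Suc i \<Longrightarrow> TG i * XG j \<simeq> XG j * TG i"
  using heq_rel[OF relation_T_X[of i j]] by (simp add: fmul_eq_times)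

lemma heq_TXT: "1 \<le> i \<Longrightarrow> i < n \<Longrightarrow> TG i * XG i * TG i \<simeq> fsc Q * XG (Suc i)"
  using heq_rel[OF relation_TXT[of i]] by (simp add: fmul_eq_times fprod_eq_prod_list Q_def mult.assoc)

lemma heq_invalid: "\<not> valid_gen n g \<Longrightarrow> fgen g \<simeq> 0"
  by (rule heq_rel) (simp add: relation_invalid)

lemma heq_scale:
  assumes "fsc Q * x \<simeq> fsc Q * y" shows "x \<simeq> y"
proof -
  have "fsc (inverse Q) * (fsc Q * z) = z" for z :: "'k falg"
    using Q0 by (simp add: mult.assoc[symmetric] fsc_mult[symmetric])
  then show ?thesis using heq_mult_left[OF assms, of "fsc (inverse Q)"] by simp
qed

lemma fsc_left_commute: "x * (fsc c * y) = fsc c * (x * (y :: 'k falg))"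
  by (metis mult.assoc fsc_commute)

lemma heq_inverse_comm:
  assumes j: "1 \<le> j" "j \<le> n" and c: "x * XG j \<simeq> XG j * x"
  shows "x * XiG j \<simeq> XiG j * x"
proof -
  have "x * XiG j \<simeq> (XiG j * XG j) * (x * XiG j)"
    using heq_mult_right[OF heq_sym[OF heq_Xi_X[OF j]], of "x * XiG j"] by simp
  also have "(XiG j * XG j) * (x * XiG j) = XiG j * (XG j * x) * XiG j" by (simp add: mult.assoc)
  also have "\<dots> \<simeq> XiG j * (x * XG j) * XiG j"
    by (intro heq_mult_right heq_mult_left heq_sym[OF c])
  also have "\<dots> = (XiG j * x) * (XG j * XiG j)" by (simp add: mult.assoc)
  also have "\<dots> \<simeq> (XiG j * x) * 1" by (intro heq_mult_left heq_X_Xi j)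
  finally show ?thesis by simp
qed

section \<open>The Laurent polynomials inside the algebra\<close>

definition xp :: "nat \<Rightarrow> int \<Rightarrow> 'k falg" where
  "xp j z = (if 0 \<le> z then XG j ^ nat z else XiG j ^ nat (- z))"

lemma heq_comm_power: "x * y \<simeq> y * x \<Longrightarrow> x * y ^ m \<simeq> y ^ m * x"
proof (induction m)
  case (Suc m)
  have "x * y ^ Suc m = (x * y) * y ^ m" by (simp add: mult.assoc)
  also have "\<dots> \<simeq> (y * x) * y ^ m" by (intro heq_mult_right Suc)
  also have "\<dots> = y * (x * y ^ m)" by (simp add: mult.assoc)
  also have "\<dots> \<simeq> y * (y ^ m * x)" by (intro heq_mult_left Suc)
  finally show ?case by (simp add: mult.assoc)
qed simp

lemma xp_comm:
  assumes "1 \<le> j" "j \<le> n" "x * XG j \<simeq> XG j * x" shows "x * xp j z \<simeq> xp j z * x"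
  unfolding xp_def using heq_comm_power assms heq_inverse_comm by simp

lemma X_xp_comm: "1 \<le> j \<Longrightarrow> j \<le> n \<Longrightarrow> 1 \<le> k \<Longrightarrow> k \<le> n \<Longrightarrow> XG j * xp k z \<simeq> xp k z * XG j"
  by (intro xp_comm heq_X_X)

lemma Xi_xp_comm:
  assumes "1 \<le> j" "j \<le> n" "1 \<le> k" "k \<le> n" shows "XiG j * xp k z \<simeq> xp k z * XiG j"
proof (rule xp_comm)
  have "XG k * XiG j \<simeq> XiG j * XG k" using assms by (intro heq_inverse_comm heq_X_X)
  then show "XiG j * XG k \<simeq> XG k * XiG j" by (rule heq_sym)
qed (use assms in auto)

lemma X_xp:
  assumes "1 \<le> j" "j \<le> n" shows "XG j * xp j z \<simeq> xp j (z + 1)"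
proof (cases "0 \<le> z")
  case True
  then show ?thesis by (simp add: xp_def nat_add_distrib)
next
  case False
  then obtain m where m: "nat (- z) = Suc m" "nat (- (z + 1)) = m" by (cases "nat (- z)") auto
  have "XG j * xp j z = (XG j * XiG j) * XiG j ^ m" using False m by (simp add: xp_def mult.assoc)
  also have "\<dots> \<simeq> 1 * XiG j ^ m" by (intro heq_mult_right heq_X_Xi assms)
  also have "1 * XiG j ^ m = xp j (z + 1)" using False m by (auto simp: xp_def)
  finally show ?thesis .
qed

lemma Xi_xp:
  assumes "1 \<le> j" "j \<le> n" shows "XiG j * xp j z \<simeq> xp j (z - 1)"
proof (cases "z \<le> 0")
  case True
  then obtain m where m: "z = - int m" using nonpos_int_cases by blast
  have neg: "xp j (- int k) = XiG j ^ k" for k by (cases "k = 0") (simp_all add: xp_def)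
  have "z - 1 = - int (Suc m)" using m by simp
  then show ?thesis by (simp only: m neg power_Suc heq_refl)
next
  case False
  then obtain m where m: "nat z = Suc m" "nat (z - 1) = m" by (cases "nat z") auto
  have "XiG j * xp j z = (XiG j * XG j) * XG j ^ m" using False m by (simp add: xp_def mult.assoc)
  also have "\<dots> \<simeq> 1 * XG j ^ m" by (intro heq_mult_right heq_Xi_X assms)
  also have "1 * XG j ^ m = xp j (z - 1)" using False m by (auto simp: xp_def)
  finally show ?thesis .
qed

text \<open>The factor g commutes past everything before index j and is absorbed there.\<close>

lemma heq_prod_list_update:
  assumes "distinct js" "j \<in> set js" "\<And>k. k \<in> set js \<Longrightarrow> g * f k \<simeq> f k * g" "g * f j \<simeq> y"
  shows "g * prod_list (map f js) \<simeq> prod_list (map (f(j := y)) js)"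
  using assms
proof (induction js)
  case (Cons k js)
  show ?case
  proof (cases "k = j")
    case True
    then have "map (f(j := y)) js = map f js" using Cons(2) by auto
    then have 1: "prod_list (map (f(j := y)) (k # js)) = y * prod_list (map f js)"
      by (simp only: list.map prod_list.Cons True fun_upd_same)
    have 2: "g * prod_list (map f (k # js)) = (g * f j) * prod_list (map f js)" using True by (simp add: mult.assoc)
    show ?thesis unfolding 1 2 by (rule heq_mult_right[OF Cons(5)])
  next
    case False
    have "g * prod_list (map f (k # js)) = (g * f k) * prod_list (map f js)" by (simp add: mult.assoc)
    also have "\<dots> \<simeq> (f k * g) * prod_list (map f js)" using Cons by (intro heq_mult_right) auto
    also have "\<dots> = f k * (g * prod_list (map f js))" by (simp add: mult.assoc)
    also have "\<dots> \<simeq> f k * prod_list (map (f(j := y)) js)" using Cons False by (intro heq_mult_left Cons.IH) auto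
    also have "\<dots> = prod_list (map (f(j := y)) (k # js))" using False by simp
    finally show ?thesis .
  qed
qed simp

text \<open>The monomial \<open>X^e\<close> with its variables in a fixed order, which is immaterial
  only modulo the relations. Exponents outside 1, ..., n are dropped, hence the restriction to
  \<open>LP\<close> in \<open>act_lmap\<close>.\<close>

definition xw :: "(nat \<Rightarrow>\<^sub>0 int) \<Rightarrow> 'k falg" where
  "xw e = prod_list (map (\<lambda>j. xp j (Poly_Mapping.lookup e j)) [1..<Suc n])"

lemma xw_0 [simp]: "xw 0 = 1"
proof -
  have "prod_list (map (\<lambda>j. xp j 0) js) = 1" for js by (induction js) (simp_all add: xp_def)
  then show ?thesis unfolding xw_def by simp
qed

lemma xw_update:
  assumes j: "1 \<le> j" "j \<le> n" and g: "\<And>k. 1 \<le> k \<Longrightarrow> k \<le> n \<Longrightarrow> g * xp k (Poly_Mapping.lookup e k) \<simeq> xp k (Poly_Mapping.lookup e k) * g"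
    and y: "g * xp j (Poly_Mapping.lookup e j) \<simeq> xp j (Poly_Mapping.lookup e j + d)"
  shows "g * xw e \<simeq> xw (Poly_Mapping.single j d + e)"
proof -
  let ?f = "\<lambda>k. xp k (Poly_Mapping.lookup e k)"
  have "g * prod_list (map ?f [1..<Suc n]) \<simeq> prod_list (map (?f(j := xp j (Poly_Mapping.lookup e j + d))) [1..<Suc n])"
    using j g y by (intro heq_prod_list_update) auto
  moreover have "?f(j := xp j (Poly_Mapping.lookup e j + d)) = (\<lambda>k. xp k (Poly_Mapping.lookup (Poly_Mapping.single j d + e) k))"
    by (auto simp: lookup_add lookup_single when_def fun_eq_iff add.commute)
  ultimately show ?thesis unfolding xw_def by simp
qed

lemma X_xw: "1 \<le> j \<Longrightarrow> j \<le> n \<Longrightarrow> XG j * xw e \<simeq> xw (Poly_Mapping.single j 1 + e)"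
  by (intro xw_update X_xp_comm X_xp)

lemma Xi_xw: "1 \<le> j \<Longrightarrow> j \<le> n \<Longrightarrow> XiG j * xw e \<simeq> xw (Poly_Mapping.single j (-1) + e)"
  using Xi_xp[of j] by (intro xw_update Xi_xp_comm) auto

definition lmap :: "'k laurent \<Rightarrow> 'k falg" where
  "lmap = pm_sum (\<lambda>e c. fsc c * xw e)"

lemma lmap_0 [simp]: "lmap 0 = 0" by (simp add: lmap_def)
lemma lmap_add: "lmap (f + g) = lmap f + lmap g"
  unfolding lmap_def by (rule pm_sum_add) (simp_all add: fsc_add distrib_right)
lemma lmap_single: "lmap (Poly_Mapping.single e c) = fsc c * xw e"
  unfolding lmap_def by (rule pm_sum_single) simp
lemma lmap_Lsc: "lmap (Lsc c) = fsc c"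
  by (simp add: Lsc_def lmap_single)

lemma X_lmap:
  assumes j: "1 \<le> j" "j \<le> n" shows "XG j * lmap P \<simeq> lmap (LX j * P)"
proof (induction P rule: poly_mapping_additive_induct)
  case (single u c)
  have "XG j * lmap (Poly_Mapping.single u c) = fsc c * (XG j * xw u)"
    by (simp add: lmap_single fsc_left_commute)
  also have "\<dots> \<simeq> fsc c * xw (Poly_Mapping.single j 1 + u)" by (intro heq_mult_left X_xw j)
  finally show ?case by (simp add: LX_def mult_single lmap_single)
qed (auto simp: distrib_left lmap_add intro: heq_add)

lemma Xi_lmap:
  assumes j: "1 \<le> j" "j \<le> n" shows "XiG j * lmap P \<simeq> lmap (LXinv j * P)"
proof (induction P rule: poly_mapping_additive_induct)
  case (single u c)
  have "XiG j * lmap (Poly_Mapping.single u c) = fsc c * (XiG j * xw u)"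
    by (simp add: lmap_single fsc_left_commute)
  also have "\<dots> \<simeq> fsc c * xw (Poly_Mapping.single j (-1) + u)" by (intro heq_mult_left Xi_xw j)
  finally show ?case by (simp add: LXinv_def mult_single lmap_single)
qed (auto simp: distrib_left lmap_add intro: heq_add)

lemma lmap_scale: "fsc c * lmap P = lmap (Lsc c * P)"
  by (induction P rule: poly_mapping_additive_induct)
     (simp_all add: distrib_left lmap_add lmap_single Lsc_def mult_single fsc_mult mult.assoc)

lemma lmap_X: "1 \<le> j \<Longrightarrow> j \<le> n \<Longrightarrow> lmap (LX j) \<simeq> XG j"
  using X_lmap[of j 1] lmap_Lsc[of 1] by (auto intro: heq_sym)
lemma lmap_Xi: "1 \<le> j \<Longrightarrow> j \<le> n \<Longrightarrow> lmap (LXinv j) \<simeq> XiG j"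
  using Xi_lmap[of j 1] lmap_Lsc[of 1] by (auto intro: heq_sym)

abbreviation "LP \<equiv> laurent_on {1..n} :: 'k laurent set"

lemma lmap_mult:
  assumes "P \<in> LP" shows "lmap (P * R) \<simeq> lmap P * lmap R"
  using assms
proof (induction P arbitrary: R rule: laurent_induct)
  case (scalar c)
  then show ?case by (simp add: lmap_Lsc lmap_scale)
next
  case (X j)
  have j: "1 \<le> j" "j \<le> n" using X by auto
  have "XG j * lmap R \<simeq> lmap (LX j) * lmap R" by (intro heq_mult_right heq_sym[OF lmap_X] j)
  then show ?case using heq_trans[OF heq_sym[OF X_lmap[OF j]]] by blast
next
  case (Xinv j)
  have j: "1 \<le> j" "j \<le> n" using Xinv by auto
  have "XiG j * lmap R \<simeq> lmap (LXinv j) * lmap R" by (intro heq_mult_right heq_sym[OF lmap_Xi] j)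
  then show ?case using heq_trans[OF heq_sym[OF Xi_lmap[OF j]]] by blast
next
  case (add f g)
  then show ?case by (simp add: distrib_right lmap_add heq_add)
next
  case (mult f g)
  have "lmap (f * g * R) = lmap (f * (g * R))" by (simp add: mult.assoc)
  also have "\<dots> \<simeq> lmap f * lmap (g * R)" by (rule mult)
  also have "\<dots> \<simeq> lmap f * (lmap g * lmap R)" by (intro heq_mult_left mult)
  also have "\<dots> = (lmap f * lmap g) * lmap R" by (simp add: mult.assoc)
  also have "\<dots> \<simeq> lmap (f * g) * lmap R" by (intro heq_mult_right heq_sym[OF mult(3)])
  finally show ?case .
qed

lemma act_lmap:
  assumes "P \<in> LP" shows "act n q (lmap P) = emul P"
  using assms
proof (induction P rule: laurent_induct)
  case (X j)
  then show ?case using heq_imp_act_eq[OF lmap_X, of j] by (simp add: act_XG)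
next
  case (Xinv j)
  then show ?case using heq_imp_act_eq[OF lmap_Xi, of j] by (simp add: act_XiG)
next
  case (mult f g)
  then show ?case using heq_imp_act_eq[OF lmap_mult, of f g] by (simp add: act_mult emul_mult)
qed (simp_all add: lmap_Lsc act_fsc lmap_add act_add emul_add)

text \<open>The Bernstein relations, in the form \<open>T_i P \<in> k[X] T_i + k[X]\<close>.\<close>

lemma T_Xi_identity:
  fixes T X Y c :: "'b::ring_1"
  assumes "T * c = c * T" "X * c = c * X" "Y * c = c * Y"
  shows "c * (T * X) - c * (Y * T - (c - 1) * Y) =
     (T * X * T - c * Y) * T - T * X * (T * T - ((c - 1) * T + c)) - (c - 1) * (T * X * T - c * Y)"
    "c * (T * Y) - c * (X * T + (c - 1) * Y) =
     - T * (T * X * T - c * Y) + (T * T - ((c - 1) * T + c)) * (X * T) + (c - 1) * (T * X * T - c * Y)"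
proof -
  have 1: "T * (c * y) = c * (T * y)" for y using assms(1) by (metis mult.assoc)
  have 2: "X * (c * y) = c * (X * y)" for y using assms(2) by (metis mult.assoc)
  show "c * (T * X) - c * (Y * T - (c - 1) * Y) =
     (T * X * T - c * Y) * T - T * X * (T * T - ((c - 1) * T + c)) - (c - 1) * (T * X * T - c * Y)"
    by (simp add: algebra_simps assms(1,2) 1 2)
  show
    "c * (T * Y) - c * (X * T + (c - 1) * Y) =
     - T * (T * X * T - c * Y) + (T * T - ((c - 1) * T + c)) * (X * T) + (c - 1) * (T * X * T - c * Y)"
    by (simp add: algebra_simps assms(1,2) 1 2)
qed

text \<open>The preceding identities write Q times the wanted difference as a combination of
  relators; Q is then cancelled, being nonzero.\<close>

lemma heq_T_X_i:
  assumes i: "1 \<le> i" "i < n"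
  shows "TG i * XG i \<simeq> XG (Suc i) * TG i - fsc (Q - 1) * XG (Suc i)"
    "TG i * XG (Suc i) \<simeq> XG i * TG i + fsc (Q - 1) * XG (Suc i)"
proof -
  let ?T = "TG i :: 'k falg" and ?X = "XG i :: 'k falg" and ?Y = "XG (Suc i) :: 'k falg" and ?c = "fsc Q"
  let ?I = "hideal (relations n q) :: 'k falg set"
  have 1: "?T * ?X * ?T - ?c * ?Y \<in> ?I" using heq_TXT[OF i] by (simp add: heq_def)
  have 2: "?T * ?T - ((?c - 1) * ?T + ?c) \<in> ?I" using heq_TT[OF i] by (simp add: heq_def fsc_diff)
  note id = T_Xi_identity[of ?T ?c ?X ?Y, OF fsc_commute[symmetric] fsc_commute[symmetric] fsc_commute[symmetric]]
  have minus: "a - b \<in> ?I" if "a \<in> ?I" "b \<in> ?I" for a b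
    using hideal.add[OF that(1) hideal_uminus[OF that(2)]] by simp
  have "?c * (?T * ?X) - ?c * (?Y * ?T - (?c - 1) * ?Y) \<in> ?I"
    unfolding id(1) by (rule minus[OF minus[OF hideal_mult_right[OF 1] hideal_mult_left[OF 2]] hideal_mult_left[OF 1]])
  then have "?c * (?T * ?X) \<simeq> ?c * (?Y * ?T - fsc (Q - 1) * ?Y)"
    unfolding heq_def fsc_diff fsc_1 .
  then show "?T * ?X \<simeq> ?Y * ?T - fsc (Q - 1) * ?Y" by (rule heq_scale)
  have "?c * (?T * ?Y) - ?c * (?X * ?T + (?c - 1) * ?Y) \<in> ?I"
    unfolding id(2) by (rule hideal.add[OF hideal.add[OF hideal_mult_left[OF 1] hideal_mult_right[OF 2]] hideal_mult_left[OF 1]])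
  then have "?c * (?T * ?Y) \<simeq> ?c * (?X * ?T + fsc (Q - 1) * ?Y)"
    unfolding heq_def fsc_diff fsc_1 .
  then show "?T * ?Y \<simeq> ?X * ?T + fsc (Q - 1) * ?Y" by (rule heq_scale)
qed

text \<open>The relations for the variables, multiplied by inverse variables on both sides and
  solved for the product of \<open>T_i\<close> with an inverse.\<close>

lemma heq_T_Xi_i:
  assumes i: "1 \<le> i" "i < n"
  shows "TG i * XiG i \<simeq> XiG (Suc i) * TG i + fsc (Q - 1) * XiG i"
    "TG i * XiG (Suc i) \<simeq> XiG i * TG i - fsc (Q - 1) * XiG i"
proof -
  have key: "TG i * XiG j \<simeq> XiG k * TG i - XiG k * z * XiG j"
    if j: "1 \<le> j" "j \<le> n" "1 \<le> k" "k \<le> n" and e: "TG i * XG j \<simeq> XG k * TG i + z" for j k z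
  proof -
    have "XiG k * (TG i * XG j) * XiG j \<simeq> XiG k * (XG k * TG i + z) * XiG j"
      by (intro heq_mult_left heq_mult_right e)
    moreover have "XiG k * (TG i * XG j) * XiG j \<simeq> XiG k * TG i"
      using heq_mult_left[OF heq_X_Xi[OF j(1,2)], of "XiG k * TG i"] by (simp add: mult.assoc)
    moreover have "XiG k * (XG k * TG i + z) * XiG j \<simeq> TG i * XiG j + XiG k * z * XiG j"
      using heq_add[OF heq_mult_right[OF heq_Xi_X[OF j(3,4)], of "TG i * XiG j"] heq_refl[of n q "XiG k * z * XiG j"]]
      by (simp add: algebra_simps)
    ultimately have "XiG k * TG i \<simeq> TG i * XiG j + XiG k * z * XiG j"
      using heq_trans heq_sym by blast
    from heq_diff[OF this heq_refl[of n q "XiG k * z * XiG j"]] show ?thesis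
      by (simp add: heq_sym)
  qed
  have s: "XiG (Suc i) * (fsc c * XG (Suc i)) * y \<simeq> fsc c * y" for c y
  proof -
    have "XiG (Suc i) * (fsc c * XG (Suc i)) * y = fsc c * ((XiG (Suc i) * XG (Suc i)) * y)"
      by (simp add: mult.assoc fsc_left_commute)
    also have "\<dots> \<simeq> fsc c * (1 * y)" by (intro heq_mult_left heq_mult_right heq_Xi_X) (use i in auto)
    finally show ?thesis by simp
  qed
  have s': "y * (fsc c * XG (Suc i)) * XiG (Suc i) \<simeq> fsc c * y" for c y
  proof -
    have "y * (fsc c * XG (Suc i)) * XiG (Suc i) = fsc c * (y * (XG (Suc i) * XiG (Suc i)))"
      by (simp add: mult.assoc fsc_left_commute)
    also have "\<dots> \<simeq> fsc c * (y * 1)" by (intro heq_mult_left heq_X_Xi) (use i in auto)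
    finally show ?thesis by simp
  qed
  have "TG i * XG i \<simeq> XG (Suc i) * TG i + fsc (- (Q - 1)) * XG (Suc i)"
    unfolding fsc_minus using heq_T_X_i(1)[OF i] by simp
  then have "TG i * XiG i \<simeq> XiG (Suc i) * TG i - XiG (Suc i) * (fsc (- (Q - 1)) * XG (Suc i)) * XiG i"
    by (rule key[rotated 4]) (use i in auto)
  also have "\<dots> \<simeq> XiG (Suc i) * TG i - fsc (- (Q - 1)) * XiG i"
    by (intro heq_diff heq_refl s)
  finally show "TG i * XiG i \<simeq> XiG (Suc i) * TG i + fsc (Q - 1) * XiG i"
    by (simp only: fsc_minus) simp
  have "TG i * XiG (Suc i) \<simeq> XiG i * TG i - XiG i * (fsc (Q - 1) * XG (Suc i)) * XiG (Suc i)"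
    by (rule key[OF _ _ _ _ heq_T_X_i(2)[OF i]]) (use i in auto)
  also have "\<dots> \<simeq> XiG i * TG i - fsc (Q - 1) * XiG i"
    by (intro heq_diff heq_refl s')
  finally show "TG i * XiG (Suc i) \<simeq> XiG i * TG i - fsc (Q - 1) * XiG i" .
qed

text \<open>The relations pass from the variables to sums and products. Existence of A and B
  suffices, since only the stability of a span under \<open>T_i\<close> is drawn from it.\<close>

lemma T_lmap:
  assumes P: "P \<in> LP" and i: "1 \<le> i" "i < n"
  shows "\<exists>A\<in>LP. \<exists>B\<in>LP. TG i * lmap P \<simeq> lmap A * TG i + lmap B"
  using P
proof (induction P rule: laurent_induct)
  case (scalar c)
  then show ?case
    by (intro bexI[of _ "Lsc c"] bexI[of _ 0]) (simp_all add: lmap_Lsc laurent_on_Lsc fsc_commute)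
next
  case (X j)
  have j: "1 \<le> j" "j \<le> n" using X by auto
  have L: "TG i * lmap (LX j) \<simeq> TG i * XG j" by (intro heq_mult_left lmap_X j)
  have gen: "\<exists>A\<in>LP. \<exists>B\<in>LP. TG i * lmap (LX j) \<simeq> lmap A * TG i + lmap B"
    if k: "1 \<le> k" "k \<le> n" and e: "TG i * XG j \<simeq> XG k * TG i + fsc c * XG (Suc i)" for k c
  proof (intro bexI)
    have "XG k * TG i + fsc c * XG (Suc i) \<simeq> lmap (LX k) * TG i + fsc c * lmap (LX (Suc i))"
      using k i by (intro heq_add heq_mult_left heq_mult_right heq_sym[OF lmap_X]) auto
    then show "TG i * lmap (LX j) \<simeq> lmap (LX k) * TG i + lmap (Lsc c * LX (Suc i))"
      using heq_trans[OF L heq_trans[OF e]] by (simp add: lmap_scale)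
  qed (use k i in \<open>auto intro!: laurent_on_mult laurent_on_Lsc laurent_on_LX\<close>)
  consider "j = i" | "j = Suc i" | "j \<noteq> i" "j \<noteq> Suc i" by blast
  then show ?case
  proof cases
    case 1
    have "TG i * XG j \<simeq> XG (Suc i) * TG i + fsc (- (Q - 1)) * XG (Suc i)"
      unfolding fsc_minus using heq_T_X_i(1)[OF i] 1 by simp
    then show ?thesis by (rule gen[rotated 2]) (use i in auto)
  next
    case 2
    show ?thesis by (rule gen[of i "Q - 1"]) (use 2 i heq_T_X_i(2)[OF i] in auto)
  next
    case 3
    then show ?thesis using gen[of j 0] heq_T_X[OF i j] j by simp
  qed
next
  case (Xinv j)
  have j: "1 \<le> j" "j \<le> n" using Xinv by auto
  have L: "TG i * lmap (LXinv j) \<simeq> TG i * XiG j" by (intro heq_mult_left lmap_Xi j)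
  have gen: "\<exists>A\<in>LP. \<exists>B\<in>LP. TG i * lmap (LXinv j) \<simeq> lmap A * TG i + lmap B"
    if k: "1 \<le> k" "k \<le> n" and e: "TG i * XiG j \<simeq> XiG k * TG i + fsc c * XiG i" for k c
  proof (intro bexI)
    have "XiG k * TG i + fsc c * XiG i \<simeq> lmap (LXinv k) * TG i + fsc c * lmap (LXinv i)"
      using k i by (intro heq_add heq_mult_left heq_mult_right heq_sym[OF lmap_Xi]) auto
    then show "TG i * lmap (LXinv j) \<simeq> lmap (LXinv k) * TG i + lmap (Lsc c * LXinv i)"
      using heq_trans[OF L heq_trans[OF e]] by (simp add: lmap_scale)
  qed (use k i in \<open>auto intro!: laurent_on_mult laurent_on_Lsc laurent_on_LXinv\<close>)
  consider "j = i" | "j = Suc i" | "j \<noteq> i" "j \<noteq> Suc i" by blast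
  then show ?case
  proof cases
    case 1
    show ?thesis by (rule gen[of "Suc i" "Q - 1"]) (use 1 i heq_T_Xi_i(1)[OF i] in auto)
  next
    case 2
    have "TG i * XiG j \<simeq> XiG i * TG i + fsc (- (Q - 1)) * XiG i"
      unfolding fsc_minus using heq_T_Xi_i(2)[OF i] 2 by simp
    then show ?thesis by (rule gen[rotated 2]) (use i in auto)
  next
    case 3
    then show ?thesis using gen[of j 0] heq_inverse_comm[OF j heq_T_X[OF i j]] j by simp
  qed
next
  case (add f g)
  then obtain A B A' B' where AB: "A \<in> LP" "B \<in> LP" "TG i * lmap f \<simeq> lmap A * TG i + lmap B"
    "A' \<in> LP" "B' \<in> LP" "TG i * lmap g \<simeq> lmap A' * TG i + lmap B'" by blast
  then have "TG i * lmap (f + g) \<simeq> lmap (A + A') * TG i + lmap (B + B')"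
    using heq_add[OF AB(3) AB(6)] by (simp add: lmap_add algebra_simps)
  then show ?case using AB laurent_on_add by blast
next
  case (mult f g)
  then obtain A B A' B' where AB: "A \<in> LP" "B \<in> LP" "TG i * lmap f \<simeq> lmap A * TG i + lmap B"
    "A' \<in> LP" "B' \<in> LP" "TG i * lmap g \<simeq> lmap A' * TG i + lmap B'" by blast
  have "TG i * lmap (f * g) \<simeq> TG i * (lmap f * lmap g)"
    by (intro heq_mult_left lmap_mult mult)
  also have "\<dots> = (TG i * lmap f) * lmap g" by (simp add: mult.assoc)
  also have "\<dots> \<simeq> (lmap A * TG i + lmap B) * lmap g" by (intro heq_mult_right AB)
  also have "\<dots> = lmap A * (TG i * lmap g) + lmap B * lmap g" by (simp add: algebra_simps)
  also have "\<dots> \<simeq> lmap A * (lmap A' * TG i + lmap B') + lmap (B * g)"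
    by (intro heq_add heq_mult_left AB heq_sym[OF lmap_mult])
  also have "\<dots> = (lmap A * lmap A') * TG i + (lmap A * lmap B' + lmap (B * g))" by (simp add: algebra_simps)
  also have "\<dots> \<simeq> lmap (A * A') * TG i + (lmap (A * B') + lmap (B * g))"
    by (intro heq_add heq_mult_right heq_sym[OF lmap_mult] AB heq_refl)
  finally have "TG i * lmap (f * g) \<simeq> lmap (A * A') * TG i + lmap (A * B' + B * g)"
    by (simp only: lmap_add)
  moreover have "A * A' \<in> LP" "A * B' + B * g \<in> LP"
    using AB mult(2) by (simp_all add: laurent_on_add laurent_on_mult)
  ultimately show ?case by blast
qed

end

text \<open>Subtracting \<open>\<chi> a d\<close> times the relation at e from the relation at d + e
  removes the character of a, and d can be chosen to separate a from any given v. M is a submonoid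
  because only exponents supported in 1, ..., n are available for testing.\<close>

lemma Dedekind_independence:
  fixes \<chi> :: "'u \<Rightarrow> 'e::monoid_add \<Rightarrow> 'r::idom"
  assumes "finite U" and M: "0 \<in> M" "\<And>d e. d \<in> M \<Longrightarrow> e \<in> M \<Longrightarrow> d + e \<in> M"
    and \<chi>: "\<And>u d e. u \<in> U \<Longrightarrow> \<chi> u (d + e) = \<chi> u d * \<chi> u e" "\<And>u. u \<in> U \<Longrightarrow> \<chi> u 0 = 1"
    and dist: "\<And>u v. u \<in> U \<Longrightarrow> v \<in> U \<Longrightarrow> u \<noteq> v \<Longrightarrow> \<exists>d\<in>M. \<chi> u d \<noteq> \<chi> v d"
    and "\<And>e. e \<in> M \<Longrightarrow> (\<Sum>u\<in>U. g u * \<chi> u e) = 0" and "u \<in> U"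
  shows "g u = 0"
  using assms(1) \<chi> dist assms(7,8)
proof (induction U arbitrary: g u rule: finite_induct)
  case (insert a U)
  have aU: "a \<notin> U" and fin: "finite U" using insert by auto
  have U0: "g v = 0" if v: "v \<in> U" for v
  proof -
    obtain d where d: "d \<in> M" "\<chi> v d \<noteq> \<chi> a d" using insert.prems(3)[of v a] v aU by auto
    have "g v * (\<chi> v d - \<chi> a d) = 0"
    proof (rule insert.IH[where g = "\<lambda>v. g v * (\<chi> v d - \<chi> a d)"])
      fix e assume e: "e \<in> M"
      have 1: "(\<Sum>u\<in>insert a U. g u * \<chi> u (d + e)) = 0" "(\<Sum>u\<in>insert a U. g u * \<chi> u e) = 0"
        using insert.prems(4) M(2) d e by blast+
      have "(\<Sum>u\<in>U. g u * (\<chi> u d - \<chi> a d) * \<chi> u e) =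
          (\<Sum>u\<in>insert a U. g u * (\<chi> u d - \<chi> a d) * \<chi> u e)"
        using aU fin by simp
      also have "\<dots> = (\<Sum>u\<in>insert a U. g u * \<chi> u (d + e) - \<chi> a d * (g u * \<chi> u e))"
        by (rule sum.cong) (auto simp: insert.prems(1) algebra_simps)
      also have "\<dots> = 0" using 1 by (simp only: sum_subtractf flip: sum_distrib_left) simp
      finally show "(\<Sum>u\<in>U. g u * (\<chi> u d - \<chi> a d) * \<chi> u e) = 0" .
    qed (rule insert.prems(1) insert.prems(2) insert.prems(3) v; (rule insertI2)?; assumption)+
    then show ?thesis using d by simp
  qed
  have "g a * \<chi> a 0 = 0" using insert.prems(4)[OF M(1)] U0 aU fin by simp
  then have "g a = 0" using insert.prems(2)[of a] by simp
  then show ?case using U0 insert.prems(5) by auto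
qed simp

context affine_hecke
begin

section \<open>Elements indexed by the symmetric group and the spanning set\<close>

abbreviation "S0 \<equiv> WK {1..<n}"

text \<open>The choice made by \<open>redexp\<close> does not show that a finite permutation gets a
  word without \<open>s_0\<close> and \<open>tau\<close>. Here this is built in, and
  \<open>act_Tw_S0\<close> compares the two choices.\<close>

definition rw :: "waff \<Rightarrow> nat list" where
  "rw w = (SOME is. set is \<subseteq> {1..<n} \<and> length is = Lw n w \<and> w = wprodS is)"

definition Tf :: "waff \<Rightarrow> 'k falg" where
  "Tf w = prod_list (map TG (rw w))"

lemma rw: "w \<in> S0 \<Longrightarrow> set (rw w) \<subseteq> {1..<n} \<and> length (rw w) = Lw n w \<and> w = wprodS (rw w)"
  unfolding rw_def by (rule someI_ex) (rule WK_reduced[OF subset_refl])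

text \<open>Among the letters 1, ..., n - 1 the cyclic moves reduce to those of the finite diagram,
  which are defining relations.\<close>

lemma breq_heq: "breq n u v \<Longrightarrow> set u \<subseteq> {1..<n} \<Longrightarrow> prod_list (map TG u) \<simeq> prod_list (map TG v)"
proof (induction rule: breq.induct)
  case (breq_sym u v)
  then show ?case using breq_set[of n u v] by (intro heq_sym[OF breq_sym.IH]) simp
next
  case (breq_trans u v w)
  then show ?case using breq_set[of n u v] heq_trans by metis
next
  case (breq_ctx u v x y)
  then show ?case by (simp add: heq_mult_left heq_mult_right)
next
  case (breq_comm a b)
  have ab: "1 \<le> a" "1 \<le> b" using breq_comm by auto
  have "Suc a \<noteq> b" "Suc b \<noteq> a" using breq_comm by auto
  then consider "Suc a < b" | "Suc b < a" using breq_comm(3) by linarith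
  then show ?case
  proof cases
    case 1
    then show ?thesis using heq_comm_TT[of a b] ab breq_comm by simp
  next
    case 2
    then show ?thesis using heq_sym[OF heq_comm_TT[of b a]] ab breq_comm by simp
  qed
next
  case (breq_braid a b)
  have a: "1 \<le> a" "1 \<le> b" using breq_braid by auto
  have "Suc a < n"
  proof (rule ccontr)
    assume "\<not> Suc a < n"
    then have "a + 1 = n" using breq_braid by simp
    then show False using breq_braid a by simp
  qed
  then show ?case using heq_braid[of a] a breq_braid by simp
qed simp

lemma S0_in: "w \<in> S0 \<Longrightarrow> w \<in> Wset n"
  by (rule WK_in[OF subset_refl])

lemma Tf_word:
  assumes "set is \<subseteq> {1..<n}" "length is = Lw n (wprodS is)"
  shows "prod_list (map TG is) \<simeq> Tf (wprodS is)"
proof -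
  have w: "wprodS is \<in> S0" using assms by (auto simp: WK_def)
  note r = rw[OF w]
  have "breq n is (rw (wprodS is))"
    using r assms wprodS_eq_wprodA[of "is"] wprodS_eq_wprodA[of "rw (wprodS is)"] by (intro Matsumoto) auto
  then show ?thesis unfolding Tf_def using assms by (intro breq_heq)
qed

lemma Tf_one: "Tf wone \<simeq> 1"
  using heq_sym[OF Tf_word[of "[]"]] by (simp add: wprodS_Nil)

lemma Tf_mult:
  assumes "u \<in> S0" "v \<in> S0" "Lw n (wmul u v) = Lw n u + Lw n v"
  shows "Tf u * Tf v \<simeq> Tf (wmul u v)"
proof -
  note r = rw[OF assms(1)] rw[OF assms(2)]
  have "wmul u v = wprodS (rw u @ rw v)" using r by (metis wprodS_append)
  then show ?thesis using Tf_word[of "rw u @ rw v"] r assms(3) unfolding Tf_def by simp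
qed

lemma Lw_sfin: "1 \<le> i \<Longrightarrow> i < n \<Longrightarrow> Lw n (sfin i) = 1"
  using Lw_sgen_up[OF wone_in, of i] by (simp add: zp_wone wmul_one sfin_eq_sgen)

lemma Tf_sfin: "1 \<le> i \<Longrightarrow> i < n \<Longrightarrow> TG i \<simeq> Tf (sfin i)"
  using Tf_word[of "[i]"] by (simp add: wprodS_Cons wprodS_Nil wmul_one Lw_sfin)

lemma sfin_in_S0: "1 \<le> i \<Longrightarrow> i < n \<Longrightarrow> sfin i \<in> S0"
  by (intro WK_gen) auto

text \<open>Inversion preserves the length and turns left multiplication into right multiplication,
  where descents are visible.\<close>

lemma Lw_sfin_left:
  assumes "w \<in> Wset n" "1 \<le> i" "i < n"
  shows "Lw n (wmul (sfin i) w) = Suc (Lw n w) \<or> Lw n w = Suc (Lw n (wmul (sfin i) w))"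
proof -
  have i: "winv (wmul (sfin i) w) = wmul (winv w) (sgen n i)"
    using assms by (simp add: winv_wmul sfin_eq_sgen sgen_in winv_sgen)
  have "Lw n (wmul (winv w) (sgen n i)) = Suc (Lw n (winv w)) \<or> Lw n (winv w) = Suc (Lw n (wmul (winv w) (sgen n i)))"
    using Lw_sgen_up[OF winv_in[OF assms(1)] assms(3)] Lw_sgen_down[OF winv_in[OF assms(1)] assms(3)]
      zp_Suc_neq[OF winv_in[OF assms(1)], of "int i"] by (metis linorder_less_linear)
  then show ?thesis
    using Lw_winv[OF assms(1)] Lw_winv[of "wmul (sfin i) w"] i assms by (simp add: wmul_in sfin_in)
qed

lemma sfin_sfin: "1 \<le> i \<Longrightarrow> i < n \<Longrightarrow> wmul (sfin i) (wmul (sfin i) w) = w"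
  using sgen_sgen[of i wone] by (simp add: sfin_eq_sgen wmul_one flip: wmul_assoc)

lemma T_Tf_up:
  assumes "w \<in> S0" "1 \<le> i" "i < n" "Lw n (wmul (sfin i) w) = Suc (Lw n w)"
  shows "TG i * Tf w \<simeq> Tf (wmul (sfin i) w)"
proof -
  have "TG i * Tf w \<simeq> Tf (sfin i) * Tf w" using assms by (intro heq_mult_right Tf_sfin)
  also have "\<dots> \<simeq> Tf (wmul (sfin i) w)" using assms by (intro Tf_mult sfin_in_S0) (simp_all add: Lw_sfin)
  finally show ?thesis .
qed

lemma T_Tf_down:
  assumes "w \<in> S0" "1 \<le> i" "i < n" "Lw n w = Suc (Lw n (wmul (sfin i) w))"
  shows "TG i * Tf w \<simeq> fsc (Q - 1) * Tf w + fsc Q * Tf (wmul (sfin i) w)"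
proof -
  let ?v = "wmul (sfin i) w"
  have v: "?v \<in> S0" using assms by (intro WK_mult sfin_in_S0)
  have e: "TG i * Tf ?v \<simeq> Tf w" using T_Tf_up[OF v assms(2,3)] assms sfin_sfin by simp
  have "TG i * Tf w \<simeq> TG i * (TG i * Tf ?v)" by (intro heq_mult_left heq_sym[OF e])
  also have "\<dots> = (TG i * TG i) * Tf ?v" by (simp add: mult.assoc)
  also have "\<dots> \<simeq> (fsc (Q - 1) * TG i + fsc Q) * Tf ?v" using assms by (intro heq_mult_right heq_TT)
  also have "\<dots> = fsc (Q - 1) * (TG i * Tf ?v) + fsc Q * Tf ?v" by (simp add: algebra_simps)
  also have "\<dots> \<simeq> fsc (Q - 1) * Tf w + fsc Q * Tf ?v" by (intro heq_add heq_mult_left e heq_refl)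
  finally show ?thesis .
qed

definition spn :: "(waff \<Rightarrow> 'k laurent) \<Rightarrow> 'k falg" where
  "spn P = (\<Sum>w\<in>S0. lmap (P w) * Tf w)"

definition SP :: "'k falg set" where
  "SP = {x. \<exists>P. (\<forall>w. P w \<in> LP) \<and> x \<simeq> spn P}"

lemma finite_S0: "finite S0"
  by (rule finite_WK) simp

lemma SP_heq: "x \<simeq> y \<Longrightarrow> y \<in> SP \<Longrightarrow> x \<in> SP"
  unfolding SP_def using heq_trans by blast

lemma SP_add: assumes "x \<in> SP" "y \<in> SP" shows "x + y \<in> SP"
proof -
  obtain P R where "\<forall>w. P w \<in> LP" "x \<simeq> spn P" "\<forall>w. R w \<in> LP" "y \<simeq> spn R" using assms by (auto simp: SP_def)
  moreover have "spn P + spn R = spn (\<lambda>w. P w + R w)"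
    by (simp add: spn_def lmap_add distrib_right sum.distrib)
  ultimately show ?thesis using heq_add[of n q x "spn P" y "spn R"] unfolding SP_def
    by (auto intro!: exI[of _ "\<lambda>w. P w + R w"] laurent_on_add)
qed

lemma SP_0: "0 \<in> SP"
  unfolding SP_def by (auto intro!: exI[of _ "\<lambda>w. 0"] simp: spn_def)

lemma SP_sum: "(\<And>i. i \<in> I \<Longrightarrow> f i \<in> SP) \<Longrightarrow> sum f I \<in> SP"
  by (induction I rule: infinite_finite_induct) (auto intro: SP_0 SP_add)

lemma SP_lmap: assumes "A \<in> LP" "x \<in> SP" shows "lmap A * x \<in> SP"
proof -
  obtain P where P: "\<forall>w. P w \<in> LP" "x \<simeq> spn P" using assms by (auto simp: SP_def)
  have "lmap A * x \<simeq> lmap A * spn P" by (intro heq_mult_left P)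
  also have "\<dots> = (\<Sum>w\<in>S0. (lmap A * lmap (P w)) * Tf w)" by (simp add: spn_def sum_distrib_left mult.assoc)
  also have "\<dots> \<simeq> spn (\<lambda>w. A * P w)"
    unfolding spn_def using assms by (intro heq_sum heq_mult_right heq_sym[OF lmap_mult])
  finally show ?thesis using P assms unfolding SP_def
    by (auto intro!: exI[of _ "\<lambda>w. A * P w"] laurent_on_mult)
qed

lemma SP_Tf: assumes "w \<in> S0" shows "Tf w \<in> SP"
proof -
  have "spn (\<lambda>v. if v = w then 1 else 0) = (\<Sum>v\<in>S0. if v = w then Tf v else 0)"
    unfolding spn_def using lmap_Lsc[of 1] by (intro sum.cong) auto
  then have "spn (\<lambda>v. if v = w then 1 else 0) = Tf w" using assms finite_S0 by (simp add: sum.delta')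
  then show ?thesis unfolding SP_def by (auto intro!: exI[of _ "\<lambda>v. if v = w then 1 else 0"])
qed

lemma SP_T: assumes "x \<in> SP" and i: "1 \<le> i" "i < n" shows "TG i * x \<in> SP"
proof -
  obtain P where P: "\<forall>w. P w \<in> LP" "x \<simeq> spn P" using assms by (auto simp: SP_def)
  have TT: "TG i * Tf w \<in> SP" if w: "w \<in> S0" for w
  proof -
    have v: "wmul (sfin i) w \<in> S0" using w i by (intro WK_mult sfin_in_S0)
    from Lw_sfin_left[OF S0_in[OF w] i] show ?thesis
    proof
      assume "Lw n (wmul (sfin i) w) = Suc (Lw n w)"
      then show ?thesis by (rule SP_heq[OF T_Tf_up[OF w i] SP_Tf[OF v]])
    next
      assume "Lw n w = Suc (Lw n (wmul (sfin i) w))"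
      moreover have "fsc c * Tf u \<in> SP" if "u \<in> S0" for c u
        using SP_lmap[OF laurent_on_Lsc SP_Tf[OF that], of c] by (simp add: lmap_Lsc)
      ultimately show ?thesis using w v by (intro SP_heq[OF T_Tf_down[OF w i]] SP_add)
    qed
  qed
  have "TG i * (lmap (P w) * Tf w) \<in> SP" if w: "w \<in> S0" for w
  proof -
    obtain A B where AB: "A \<in> LP" "B \<in> LP" "TG i * lmap (P w) \<simeq> lmap A * TG i + lmap B"
      using T_lmap[OF _ i] P(1) by blast
    have "TG i * (lmap (P w) * Tf w) = (TG i * lmap (P w)) * Tf w" by (simp add: mult.assoc)
    also have "\<dots> \<simeq> (lmap A * TG i + lmap B) * Tf w" by (intro heq_mult_right AB)
    also have "\<dots> = lmap A * (TG i * Tf w) + lmap B * Tf w" by (simp add: algebra_simps)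
    finally show ?thesis by (rule SP_heq) (intro SP_add SP_lmap AB TT SP_Tf w)
  qed
  then have "(\<Sum>w\<in>S0. TG i * (lmap (P w) * Tf w)) \<in> SP" by (rule SP_sum)
  then show ?thesis using SP_heq[OF heq_mult_left[OF P(2)]] by (simp add: spn_def sum_distrib_left)
qed

text \<open>The span contains 1 and is stable under left multiplication by every generator.\<close>

lemma spanning: "x \<in> SP"
proof (induction x rule: falg_induct)
  case (scalar c)
  have "fsc c = lmap (Lsc c) * 1" by (simp add: lmap_Lsc)
  also have "\<dots> \<simeq> lmap (Lsc c) * Tf wone" by (intro heq_mult_left heq_sym[OF Tf_one])
  finally show ?case by (rule SP_heq) (intro SP_lmap laurent_on_Lsc SP_Tf WK_one)
next
  case (gen g x)
  show ?case
  proof (cases "valid_gen n g")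
    case False
    then have "fgen g * x \<simeq> 0" using heq_mult_right[OF heq_invalid] by fastforce
    then show ?thesis by (rule SP_heq[OF _ SP_0])
  next
    case True
    then show ?thesis
    proof (cases g)
      case (GT i)
      then show ?thesis using True gen by (auto simp: valid_gen_def intro: SP_T)
    next
      case (GX j)
      then have j: "1 \<le> j" "j \<le> n" using True by (auto simp: valid_gen_def)
      have "fgen g * x \<simeq> lmap (LX j) * x" unfolding GX by (intro heq_mult_right heq_sym[OF lmap_X] j)
      then show ?thesis by (rule SP_heq) (use gen j in \<open>auto intro!: SP_lmap laurent_on_LX\<close>)
    next
      case (GXi j)
      then have j: "1 \<le> j" "j \<le> n" using True by (auto simp: valid_gen_def)
      have "fgen g * x \<simeq> lmap (LXinv j) * x" unfolding GXi by (intro heq_mult_right heq_sym[OF lmap_Xi] j)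
      then show ?thesis by (rule SP_heq) (use gen j in \<open>auto intro!: SP_lmap laurent_on_LXinv\<close>)
    qed
  qed
next
  case (add x y)
  then show ?case by (rule SP_add)
qed

section \<open>Linear independence of the operators\<close>

lemma Top_coeff_nonzero: "Lsc a * LX i - LX (Suc i) \<noteq> (0 :: 'k laurent)"
proof
  assume eq: "Lsc a * LX i - LX (Suc i) = (0 :: 'k laurent)"
  have "Poly_Mapping.single i (1::int) \<noteq> Poly_Mapping.single (Suc i) 1"
    using LX_inj[of i "Suc i", where 'k = 'k] by (auto simp: LX_def)
  moreover have "Lsc a * LX i = Poly_Mapping.single (Poly_Mapping.single i 1) a"
    by (simp add: Lsc_def LX_def mult_single)
  \<comment> \<open>The coefficient of \<open>X_(i+1)\<close> is -1 for every a.\<close>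
  moreover have "Poly_Mapping.lookup (Lsc a * LX i - LX (Suc i) :: 'k laurent) (Poly_Mapping.single (Suc i) 1) = 0"
    unfolding eq by simp
  ultimately show False by (simp add: lookup_minus lookup_single LX_def when_def)
qed

text \<open>Up to a denominator, each factor \<open>T_i\<close> of a reduced word is a multiple of
  the permutation \<open>s_i\<close> plus a multiple of the identity, and only the choice of
  \<open>s_i\<close> in every factor reaches the length of w. D and c stay unspecified, since only
  the nonvanishing of D and of the leading coefficient matters.\<close>

lemma triangular:
  assumes "w \<in> S0"
  shows "\<exists>D c. D \<noteq> 0 \<and> c w \<noteq> 0 \<and> (\<forall>u\<in>S0. u \<noteq> w \<longrightarrow> Lw n w \<le> Lw n u \<longrightarrow> c u = 0) \<and>
     (\<forall>f. D * app (act n q (Tf w)) f = (\<Sum>u\<in>S0. c u * permL (fst u) f))"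
  using assms
proof (induction "Lw n w" arbitrary: w)
  case 0
  then have w: "w = wone" using Lw_0_WK[OF subset_refl] by simp
  have "(\<Sum>u\<in>S0. (if u = wone then 1 else 0) * permL (fst u) f) = f" for f :: "'k laurent"
  proof -
    have "(\<Sum>u\<in>S0. (if u = wone then 1 else 0) * permL (fst u) f) = (\<Sum>u\<in>S0. if u = wone then f else 0)"
      by (intro sum.cong) (auto simp: wone_def)
    then show ?thesis using finite_S0 WK_one by (simp add: sum.delta')
  qed
  moreover have "act n q (Tf w) = 1" unfolding w using heq_imp_act_eq[OF Tf_one] by (simp only: act_1)
  ultimately have "\<forall>f. 1 * app (act n q (Tf w)) f = (\<Sum>u\<in>S0. (if u = wone then 1 else 0) * permL (fst u) f)"
    by (simp only: app_simps mult_1_left simp_thms)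
  then show ?case unfolding w
    by (intro exI[of _ 1] exI[of _ "\<lambda>u. if u = wone then 1 else 0"] conjI) simp_all
next
  case (Suc r)
  obtain "is" where i: "set is \<subseteq> {1..<n}" "length is = Lw n w" "w = wprodS is"
    using WK_reduced[OF subset_refl Suc(3)] by blast
  then obtain i js where js: "is = i # js" using Suc(2) by (cases "is") auto
  have i1: "1 \<le> i" "i < n" using i js by auto
  define v where "v = wprodS js"
  have v: "v \<in> S0" using i js by (auto simp: v_def WK_def)
  have wv: "w = wmul (sfin i) v" using i js by (simp add: v_def wprodS_Cons)
  have jn: "set js \<subseteq> {1..<n}" "set js \<subseteq> {..<n}" using i js by auto
  have "Lw n v \<le> length js" unfolding v_def wprodS_eq_wprodA[OF jn(1)] by (rule Lw_word_le[OF jn(2)])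
  then have Lv: "Lw n w = Suc (Lw n v)"
    using Lw_sfin_left[OF S0_in[OF v] i1] wv i js by auto
  then have rv: "r = Lw n v" using Suc(2) by simp
  obtain D c where IH: "D \<noteq> 0" "c v \<noteq> 0" "\<forall>u\<in>S0. u \<noteq> v \<longrightarrow> Lw n v \<le> Lw n u \<longrightarrow> c u = 0"
     "\<And>f. D * app (act n q (Tf v)) f = (\<Sum>u\<in>S0. c u * permL (fst u) f)"
    using Suc(1)[OF rv v] by blast
  let ?s = "permL (sw i) :: 'k laurent \<Rightarrow> _"
  let ?A = "Lsc Q * LX i - LX (Suc i) :: 'k laurent" and ?B = "(1 - Lsc Q) * LX (Suc i) :: 'k laurent"
  \<comment> \<open>The swap acts on coefficients as well, so the swapped sum carries the
    denominator \<open>s_i D\<close>, and both D and its swap are cleared. The first term is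
    reindexed by left multiplication with \<open>s_i\<close>; the second is the part of
    \<open>Top_cleared\<close> without permutation.\<close>
  define c' where "c' u = ?A * D * ?s (c (wmul (sfin i) u)) + ?B * ?s D * c u" for u
  define D' where "D' = (LX i - LX (Suc i)) * (D * ?s D)"
  have A0: "?A \<noteq> 0" by (rule Top_coeff_nonzero)
  have sD: "?s D \<noteq> 0" using permL_inj[OF inj_sw] IH(1) by blast
  have aw: "act n q (Tf w) = Top Q i * act n q (Tf v)"
    using heq_imp_act_eq[OF T_Tf_up[OF v i1]] Lv wv i1 by (simp add: act_mult act_TG Q_def)
  have eq: "D' * app (act n q (Tf w)) f = (\<Sum>u\<in>S0. c' u * permL (fst u) f)" for f
  proof -
    let ?g = "app (act n q (Tf v)) f"
    have sg: "?s D * ?s ?g = (\<Sum>u\<in>S0. ?s (c u) * permL (sw i \<circ> fst u) f)"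
    proof -
      have "?s D * ?s ?g = ?s (\<Sum>u\<in>S0. c u * permL (fst u) f)" unfolding IH(4)[symmetric] permL_mult ..
      then show ?thesis by (simp add: permL_sum permL_mult permL_comp)
    qed
    have bij: "bij_betw (wmul (sfin i)) S0 S0"
      by (rule bij_betwI[where g = "wmul (sfin i)"])
         (simp_all add: sfin_sfin[OF i1] WK_mult[OF sfin_in_S0[OF i1]] del: One_nat_def)
    have "(\<Sum>u\<in>S0. ?s (c u) * permL (sw i \<circ> fst u) f)
        = (\<Sum>u\<in>S0. ?s (c (wmul (sfin i) u)) * permL (sw i \<circ> fst (wmul (sfin i) u)) f)"
      using sum.reindex_bij_betw[OF bij, of "\<lambda>u. ?s (c u) * permL (sw i \<circ> fst u) f"] by simp
    also have "\<dots> = (\<Sum>u\<in>S0. ?s (c (wmul (sfin i) u)) * permL (fst u) f)"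
    proof -
      have "sw i \<circ> fst (wmul (sfin i) u) = fst u" for u by (auto simp: wmul_def sfin_def fun_eq_iff)
      then show ?thesis by simp
    qed
    finally have sg': "?s D * ?s ?g = (\<Sum>u\<in>S0. ?s (c (wmul (sfin i) u)) * permL (fst u) f)" using sg by simp
    have "D' * app (act n q (Tf w)) f = D * ?s D * ((LX i - LX (Suc i)) * app (Top Q i) ?g)"
      unfolding D'_def aw by simp
    also have "\<dots> = ?A * D * (?s D * ?s ?g) + ?B * ?s D * (D * ?g)"
      unfolding Top_cleared by algebra
    also have "\<dots> = (\<Sum>u\<in>S0. c' u * permL (fst u) f)"
      unfolding sg' IH(4) c'_def by (simp add: sum_distrib_left distrib_right sum.distrib mult.assoc)
    finally show ?thesis .
  qed
  \<comment> \<open>w is longer than v, so only the permuted part of \<open>T_i\<close> contributes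
    to the leading coefficient.\<close>
  have "c w = 0" using IH(3) WK_mult[OF sfin_in_S0[OF i1] v] wv Lv by auto
  then have "c' w = ?A * D * ?s (c v)" unfolding c'_def wv sfin_sfin[OF i1] by simp
  moreover have "?s (c v) \<noteq> 0" using permL_inj[OF inj_sw] IH(2) by blast
  ultimately have cw': "c' w \<noteq> 0" using A0 IH(1) by simp
  have c'0: "c' u = 0" if u: "u \<in> S0" "u \<noteq> w" "Lw n w \<le> Lw n u" for u
  proof -
    have "c u = 0" using IH(3) u Lv by auto
    moreover have "c (wmul (sfin i) u) = 0"
    proof -
      have "wmul (sfin i) u \<noteq> v" using u wv sfin_sfin[OF i1] by metis
      moreover have "Lw n v \<le> Lw n (wmul (sfin i) u)" using Lw_sfin_left[OF S0_in[OF u(1)] i1] u Lv by auto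
      ultimately show ?thesis using IH(3) WK_mult[OF sfin_in_S0[OF i1] u(1)] by blast
    qed
    ultimately show ?thesis by (simp add: c'_def)
  qed
  have D'0: "D' \<noteq> 0" using IH(1) sD by (simp add: D'_def LX_inj)
  show ?case
    by (intro exI[of _ D'] exI[of _ c'] conjI ballI impI allI D'0 cw' c'0 eq)
qed

lemma S0_fst_inj:
  assumes "u \<in> S0" "v \<in> S0" "u \<noteq> v"
  shows "\<exists>j\<in>{1..n}. fst u j \<noteq> fst v j"
proof (rule ccontr)
  assume no: "\<not> ?thesis"
  have "snd u = snd v" using assms by (auto simp: WK_def snd_wprodS)
  moreover have "fst u = fst v"
  proof
    fix j
    show "fst u j = fst v j"
    proof (cases "j \<in> {1..n}")
      case False
      have "fst u permutes {1..n}" "fst v permutes {1..n}"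
        using S0_in[OF assms(1)] S0_in[OF assms(2)] by (simp_all add: Wset_def)
      then show ?thesis using permutes_not_in[OF _ False] by metis
    qed (use no in blast)
  qed
  ultimately show False using assms(3) by (auto simp: prod_eq_iff)
qed

text \<open>Each permutation u gives a character of the exponents, sending e to the monomial
  \<open>X^(u e)\<close>; different u differ at some variable.\<close>

lemma permutation_independence:
  assumes "\<And>f. f \<in> LP \<Longrightarrow> (\<Sum>u\<in>S0. g u * permL (fst u) f) = 0" and "u \<in> S0"
  shows "g u = (0 :: 'k laurent)"
proof (rule Dedekind_independence[where M = "{e. Poly_Mapping.keys e \<subseteq> {1..n}}" and U = S0 and g = g
      and \<chi> = "\<lambda>u e. mon (pexp (fst u) e)"])
  fix u v assume "u \<in> S0" "v \<in> S0" "u \<noteq> v"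
  then obtain j where j: "j \<in> {1..n}" "fst u j \<noteq> fst v j" using S0_fst_inj by blast
  then have "mon (pexp (fst u) (Poly_Mapping.single j 1)) \<noteq> (mon (pexp (fst v) (Poly_Mapping.single j 1)) :: 'k laurent)"
    by (simp add: LX_inj flip: LX_eq_mon)
  then show "\<exists>d\<in>{e. Poly_Mapping.keys e \<subseteq> {1..n}}. (mon (pexp (fst u) d) :: 'k laurent) \<noteq> mon (pexp (fst v) d)"
    using j by (intro bexI[of _ "Poly_Mapping.single j 1"]) auto
next
  fix e :: "nat \<Rightarrow>\<^sub>0 int" assume "e \<in> {e. Poly_Mapping.keys e \<subseteq> {1..n}}"
  then show "(\<Sum>u\<in>S0. g u * mon (pexp (fst u) e)) = 0"
    using assms(1)[OF laurent_on_mon, of e] by simp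
next
  fix d e :: "nat \<Rightarrow>\<^sub>0 int"
  assume "d \<in> {e. Poly_Mapping.keys e \<subseteq> {1..n}}" "e \<in> {e. Poly_Mapping.keys e \<subseteq> {1..n}}"
  then show "d + e \<in> {e. Poly_Mapping.keys e \<subseteq> {1..n}}" using Poly_Mapping.keys_add[of d e] by blast
qed (simp_all only: finite_S0 assms(2) pexp_add mon_add pexp_0 mon_0 keys_zero mem_Collect_eq empty_subsetI)

text \<open>Among the w with nonzero coefficient take v of maximal length: by triangularity the
  permutation v occurs in no other \<open>T_w\<close> of the sum.\<close>

lemma independence:
  assumes P: "\<And>w. P w \<in> LP" and zero: "\<And>f. f \<in> LP \<Longrightarrow> app (act n q (spn P)) f = 0" and "w \<in> S0"
  shows "P w = 0"
proof (rule ccontr)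
  assume "P w \<noteq> 0"
  then have ne: "{w \<in> S0. P w \<noteq> 0} \<noteq> {}" using assms(3) by blast
  have fin: "finite {w \<in> S0. P w \<noteq> 0}" using finite_S0 by simp
  obtain v where v: "v \<in> S0" "P v \<noteq> 0" "\<And>u. u \<in> S0 \<Longrightarrow> P u \<noteq> 0 \<Longrightarrow> Lw n u \<le> Lw n v"
  proof -
    have "Max (Lw n ` {w \<in> S0. P w \<noteq> 0}) \<in> Lw n ` {w \<in> S0. P w \<noteq> 0}" using ne fin by (intro Max_in) auto
    then obtain v where v: "v \<in> S0" "P v \<noteq> 0" "Lw n v = Max (Lw n ` {w \<in> S0. P w \<noteq> 0})" by auto
    then have "Lw n u \<le> Lw n v" if "u \<in> S0" "P u \<noteq> 0" for u using that fin by (auto intro!: Max_ge)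
    then show ?thesis using that v by blast
  qed
  define R where "R = (\<lambda>w D c. D \<noteq> 0 \<and> c w \<noteq> 0 \<and> (\<forall>u\<in>S0. u \<noteq> w \<longrightarrow> Lw n w \<le> Lw n u \<longrightarrow> c u = 0) \<and>
     (\<forall>f. D * app (act n q (Tf w)) f = (\<Sum>u\<in>S0. c u * permL (fst u) f)))"
  have "\<forall>w\<in>S0. \<exists>p. R w (fst p) (snd p)"
  proof
    fix w assume "w \<in> S0"
    then obtain D c where "R w D c" using triangular[of w] unfolding R_def by blast
    then have "R w (fst (D, c)) (snd (D, c))" by simp
    then show "\<exists>p. R w (fst p) (snd p)" by (rule exI)
  qed
  from bchoice[OF this] obtain F where F: "\<forall>w\<in>S0. R w (fst (F w)) (snd (F w))" by blast
  define D where "D w = fst (F w)" for w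
  define c where "c w = snd (F w)" for w
  have Dc: "D w \<noteq> 0" "c w w \<noteq> 0" "\<And>u. u \<in> S0 \<Longrightarrow> u \<noteq> w \<Longrightarrow> Lw n w \<le> Lw n u \<Longrightarrow> c w u = 0"
     "\<And>f. D w * app (act n q (Tf w)) f = (\<Sum>u\<in>S0. c w u * permL (fst u) f)" if "w \<in> S0" for w
    using F[rule_format, OF that] unfolding R_def D_def c_def by blast+
  \<comment> \<open>The factor that completes \<open>D w\<close> to the common denominator of all
    terms.\<close>
  define E where "E w = (\<Prod>x\<in>S0 - {w}. D x)" for w
  have E: "prod D S0 = E w * D w" if "w \<in> S0" for w
    unfolding E_def using prod.remove[OF finite_S0 that, of D] by (simp add: mult.commute)
  have E0: "E w \<noteq> 0" for w
    unfolding E_def using finite_S0 Dc(1) by (subst prod_zero_iff) auto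
  define g where "g u = (\<Sum>w\<in>S0. P w * E w * c w u)" for u
  have "(\<Sum>u\<in>S0. g u * permL (fst u) f) = 0" if f: "f \<in> LP" for f
  proof -
    have "0 = prod D S0 * (\<Sum>w\<in>S0. P w * app (act n q (Tf w)) f)"
      using zero[OF f] P by (simp add: spn_def act_sum act_mult act_lmap app_sum)
    also have "\<dots> = (\<Sum>w\<in>S0. P w * E w * (D w * app (act n q (Tf w)) f))"
      unfolding sum_distrib_left using E by (intro sum.cong) auto
    also have "\<dots> = (\<Sum>w\<in>S0. \<Sum>u\<in>S0. P w * E w * c w u * permL (fst u) f)"
    proof (rule sum.cong[OF refl])
      fix w assume w: "w \<in> S0"
      show "P w * E w * (D w * app (act n q (Tf w)) f) = (\<Sum>u\<in>S0. P w * E w * c w u * permL (fst u) f)"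
        unfolding Dc(4)[OF w] sum_distrib_left by (simp only: mult.assoc)
    qed
    also have "\<dots> = (\<Sum>u\<in>S0. g u * permL (fst u) f)"
      unfolding g_def sum_distrib_right by (rule sum.swap)
    finally show ?thesis ..
  qed
  then have "g v = 0" using v(1) by (rule permutation_independence)
  moreover have "g v = P v * E v * c v v"
  proof -
    have "P w * E w * c w v = 0" if w: "w \<in> S0 - {v}" for w
    proof (cases "P w = 0")
      case False
      have "w \<in> S0" "v \<noteq> w" using w by blast+
      then have "c w v = 0" using Dc(3)[of w v] v(1) v(3)[of w] False by blast
      then show ?thesis by simp
    qed simp
    then have "(\<Sum>w\<in>S0 - {v}. P w * E w * c w v) = 0" by (intro sum.neutral) blast
    then show ?thesis unfolding g_def using sum.remove[OF finite_S0 v(1), of "\<lambda>w. P w * E w * c w v"] by simp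
  qed
  ultimately show False using v(2) E0 Dc(2)[OF v(1)] by simp
qed

theorem act_faithful:
  assumes "\<And>f. f \<in> LP \<Longrightarrow> app (act n q x) f = app (act n q y) f"
  shows "x \<simeq> y"
proof -
  have "x - y \<in> SP" by (rule spanning)
  then obtain P where P: "\<forall>w. P w \<in> LP" "x - y \<simeq> spn P" unfolding SP_def mem_Collect_eq by (elim exE conjE)
  have P1: "P w \<in> LP" for w by (rule spec[OF P(1)])
  have eq: "act n q (spn P) = act n q x - act n q y" using heq_imp_act_eq[OF P(2)] unfolding act_diff by (rule sym)
  have z: "app (act n q (spn P)) f = 0" if "f \<in> LP" for f
    unfolding eq app_simps assms[OF that] by (rule diff_self)
  have P0: "P w = 0" if "w \<in> S0" for w by (rule independence[OF P1 z that])
  have "lmap (P w) * Tf w = 0" if "w \<in> S0" for w unfolding P0[OF that] lmap_0 by (rule mult_zero_left)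
  then have "spn P = 0" unfolding spn_def by (intro sum.neutral ballI)
  then show ?thesis using P(2) unfolding heq_def by simp
qed

text \<open>Identities in the algebra may from here on be proved between operators.\<close>

corollary heq_iff_act: "x \<simeq> y \<longleftrightarrow> act n q x = act n q y"
proof
  assume "act n q x = act n q y"
  then have "app (act n q x) f = app (act n q y) f" for f by (rule arg_cong)
  then show "x \<simeq> y" by (rule act_faithful)
qed (rule heq_imp_act_eq)

end

subsection \<open>The length-zero element and the affine generator\<close>

text \<open>In \<open>A_k ... A_1 T_i\<close> everything commutes except for one use of the mixed
  braid relation at \<open>A_i A_(i-1)\<close>, which lowers the index of T. Two families are
  allowed because A is taken to be T once and its inverses the other time.\<close>

lemma descending_product_shift:
  fixes A T :: "nat \<Rightarrow> 'a::monoid_mult"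
  assumes comm: "\<And>i j. 1 \<le> i \<Longrightarrow> i < n \<Longrightarrow> 1 \<le> j \<Longrightarrow> j < n \<Longrightarrow> Suc i < j \<or> Suc j < i \<Longrightarrow> A i * T j = T j * A i"
    and braid: "\<And>i. 1 \<le> i \<Longrightarrow> Suc i < n \<Longrightarrow> A (Suc i) * A i * T (Suc i) = T i * A (Suc i) * A i"
    and "k < n"
  shows "(\<forall>i. k + 2 \<le> i \<longrightarrow> i < n \<longrightarrow> prod_list (map A (rev [1..<Suc k])) * T i = T i * prod_list (map A (rev [1..<Suc k])))
    \<and> (\<forall>i. 2 \<le> i \<longrightarrow> i \<le> k \<longrightarrow> prod_list (map A (rev [1..<Suc k])) * T i = T (i - 1) * prod_list (map A (rev [1..<Suc k])))"
  using assms(3)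
proof (induction k)
  case (Suc k)
  let ?U = "\<lambda>k. prod_list (map A (rev [1..<Suc k]))"
  have US: "?U (Suc k) = A (Suc k) * ?U k" for k by simp
  have IH1: "?U k * T i = T i * ?U k" if "k + 2 \<le> i" "i < n" for i using Suc that by simp
  have IH2: "?U k * T i = T (i - 1) * ?U k" if "2 \<le> i" "i \<le> k" for i using Suc that by simp
  have 1: "?U (Suc k) * T i = T i * ?U (Suc k)" if i: "Suc k + 2 \<le> i" "i < n" for i
  proof -
    have "?U (Suc k) * T i = A (Suc k) * (?U k * T i)" by (simp only: US mult.assoc)
    also have "\<dots> = (A (Suc k) * T i) * ?U k" using i by (simp only: IH1 mult.assoc)
    also have "A (Suc k) * T i = T i * A (Suc k)" using i by (intro comm) auto
    finally show ?thesis by (simp only: US mult.assoc)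
  qed
  have 2: "?U (Suc k) * T i = T (i - 1) * ?U (Suc k)" if i: "2 \<le> i" "i \<le> Suc k" for i
  proof (cases "i = Suc k")
    case False
    have "?U (Suc k) * T i = A (Suc k) * (?U k * T i)" by (simp only: US mult.assoc)
    also have "\<dots> = (A (Suc k) * T (i - 1)) * ?U k" using i False IH2 by (simp add: mult.assoc)
    also have "A (Suc k) * T (i - 1) = T (i - 1) * A (Suc k)" using i False Suc by (intro comm) auto
    finally show ?thesis by (simp only: US mult.assoc)
  next
    case True
    then obtain m where m: "k = Suc m" using i by (cases k) auto
    have IHm: "?U m * T (Suc k) = T (Suc k) * ?U m"
    proof -
      have "\<forall>i. 1 \<le> i \<and> i \<le> m \<longrightarrow> A i * T (Suc k) = T (Suc k) * A i"
        using Suc m by (auto intro!: comm)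
      then show ?thesis
      proof (induction m)
        case (Suc m)
        have e: "?U m * T (Suc k) = T (Suc k) * ?U m" by (rule Suc.IH) (use Suc.prems in auto)
        have "?U (Suc m) * T (Suc k) = A (Suc m) * (?U m * T (Suc k))" by (simp only: US mult.assoc)
        also have "\<dots> = (A (Suc m) * T (Suc k)) * ?U m" by (simp only: e mult.assoc)
        also have "A (Suc m) * T (Suc k) = T (Suc k) * A (Suc m)" using Suc.prems by simp
        finally show ?case by (simp only: US mult.assoc)
      qed simp
    qed
    have "?U (Suc k) * T (Suc k) = A (Suc k) * (A k * (?U m * T (Suc k)))" by (simp only: US m mult.assoc)
    also have "\<dots> = (A (Suc k) * A k * T (Suc k)) * ?U m" by (simp only: IHm mult.assoc)
    also have "A (Suc k) * A k * T (Suc k) = T k * A (Suc k) * A k" using Suc m by (intro braid) auto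
    finally show ?thesis unfolding True by (simp only: US m mult.assoc diff_Suc_1)
  qed
  show ?case using 1 2 by blast
qed simp

text \<open>Generators with their inverses in an arbitrary ring, and a central c in the role of q.
  Here the relations are equations, so the long computations with \<open>T_0\<close> and
  \<open>T_tau\<close> avoid congruences; the ring of operators will be the instance.\<close>

locale hecke_ops =
  fixes n :: nat and T Ti X Xi :: "nat \<Rightarrow> 'a::ring_1" and c :: 'a
  assumes n2: "n \<ge> 2"
    and TTi: "1 \<le> i \<Longrightarrow> i < n \<Longrightarrow> T i * Ti i = 1" "1 \<le> i \<Longrightarrow> i < n \<Longrightarrow> Ti i * T i = 1"
    and braid: "1 \<le> i \<Longrightarrow> Suc i < n \<Longrightarrow> T i * T (Suc i) * T i = T (Suc i) * T i * T (Suc i)"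
    and comm: "1 \<le> i \<Longrightarrow> i < n \<Longrightarrow> 1 \<le> j \<Longrightarrow> j < n \<Longrightarrow> Suc i < j \<Longrightarrow> T i * T j = T j * T i"
    and XXi: "1 \<le> j \<Longrightarrow> j \<le> n \<Longrightarrow> X j * Xi j = 1" "1 \<le> j \<Longrightarrow> j \<le> n \<Longrightarrow> Xi j * X j = 1"
    and XX: "1 \<le> j \<Longrightarrow> j \<le> n \<Longrightarrow> 1 \<le> k \<Longrightarrow> k \<le> n \<Longrightarrow> X j * X k = X k * X j"
    and TX: "1 \<le> i \<Longrightarrow> i < n \<Longrightarrow> 1 \<le> j \<Longrightarrow> j \<le> n \<Longrightarrow> j \<noteq> i \<Longrightarrow> j \<noteq> Suc i \<Longrightarrow> T i * X j = X j * T i"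
    and TXT: "1 \<le> i \<Longrightarrow> i < n \<Longrightarrow> T i * X i * T i = c * X (Suc i)"
    and central: "c * x = x * c"
begin

lemma Ti_comm:
  assumes "1 \<le> i" "i < n" and "T i * y = y * T i" shows "Ti i * y = y * Ti i"
proof -
  have "Ti i * y = Ti i * y * (T i * Ti i)" using TTi assms by simp
  also have "\<dots> = Ti i * (y * T i) * Ti i" by (simp only: mult.assoc)
  also have "\<dots> = (Ti i * T i) * y * Ti i" unfolding assms(3)[symmetric] by (simp only: mult.assoc)
  finally show ?thesis using TTi assms by simp
qed

lemma TT_comm: "1 \<le> i \<Longrightarrow> i < n \<Longrightarrow> 1 \<le> j \<Longrightarrow> j < n \<Longrightarrow> Suc i < j \<or> Suc j < i \<Longrightarrow> T i * T j = T j * T i"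
  using comm[of i j] comm[of j i] by auto

lemma TiT_comm: "1 \<le> i \<Longrightarrow> i < n \<Longrightarrow> 1 \<le> j \<Longrightarrow> j < n \<Longrightarrow> Suc i < j \<or> Suc j < i \<Longrightarrow> Ti i * T j = T j * Ti i"
  by (intro Ti_comm TT_comm) auto

lemma Ti_braid:
  assumes i: "1 \<le> i" "Suc i < n"
  shows "Ti (Suc i) * Ti i * T (Suc i) = T i * Ti (Suc i) * Ti i"
proof -
  let ?A = "T i" and ?B = "T (Suc i)" and ?a = "Ti i" and ?b = "Ti (Suc i)"
  have inv: "?A * ?a = 1" "?a * ?A = 1" "?B * ?b = 1" "?b * ?B = 1" using TTi i by auto
  have "?b * ?a * ?B = ?b * ?a * ?B * (?A * (?B * ?b) * ?a)" using inv by simp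
  also have "\<dots> = ?b * ?a * (?B * ?A * ?B) * ?b * ?a" by (simp only: mult.assoc)
  also have "\<dots> = ?b * (?a * ?A) * ?B * ?A * ?b * ?a" unfolding braid[OF i, symmetric] by (simp only: mult.assoc)
  also have "\<dots> = ?A * ?b * ?a" using inv by simp
  finally show ?thesis .
qed

definition "U = prod_list (map T (rev [1..<n]))"
definition "V = prod_list (map Ti (rev [1..<n]))"
definition "Ui = prod_list (map Ti [1..<n])"
definition "V2 = prod_list (map Ti (rev [2..<n]))"
definition "U' = prod_list (map T (rev [1..<n - 1]))"

lemma UT: "2 \<le> i \<Longrightarrow> i < n \<Longrightarrow> U * T i = T (i - 1) * U"
  using descending_product_shift[of n T T "n - 1", OF TT_comm braid[symmetric]] n2 by (simp add: U_def)

lemma VT: "2 \<le> i \<Longrightarrow> i < n \<Longrightarrow> V * T i = T (i - 1) * V"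
  using descending_product_shift[of n Ti T "n - 1", OF TiT_comm Ti_braid] n2 by (simp add: V_def)

lemma prod_inverse:
  assumes "set js \<subseteq> {1..<n}"
  shows "prod_list (map T (rev js)) * prod_list (map Ti js) = 1"
    "prod_list (map Ti js) * prod_list (map T (rev js)) = 1"
  using assms
proof (induction js)
  case (Cons j js)
  {
    case 1
    have "prod_list (map T (rev (j # js))) * prod_list (map Ti (j # js)) =
       prod_list (map T (rev js)) * (T j * Ti j) * prod_list (map Ti js)" by (simp add: mult.assoc)
    then show ?case using Cons 1 TTi by simp
  next
    case 2
    have "prod_list (map Ti (j # js)) * prod_list (map T (rev (j # js))) =
       Ti j * (prod_list (map Ti js) * prod_list (map T (rev js))) * T j" by (simp add: mult.assoc)
    then show ?case using Cons 2 TTi by simp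
  }
qed simp_all

lemma U_Ui: "U * Ui = 1" "Ui * U = 1"
  unfolding U_def Ui_def by (rule prod_inverse; simp)+

lemma upt_1: "[1..<n] = 1 # [2..<n]"
  using n2 upt_conv_Cons[of 1 n] by (simp add: numeral_2_eq_2)

lemma V_V2: "V = V2 * Ti 1"
  unfolding V_def V2_def upt_1 by simp

lemma U_U': "U = T (n - 1) * U'"
proof -
  have "[1..<n] = [1..<n - 1] @ [n - 1]" using n2 upt_Suc_append[of 1 "n - 1"] by simp
  then show ?thesis unfolding U_def U'_def by simp
qed

lemma prod_comm:
  assumes "\<And>j. j \<in> set js \<Longrightarrow> A j * y = y * A j"
  shows "prod_list (map A js) * y = y * prod_list (map A js)"
  using assms
proof (induction js)
  case (Cons j js)
  have e: "prod_list (map A js) * y = y * prod_list (map A js)" using Cons by simp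
  have "prod_list (map A (j # js)) * y = A j * (prod_list (map A js) * y)" by (simp add: mult.assoc)
  also have "\<dots> = (A j * y) * prod_list (map A js)" by (simp only: e mult.assoc)
  also have "A j * y = y * A j" using Cons by simp
  finally show ?case by (simp add: mult.assoc)
qed simp

lemma V2_X1: "V2 * X 1 = X 1 * V2"
  unfolding V2_def using n2 by (intro prod_comm Ti_comm TX) auto

lemma U'_Xn: "U' * X n = X n * U'"
  unfolding U'_def using n2 by (intro prod_comm TX) auto

lemma power_central: "c ^ m * x = x * c ^ m"
proof (induction m)
  case (Suc m)
  have "c ^ Suc m * x = c * (c ^ m * x)" by (simp add: mult.assoc)
  also have "\<dots> = c * (x * c ^ m)" by (simp only: Suc)
  also have "\<dots> = (x * c) * c ^ m" by (simp only: central[of x] mult.assoc[symmetric])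
  finally show ?case by (simp add: mult.assoc)
qed simp

lemma power_left: "x * (c ^ m * y) = c ^ m * (x * y)"
  using power_central[of m x] by (simp only: mult.assoc[symmetric])

text \<open>\<open>T_i X_i\<close> equals \<open>c X_(i+1)\<close> times the inverse of
  \<open>T_i\<close>. Applied from \<open>T_1\<close> upwards, this turns \<open>X_1\<close> into
  \<open>X_n\<close>, inverts every factor and collects one c for each.\<close>

lemma U_X1: "U * X 1 = c ^ (n - 1) * X n * V"
proof -
  have TXi: "T i * X i = c * X (Suc i) * Ti i" if "1 \<le> i" "i < n" for i
  proof -
    have "T i * X i = T i * X i * T i * Ti i" using TTi that by (simp add: mult.assoc)
    then show ?thesis using TXT that by simp
  qed
  have "k < n \<Longrightarrow> prod_list (map T (rev [1..<Suc k])) * X 1 =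
     c ^ k * X (Suc k) * prod_list (map Ti (rev [1..<Suc k]))" for k
  proof (induction k)
    case (Suc k)
    let ?u = "prod_list (map T (rev [1..<Suc k]))" and ?v = "prod_list (map Ti (rev [1..<Suc k]))"
    have "prod_list (map T (rev [1..<Suc (Suc k)])) * X 1 = T (Suc k) * (?u * X 1)" by (simp add: mult.assoc)
    also have "\<dots> = T (Suc k) * (c ^ k * X (Suc k) * ?v)" using Suc by simp
    also have "\<dots> = c ^ k * (T (Suc k) * X (Suc k)) * ?v" by (simp only: power_left mult.assoc)
    also have "\<dots> = c ^ k * (c * X (Suc (Suc k)) * Ti (Suc k)) * ?v" using TXi Suc by simp
    also have "\<dots> = c ^ Suc k * X (Suc (Suc k)) * (Ti (Suc k) * ?v)"
      by (simp only: power_Suc2 mult.assoc)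
    finally show ?case by simp
  qed simp
  from this[of "n - 1"] n2 show ?thesis by (simp add: U_def V_def)
qed

text \<open>\<open>T_tau\<close> without its scalar \<open>q^(-(n-1)/2)\<close>, which needs a
  square root of q and is restored through \<open>kap\<close>.\<close>

definition "tau' = U * X 1"
definition "taui = Xi 1 * Ui"
text \<open>\<open>V2 * Ui\<close> is the inverse of the palindrome
  \<open>T_(n-1) ... T_2 T_1 T_2 ... T_(n-1)\<close>.\<close>

definition "T0 = c ^ (n - 1) * (Xi 1 * X n * (V2 * Ui))"

lemma tau_taui: "tau' * taui = 1" "taui * tau' = 1"
proof -
  have X1: "X 1 * Xi 1 = 1" "Xi 1 * X 1 = 1" using XXi[of 1] n2 by auto
  have "tau' * taui = U * (X 1 * Xi 1) * Ui" by (simp only: tau'_def taui_def mult.assoc)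
  then show "tau' * taui = 1" by (simp only: X1 U_Ui mult_1_right)
  have "taui * tau' = Xi 1 * (Ui * U) * X 1" by (simp only: tau'_def taui_def mult.assoc)
  then show "taui * tau' = 1" by (simp only: X1 U_Ui mult_1_right)
qed

lemma tau_T:
  assumes i: "2 \<le> i" "i < n" shows "tau' * T i = T (i - 1) * tau'"
proof -
  have "tau' * T i = U * (X 1 * T i)" by (simp only: tau'_def mult.assoc)
  also have "X 1 * T i = T i * X 1" using TX[of i 1] i by simp
  also have "U * (T i * X 1) = (U * T i) * X 1" by (simp only: mult.assoc)
  also have "U * T i = T (i - 1) * U" using UT i by simp
  finally show ?thesis by (simp only: tau'_def mult.assoc)
qed

lemma tau_T1: "tau' * T 1 = c ^ (n - 1) * X n * V2"
proof -
  have "Ti 1 * T 1 = 1" using TTi n2 by simp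
  then have "V * T 1 = V2" by (simp add: V_V2 mult.assoc)
  moreover have "tau' * T 1 = c ^ (n - 1) * X n * (V * T 1)" unfolding tau'_def U_X1 by (simp only: mult.assoc)
  ultimately show ?thesis by simp
qed

lemma T0_tau: "T0 * tau' = tau' * T 1"
proof -
  have X1: "Xi 1 * X 1 = 1" and XX1: "X n * X 1 = X 1 * X n" using XXi[of 1] XX[of n 1] n2 by auto
  have "T0 * tau' = c ^ (n - 1) * (Xi 1 * X n * (V2 * (Ui * U) * X 1))" by (simp only: T0_def tau'_def mult.assoc)
  also have "\<dots> = c ^ (n - 1) * (Xi 1 * (X n * X 1) * V2)" by (simp only: U_Ui V2_X1 mult_1_right mult.assoc)
  also have "\<dots> = c ^ (n - 1) * (Xi 1 * X 1) * X n * V2" by (simp only: XX1 mult.assoc)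
  finally show ?thesis unfolding tau_T1 X1 by simp
qed

text \<open>Multiplied by \<open>tau'\<close> on the right and combined with \<open>T0_tau\<close>,
  the claim becomes that \<open>T_(n-1) tau'^2\<close> equals \<open>tau'^2 T_1\<close>. One factor
  \<open>tau'\<close> is rewritten by \<open>U_X1\<close>, and the exchange of V U for U' V2 is the
  essential step.\<close>

lemma tau_T0: "tau' * T0 = T (n - 1) * tau'"
proof -
  have XX1: "X n * X 1 = X 1 * X n" using XX[of n 1] n2 by auto
  have VU: "V * U = U' * V2"
  proof -
    \<comment> \<open>Each factor of index i moves through V and comes out with index i - 1.\<close>
    have "k < n \<Longrightarrow> V * prod_list (map T (rev [2..<Suc k])) = prod_list (map T (rev [1..<k])) * V" for k
    proof (induction k)
      case (Suc k)
      show ?case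
      proof (cases "k \<ge> 1")
        case True
        then have "V * prod_list (map T (rev [2..<Suc (Suc k)])) = (V * T (Suc k)) * prod_list (map T (rev [2..<Suc k]))"
          by (simp add: mult.assoc)
        also have "\<dots> = T k * (V * prod_list (map T (rev [2..<Suc k])))" using VT[of "Suc k"] True Suc by (simp add: mult.assoc)
        also have "\<dots> = T k * (prod_list (map T (rev [1..<k])) * V)" using Suc by simp
        finally show ?thesis using True by (simp add: mult.assoc)
      qed simp
    qed simp
    from this[of "n - 1"] have "V * prod_list (map T (rev [2..<n])) = U' * V" using n2 by (simp add: U'_def)
    moreover have "U = prod_list (map T (rev [2..<n])) * T 1" unfolding U_def upt_1 by simp
    ultimately have "V * U = U' * (V * T 1)" by (simp add: mult.assoc[symmetric])
    moreover have "Ti 1 * T 1 = 1" using TTi n2 by simp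
    ultimately show ?thesis by (simp add: V_V2 mult.assoc)
  qed
  have "T (n - 1) * ((U * X 1) * (U * X 1)) = T (n - 1) * ((c ^ (n - 1) * X n * V) * (U * X 1))"
    by (simp only: U_X1)
  also have "\<dots> = c ^ (n - 1) * (T (n - 1) * (X n * (V * U) * X 1))" by (simp only: power_left mult.assoc)
  also have "X n * (V * U) * X 1 = (X n * U') * (V2 * X 1)" unfolding VU by (simp only: mult.assoc)
  also have "\<dots> = U' * (X n * X 1) * V2" by (simp only: U'_Xn[symmetric] V2_X1 mult.assoc)
  also have "c ^ (n - 1) * (T (n - 1) * (U' * (X n * X 1) * V2)) = c ^ (n - 1) * (U * X 1 * (X n * V2))"
    by (simp only: XX1 U_U' mult.assoc)
  also have "\<dots> = (U * X 1) * (c ^ (n - 1) * X n * V2)" by (simp only: power_left mult.assoc)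
  finally have e: "T (n - 1) * ((U * X 1) * (U * X 1)) = (U * X 1) * (c ^ (n - 1) * X n * V2)" .
  have "(T (n - 1) * tau') * tau' = tau' * (c ^ (n - 1) * X n * V2)"
    using e by (simp only: tau'_def mult.assoc)
  also have "\<dots> = tau' * (T0 * tau')" by (simp only: tau_T1[symmetric] T0_tau)
  finally have "(T (n - 1) * tau') * tau' * taui = tau' * (T0 * tau') * taui" by (simp only:)
  then have "(T (n - 1) * tau') * (tau' * taui) = tau' * T0 * (tau' * taui)" by (simp only: mult.assoc)
  then show ?thesis by (simp add: tau_taui)
qed

definition "gen k = (if k = 0 then T0 else T k)"

lemma tau_gen: "k < n \<Longrightarrow> tau' * gen k = gen (nat ((int k - 1) mod int n)) * tau'"
proof -
  assume k: "k < n"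
  consider "k = 0" | "k = 1" | "k \<ge> 2" by linarith
  then show "tau' * gen k = gen (nat ((int k - 1) mod int n)) * tau'"
  proof cases
    case 1
    have "(- 1) mod int n = int n - 1" using n2 by (simp add: zmod_minus1)
    then show ?thesis using 1 n2 tau_T0 by (simp add: gen_def nat_diff_distrib)
  next
    case 2
    then show ?thesis using T0_tau by (simp add: gen_def)
  next
    case 3
    then have "nat ((int k - 1) mod int n) = k - 1" using k by (simp add: nat_diff_distrib)
    then show ?thesis using 3 k tau_T[of k] by (simp add: gen_def)
  qed
qed

definition "gword u = prod_list (map gen u)"

definition "taup j = (if 0 \<le> j then tau' ^ nat j else taui ^ nat (- j))"

lemma taup_0 [simp]: "taup 0 = 1" by (simp add: taup_def)

lemma taup_Suc: "taup (j + 1) = tau' * taup j"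
proof (cases "0 \<le> j")
  case True
  then show ?thesis by (simp add: taup_def nat_add_distrib)
next
  case False
  then obtain m where m: "nat (- j) = Suc m" by (cases "nat (- j)") auto
  then have "nat (- (j + 1)) = m" by simp
  have "tau' * taui ^ Suc m = (tau' * taui) * taui ^ m" by (simp add: mult.assoc)
  then have "tau' * taup j = taui ^ m" using m False by (simp add: taup_def tau_taui)
  also have "\<dots> = taup (j + 1)"
  proof (cases "j = -1")
    case True
    then show ?thesis using m by (simp add: taup_def)
  next
    case 2: False
    then show ?thesis using False \<open>nat (- (j + 1)) = m\<close> by (simp add: taup_def)
  qed
  finally show ?thesis ..
qed

lemma taup_pred: "taup (j - 1) = taui * taup j"
proof -
  have "taui * taup j = taui * (tau' * taup (j - 1))" using taup_Suc[of "j - 1"] by simp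
  also have "\<dots> = (taui * tau') * taup (j - 1)" by (simp only: mult.assoc)
  finally show ?thesis by (simp add: tau_taui)
qed

lemma taup_add: "taup (i + j) = taup i * taup j"
proof (induction i rule: int_induct[where k = 0])
  case (step1 i)
  then show ?case using taup_Suc[of "i + j"] taup_Suc[of i] by (simp add: algebra_simps)
next
  case (step2 i)
  then show ?case using taup_pred[of "i + j"] taup_pred[of i] by (simp add: algebra_simps)
qed simp

lemma taup_inverse: "taup j * taup (- j) = 1" "taup (- j) * taup j = 1"
  by (simp_all flip: taup_add)

lemma tau_gword: "set u \<subseteq> {..<n} \<Longrightarrow> tau' * gword u = gword (shl n 1 u) * tau'"
proof (induction u)
  case (Cons k u)
  have "tau' * gword (k # u) = (tau' * gen k) * gword u" by (simp add: gword_def mult.assoc)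
  also have "\<dots> = gen (nat ((int k - 1) mod int n)) * (tau' * gword u)" using Cons by (simp add: tau_gen mult.assoc)
  also have "\<dots> = gword (shl n 1 (k # u)) * tau'" using Cons by (simp add: gword_def shl_def mult.assoc)
  finally show ?case .
qed (simp add: gword_def)

lemma shl_shl: "shl n i (shl n j u) = shl n (i + j) u"
  using n2 by (simp add: shl_def comp_def mod_diff_left_eq algebra_simps)

lemma shl_0: "set u \<subseteq> {..<n} \<Longrightarrow> shl n 0 u = u"
  unfolding shl_def by (intro map_idI) auto

lemma shl_bound: "set (shl n j u) \<subseteq> {..<n}"
  using n2 by (auto simp: shl_def nat_less_iff)

lemma taup_gword: "set u \<subseteq> {..<n} \<Longrightarrow> taup j * gword u = gword (shl n j u) * taup j"
proof (induction j rule: int_induct[where k = 0])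
  case base
  then show ?case by (simp add: shl_0)
next
  case (step1 i)
  have s: "shl n 1 (shl n i u) = shl n (i + 1) u" by (simp add: shl_shl add.commute)
  have "taup (i + 1) * gword u = tau' * (taup i * gword u)" by (simp only: taup_Suc mult.assoc)
  also have "\<dots> = (tau' * gword (shl n i u)) * taup i" using step1 by (simp add: mult.assoc)
  also have "\<dots> = gword (shl n (i + 1) u) * (tau' * taup i)" by (simp only: tau_gword[OF shl_bound] s mult.assoc)
  finally show ?case by (simp only: taup_Suc)
next
  case (step2 i)
  have s: "shl n 1 (shl n (i - 1) u) = shl n i u" by (simp add: shl_shl)
  have "taui * gword (shl n i u) * tau' = taui * (tau' * gword (shl n (i - 1) u))"
    unfolding s[symmetric] by (simp only: tau_gword[OF shl_bound] mult.assoc)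
  also have "\<dots> = gword (shl n (i - 1) u)" by (simp add: tau_taui flip: mult.assoc)
  finally have e: "taui * gword (shl n i u) = gword (shl n (i - 1) u) * taui"
    using tau_taui(1) by (metis mult.assoc mult.right_neutral)
  have "taup (i - 1) * gword u = taui * (taup i * gword u)" by (simp add: taup_pred mult.assoc)
  also have "\<dots> = (taui * gword (shl n i u)) * taup i" using step2 by (simp add: mult.assoc)
  also have "\<dots> = gword (shl n (i - 1) u) * (taui * taup i)" by (simp only: e mult.assoc)
  finally show ?case by (simp add: taup_pred)
qed

text \<open>Conjugation by \<open>tau'\<close> rotates the indices and is injective, so an identity
  of words may be checked after any rotation.\<close>

lemma gword_shl_eqD:
  assumes "set u \<subseteq> {..<n}" "set v \<subseteq> {..<n}" "gword (shl n j u) = gword (shl n j v)"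
  shows "gword u = gword v"
proof -
  have "taup j * gword u = taup j * gword v" using assms by (simp add: taup_gword)
  then have "(taup (- j) * taup j) * gword u = (taup (- j) * taup j) * gword v" by (simp only: mult.assoc)
  then show ?thesis by (simp add: taup_inverse)
qed

lemma gword_append: "gword (u @ v) = gword u * gword v"
  by (simp add: gword_def)

text \<open>Moves involving the index 0 are rotated into the range 1, ..., n - 1, where the finite
  relations hold: by two steps for the braid of n - 1 and 0, by one step otherwise.\<close>

lemma breq_gword: "breq n u v \<Longrightarrow> gword u = gword v"
proof (induction rule: breq.induct)
  case (breq_ctx u v x y)
  then show ?case by (simp add: gword_append)
next
  case (breq_comm a b)
  have direct: "gword [x, y] = gword [y, x]"
    if "1 \<le> x" "x < n" "1 \<le> y" "y < n" "x \<noteq> y" "Suc x \<noteq> y" "Suc y \<noteq> x" for x y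
  proof -
    have "T x * T y = T y * T x" using that by (intro TT_comm) linarith+
    then show ?thesis using that by (simp add: gword_def gen_def)
  qed
  have zero: "gword [0, y] = gword [y, 0]" if "y < n" "y \<noteq> 0" "1 \<noteq> y" "(y + 1) mod n \<noteq> 0" for y
  proof (rule gword_shl_eqD[where j = "-1"])
    have "y + 1 \<noteq> n" using that by auto
    then have y: "y + 1 < n" using that by simp
    have s: "shl n (-1) [0, y] = [1, y + 1]" "shl n (-1) [y, 0] = [y + 1, 1]"
      using y n2 by (simp_all add: shl_def nat_add_distrib)
    show "gword (shl n (-1) [0, y]) = gword (shl n (-1) [y, 0])"
      unfolding s using y that by (intro direct) auto
  qed (use that in auto)
  show ?case
  proof (cases "a = 0")
    case True
    have "(0 + 1) mod n = 1" using n2 by simp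
    then have "1 \<noteq> b" using breq_comm(4) True by metis
    then show ?thesis using zero[of b] breq_comm True by simp
  next
    case a: False
    show ?thesis
    proof (cases "b = 0")
      case True
      have "(0 + 1) mod n = 1" using n2 by simp
      then have "1 \<noteq> a" using breq_comm(5) True by metis
      then show ?thesis using zero[of a] breq_comm True by simp
    next
      case False
      have "Suc a \<noteq> b" "Suc b \<noteq> a" using breq_comm by auto
      then show ?thesis using a False breq_comm by (intro direct) auto
    qed
  qed
next
  case (breq_braid a b)
  have direct: "gword [x, Suc x, x] = gword [Suc x, x, Suc x]" if "1 \<le> x" "Suc x < n" for x
    using braid[OF that] that by (simp add: gword_def gen_def mult.assoc)
  have two: "gword (shl n j [a, b, a]) = gword (shl n j [b, a, b])"
    if "nat ((int a - j) mod int n) = x" "nat ((int b - j) mod int n) = Suc x" "1 \<le> x" "Suc x < n" for j x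
    using direct[OF that(3,4)] that(1,2) by (simp add: shl_def)
  have bn: "b < n" using breq_braid n2 by simp
  consider "a + 1 < n" "a \<ge> 1" | "a = 0" | "a + 1 = n" using breq_braid by linarith
  then show ?case
  proof cases
    case 1
    then show ?thesis using direct[of a] breq_braid by simp
  next
    case 2
    then have "b = 1" using breq_braid by simp
    then have "gword (shl n (-1) [a, b, a]) = gword (shl n (-1) [b, a, b])"
      using breq_braid 2 by (intro two[of _ 1]) simp_all
    then show ?thesis by (rule gword_shl_eqD[rotated 2]) (use breq_braid(2) bn in auto)
  next
    case 3
    then have b0: "b = 0" using breq_braid(3) by (simp only: mod_self)
    have "int a - (-2) = 1 + int n" using 3 by linarith
    moreover have "(1 + int n) mod int n = 1" using breq_braid(1) by simp
    ultimately have am: "(int a - (-2)) mod int n = 1" by (simp only:)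
    have bm: "(int b - (-2)) mod int n = 2" unfolding b0 using breq_braid(1) by simp
    have "gword (shl n (-2) [a, b, a]) = gword (shl n (-2) [b, a, b])"
    proof (rule two[where x = 1])
      show "nat ((int a - (-2)) mod int n) = 1" unfolding am by simp
      show "nat ((int b - (-2)) mod int n) = Suc 1" unfolding bm by simp
    qed (use breq_braid(1) in auto)
    then show ?thesis by (rule gword_shl_eqD[rotated 2]) (use breq_braid(2) bn in auto)
  qed
qed simp_all

end

subsection \<open>The standard basis as operators\<close>

lemma emul_of_nat: "emul (Lsc (of_nat m)) = (of_nat m :: 'k::field laurent aend)"
  by (induction m) (simp_all add: Lsc_add emul_add add.commute)

locale hecke_full = affine_hecke n q Q for n q :: nat and Q :: "'k::field" +
  fixes sq :: 'k
  assumes sq: "sq * sq = Q"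
begin

lemma sq0: "sq \<noteq> 0" using sq Q0 by auto

lemma Tinv_eq: "Tinv q i = fsc (inverse Q) * (TG i - fsc (Q - 1))"
  by (simp add: Tinv_def fmul_eq_times Q_def)

lemma T_Tinv:
  assumes "1 \<le> i" "i < n" shows "TG i * Tinv q i \<simeq> 1" "Tinv q i * TG i \<simeq> 1"
proof -
  have "TG i * TG i - fsc (Q - 1) * TG i \<simeq> (fsc (Q - 1) * TG i + fsc Q) - fsc (Q - 1) * TG i"
    by (intro heq_diff heq_TT heq_refl assms)
  then have e: "TG i * TG i - fsc (Q - 1) * TG i \<simeq> fsc Q" by simp
  have "fsc (inverse Q) * (TG i * TG i - fsc (Q - 1) * TG i) \<simeq> fsc (inverse Q) * fsc Q"
    by (rule heq_mult_left[OF e])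
  moreover have "fsc (inverse Q) * fsc Q = 1" using Q0 by (simp flip: fsc_mult)
  ultimately have f: "fsc (inverse Q) * (TG i * TG i - fsc (Q - 1) * TG i) \<simeq> 1" by simp
  have "TG i * Tinv q i = fsc (inverse Q) * (TG i * (TG i - fsc (Q - 1)))"
    unfolding Tinv_eq by (rule fsc_left_commute)
  then show "TG i * Tinv q i \<simeq> 1" using f by (simp add: right_diff_distrib fsc_commute)
  show "Tinv q i * TG i \<simeq> 1" using f unfolding Tinv_eq by (simp add: left_diff_distrib mult.assoc)
qed

text \<open>Congruences become equations under \<open>act\<close>, so everything proved in
  \<open>hecke_ops\<close> holds for the operators. The scalar q enters as a natural number of the
  ring and is central for that reason.\<close>

sublocale ops: hecke_ops n "\<lambda>i. act n q (TG i)" "\<lambda>i. act n q (Tinv q i)" "\<lambda>j. act n q (XG j)" "\<lambda>j. act n q (XiG j)"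
  "of_nat q :: 'k laurent aend"
proof
  let ?act = "act n q :: 'k falg \<Rightarrow> 'k laurent aend"
  show "n \<ge> 2" by (rule n2)
  fix i j k :: nat
  show "?act (TG i) * ?act (Tinv q i) = 1" "?act (Tinv q i) * ?act (TG i) = 1" if "1 \<le> i" "i < n"
    using heq_imp_act_eq[OF T_Tinv(1)[OF that]] heq_imp_act_eq[OF T_Tinv(2)[OF that]] by (simp_all add: act_mult)
  show "?act (TG i) * ?act (TG (Suc i)) * ?act (TG i) = ?act (TG (Suc i)) * ?act (TG i) * ?act (TG (Suc i))"
    if "1 \<le> i" "Suc i < n"
    using heq_imp_act_eq[OF heq_braid[OF that]] by (simp add: act_mult mult.assoc)
  show "?act (TG i) * ?act (TG j) = ?act (TG j) * ?act (TG i)" if "1 \<le> i" "i < n" "1 \<le> j" "j < n" "Suc i < j"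
    using heq_imp_act_eq[OF heq_comm_TT[OF that]] by (simp add: act_mult)
  show "?act (XG j) * ?act (XiG j) = 1" "?act (XiG j) * ?act (XG j) = 1" if "1 \<le> j" "j \<le> n"
    using heq_imp_act_eq[OF heq_X_Xi[OF that]] heq_imp_act_eq[OF heq_Xi_X[OF that]] by (simp_all add: act_mult)
  show "?act (XG j) * ?act (XG k) = ?act (XG k) * ?act (XG j)" if "1 \<le> j" "j \<le> n" "1 \<le> k" "k \<le> n"
    using heq_imp_act_eq[OF heq_X_X[OF that]] by (simp add: act_mult)
  show "?act (TG i) * ?act (XG j) = ?act (XG j) * ?act (TG i)"
    if "1 \<le> i" "i < n" "1 \<le> j" "j \<le> n" "j \<noteq> i" "j \<noteq> Suc i"
    using heq_imp_act_eq[OF heq_T_X[OF that]] by (simp add: act_mult)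
  show "?act (TG i) * ?act (XG i) * ?act (TG i) = of_nat q * ?act (XG (Suc i))" if "1 \<le> i" "i < n"
    using heq_imp_act_eq[OF heq_TXT[OF that]] by (simp add: act_mult act_fsc Q_def emul_of_nat)
  show "of_nat q * x = x * (of_nat q :: 'k laurent aend)" for x
    by (rule mult_of_nat_commute)
qed

lemma act_fprod: "act n q (fprod xs) = prod_list (map (act n q) xs)"
  by (simp add: fprod_eq_prod_list act_prod_list)

lemma act_Tgen: "k < n \<Longrightarrow> act n q (Tgen n q k) = ops.gen k"
proof (cases "k = 0")
  case True
  let ?t = "Tinv q :: nat \<Rightarrow> 'k falg"
  have "rev (map ?t (rev [2..<n] @ [1] @ [2..<n])) = map ?t (rev [2..<n]) @ map ?t [1..<n]"
    using ops.upt_1 by (simp add: rev_map)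
  then have "act n q (Ts0 n q) = act n q (fsc (of_nat q ^ (n - 1))) * (act n q (XiG 1) * (act n q (XG n) * (ops.V2 * ops.Ui)))"
    by (simp add: Ts0_def fmul_eq_times act_mult act_fprod ops.V2_def ops.Ui_def comp_def)
  moreover have "act n q (fsc (of_nat q ^ (n - 1) :: 'k)) = of_nat q ^ (n - 1)"
    using emul_of_nat[of "q ^ (n - 1)"] by (simp add: act_fsc)
  ultimately show ?thesis using True by (simp add: Tgen_def ops.gen_def ops.T0_def mult.assoc)
qed (simp add: Tgen_def ops.gen_def)

lemma act_gword: "set u \<subseteq> {..<n} \<Longrightarrow> act n q (fprod (map (Tgen n q) u)) = ops.gword u"
  by (induction u) (simp_all add: ops.gword_def fprod_eq_prod_list act_mult act_Tgen)

text \<open>The scalar attached to \<open>T_tau ^ j\<close>.\<close>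

definition kap :: "int \<Rightarrow> 'k" where
  "kap j = (inverse sq ^ (n - 1)) powi j"

lemma kap_add: "kap (i + j) = kap i * kap j"
  using sq0 by (simp add: kap_def power_int_add)

text \<open>Elements of \<open>aend\<close> are only additive; this is the missing linearity over
  the ground field.\<close>

definition scalar_commuting :: "'k laurent aend \<Rightarrow> bool" where
  "scalar_commuting x \<longleftrightarrow> (\<forall>c. emul (Lsc c) * x = x * emul (Lsc c))"

lemma sc_act: "scalar_commuting (act n q x)"
  unfolding scalar_commuting_def using fsc_commute[of _ x] by (metis act_fsc act_mult)

lemma sc_mult:
  assumes "scalar_commuting x" "scalar_commuting y" shows "scalar_commuting (x * y)"
  unfolding scalar_commuting_def
proof
  fix c
  have "emul (Lsc c) * (x * y) = (emul (Lsc c) * x) * y" by (simp only: mult.assoc)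
  also have "\<dots> = x * (emul (Lsc c) * y)" using assms(1) by (simp add: scalar_commuting_def mult.assoc)
  also have "\<dots> = x * (y * emul (Lsc c))" using assms(2) by (simp add: scalar_commuting_def)
  finally show "emul (Lsc c) * (x * y) = x * y * emul (Lsc c)" by (simp only: mult.assoc)
qed

lemma sc_power: "scalar_commuting x \<Longrightarrow> scalar_commuting (x ^ m)"
  by (induction m) (simp_all add: sc_mult, simp add: scalar_commuting_def)

lemma act_Ttau: "act n q (Ttau n sq) = emul (Lsc (inverse sq ^ (n - 1))) * ops.tau'"
  by (simp add: Ttau_def fmul_eq_times act_mult act_fsc act_fprod ops.tau'_def ops.U_def comp_def)

lemma act_Ttauinv: "act n q (Ttauinv n q sq) = emul (Lsc (sq ^ (n - 1))) * ops.taui"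
  by (simp add: Ttauinv_def fmul_eq_times act_mult act_fsc act_fprod ops.taui_def ops.Ui_def comp_def rev_map)

lemma sc_tau: "scalar_commuting ops.tau'" "scalar_commuting ops.taui"
  unfolding ops.tau'_def ops.taui_def ops.U_def ops.Ui_def
  using sc_act[of "prod_list (map TG (rev [1..<n])) * XG 1"] sc_act[of "XiG 1 * prod_list (map (Tinv q) [1..<n])"]
  by (simp_all add: act_mult act_prod_list comp_def)

lemma sc_taup: "scalar_commuting (ops.taup j)"
  unfolding ops.taup_def using sc_tau sc_power by simp

lemma sc_gword: "set u \<subseteq> {..<n} \<Longrightarrow> scalar_commuting (ops.gword u)"
  using sc_act act_gword by metis

lemma scalar_power: "scalar_commuting x \<Longrightarrow> (emul (Lsc a) * x) ^ m = emul (Lsc (a ^ m)) * x ^ m"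
proof (induction m)
  case (Suc m)
  have "(emul (Lsc a) * x) ^ Suc m = emul (Lsc a) * (x * emul (Lsc (a ^ m))) * x ^ m"
    using Suc by (simp add: mult.assoc)
  also have "x * emul (Lsc (a ^ m)) = emul (Lsc (a ^ m)) * x" using Suc(2) by (simp add: scalar_commuting_def)
  finally show ?case by (simp add: Lsc_mult emul_mult mult.assoc)
qed simp

lemma act_Ttaupow: "act n q (Ttaupow n q sq j) = emul (Lsc (kap j)) * ops.taup j"
proof -
  have rep: "act n q (fprod (replicate m x)) = act n q x ^ m" for m x
    by (induction m) (simp_all add: fprod_eq_prod_list act_mult)
  show ?thesis
  proof (cases "0 \<le> j")
    case True
    then have "kap j = (inverse sq ^ (n - 1)) ^ nat j" by (simp add: kap_def power_int_def)
    then show ?thesis using True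
      by (simp add: Ttaupow_def rep act_Ttau scalar_power sc_tau ops.taup_def)
  next
    case False
    then have "kap j = (sq ^ (n - 1)) ^ nat (- j)" by (simp add: kap_def power_int_def power_inverse)
    then show ?thesis using False
      by (simp add: Ttaupow_def rep act_Ttauinv scalar_power sc_tau ops.taup_def)
  qed
qed

text \<open>Independence of the expression picked by \<open>redexp\<close>: the degree fixes the
  power of \<open>tau\<close>, and by \<open>Matsumoto\<close> the remaining words are connected by
  braid moves.\<close>

lemma act_Tw:
  assumes w: "w \<in> Wset n" and s: "set is \<subseteq> {..<n}" and l: "length is = Lw n w"
    and e: "w = wmul (wprodA n is) (wpow (tau n) j)"
  shows "act n q (Tw n q sq w) = emul (Lsc (kap j)) * (ops.gword is * ops.taup j)"
proof -
  obtain js i where r: "redexp n w = (js, i)" by (cases "redexp n w")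
  have "case redexp n w of (is, j) \<Rightarrow> length is = lenW n w \<and> set is \<subseteq> {..<n} \<and> w = wmul (wprodA n is) (wpow (tau n) j)"
    unfolding redexp_def by (rule someI[of _ "(is, j)"]) (use s l e lenW_eq_Lw[OF w] in simp)
  then have js: "length js = Lw n w" "set js \<subseteq> {..<n}" "w = wmul (wprodA n js) (wpow (tau n) i)"
    unfolding r using lenW_eq_Lw[OF w] by simp_all
  have deg: "wdeg n (wmul (wprodA n u) (wpow (tau n) i)) = i" if "set u \<subseteq> {..<n}" for u i
    using wdeg_wmul[OF wprodA_in[OF that] wpow_tau_in] wdeg_wprodA[OF that] by (simp add: wdeg_wpow_tau)
  have "wdeg n w = i" unfolding js(3) by (rule deg[OF js(2)])
  moreover have "wdeg n w = j" unfolding e by (rule deg[OF s])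
  ultimately have ij: "i = j" by simp
  have "wmul (wprodA n js) (wpow (tau n) j) = wmul (wprodA n is) (wpow (tau n) j)" using js(3) e ij by simp
  then have "wprodA n js = wprodA n is" by (rule wmul_cancel_right[OF wpow_tau_in])
  moreover have "Lw n w = Lw n (wprodA n js)" using Lw_tau[OF wprodA_in[OF js(2)], of i] js(3) by simp
  ultimately have "breq n js is" using js s l by (intro Matsumoto) simp_all
  then have g: "ops.gword js = ops.gword is" by (rule ops.breq_gword)
  have "act n q (Tw n q sq w) = ops.gword js * (emul (Lsc (kap j)) * ops.taup j)"
    unfolding Tw_def r ij by (simp add: fmul_eq_times act_mult act_gword[OF js(2)] act_Ttaupow)
  also have "\<dots> = emul (Lsc (kap j)) * (ops.gword js * ops.taup j)"
    using sc_gword[OF js(2)] unfolding scalar_commuting_def by (simp only: mult.assoc[symmetric])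
  finally show ?thesis using g by simp
qed

text \<open>A reduced word of b, rotated past the power of \<open>tau\<close> in a and appended to a
  reduced word of a, has the length of the product and is therefore reduced.\<close>

theorem act_Tw_mult:
  assumes a: "a \<in> Wset n" and b: "b \<in> Wset n" and L: "Lw n (wmul a b) = Lw n a + Lw n b"
  shows "act n q (Tw n q sq (wmul a b)) = act n q (Tw n q sq a) * act n q (Tw n q sq b)"
proof -
  obtain "is" i where i: "length is = Lw n a" "set is \<subseteq> {..<n}" "a = wmul (wprodA n is) (wpow (tau n) i)"
    using reduced_exists[OF a] by blast
  obtain js j where j: "length js = Lw n b" "set js \<subseteq> {..<n}" "b = wmul (wprodA n js) (wpow (tau n) j)"
    using reduced_exists[OF b] by blast
  let ?k = "is @ shl n i js"
  have "wmul a b = wmul (wprodA n is) (wmul (wmul (wpow (tau n) i) (wprodA n js)) (wpow (tau n) j))"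
    unfolding i(3) j(3) by (simp only: wmul_assoc)
  also have "\<dots> = wmul (wprodA n ?k) (wmul (wpow (tau n) i) (wpow (tau n) j))"
    by (simp only: tau_wprodA[OF j(2)] wprodA_append wmul_assoc)
  finally have ab: "wmul a b = wmul (wprodA n ?k) (wpow (tau n) (i + j))" by (simp only: wpow_tau_add)
  have s: "set ?k \<subseteq> {..<n}" using i(2) set_shl by auto
  have "length ?k = Lw n (wmul a b)" using i j L by simp
  from act_Tw[OF wmul_in[OF a b] s this ab]
  have "act n q (Tw n q sq (wmul a b)) = emul (Lsc (kap i)) * emul (Lsc (kap j)) * (ops.gword is * (ops.gword (shl n i js) * ops.taup i) * ops.taup j)"
    by (simp add: kap_add ops.gword_append ops.taup_add Lsc_mult emul_mult mult.assoc)
  also have "ops.gword (shl n i js) * ops.taup i = ops.taup i * ops.gword js"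
    by (rule ops.taup_gword[OF j(2), symmetric])
  also have "emul (Lsc (kap i)) * emul (Lsc (kap j)) * (ops.gword is * (ops.taup i * ops.gword js) * ops.taup j)
      = emul (Lsc (kap i)) * (emul (Lsc (kap j)) * (ops.gword is * ops.taup i)) * (ops.gword js * ops.taup j)"
    by (simp only: mult.assoc)
  also have "emul (Lsc (kap j)) * (ops.gword is * ops.taup i) = (ops.gword is * ops.taup i) * emul (Lsc (kap j))"
    using sc_mult[OF sc_gword[OF i(2)] sc_taup] unfolding scalar_commuting_def by blast
  finally show ?thesis
    unfolding act_Tw[OF a i(2,1,3)] act_Tw[OF b j(2,1,3)] by (simp only: mult.assoc)
qed

lemma act_Tw_S0:
  assumes "w \<in> S0" shows "act n q (Tw n q sq w) = act n q (Tf w)"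
proof -
  note r = rw[OF assms]
  have s: "set (rw w) \<subseteq> {..<n}" and s1: "set (rw w) \<subseteq> {1..<n}" using r by auto
  have "w = wmul (wprodA n (rw w)) (wpow (tau n) 0)"
    using r wprodS_eq_wprodA[OF s1] by (simp add: wmul_one)
  from act_Tw[OF S0_in[OF assms] s _ this] r
  have "act n q (Tw n q sq w) = ops.gword (rw w)" by (simp add: kap_def)
  also have "\<dots> = prod_list (map (\<lambda>i. act n q (TG i)) (rw w))"
    unfolding ops.gword_def using s1 by (intro arg_cong[of _ _ prod_list] map_cong) (auto simp: ops.gen_def)
  finally show ?thesis by (simp add: Tf_def act_prod_list comp_def)
qed

definition vT :: "nat set \<Rightarrow> 'k falg" where
  "vT J = (\<Sum>w\<in>WK J. Tf w)"

lemma WK_S0: "J \<subseteq> {1..<n} \<Longrightarrow> u \<in> WK J \<Longrightarrow> u \<in> S0"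
  using WK_mono by blast

lemma act_vJ: "J \<subseteq> {1..<n} \<Longrightarrow> act n q (vJ n q sq J) = act n q (vT J)"
  unfolding vJ_def vT_def act_sum by (intro sum.cong refl act_Tw_S0 WK_S0)

lemma vJ_vT: "J \<subseteq> {1..<n} \<Longrightarrow> vJ n q sq J \<simeq> vT J"
  unfolding heq_iff_act by (rule act_vJ)

lemma act_double_coset:
  assumes J: "J \<subseteq> {1..<n}" and K: "K \<subseteq> {1..<n}" and d: "d \<in> Dset n K J"
  shows "act n q (\<Sum>v\<in>{wmul (wmul u d) w | u w. u \<in> WK K \<and> w \<in> WK J}. Tw n q sq v) =
     act n q (\<Sum>a\<in>Dleft n K (capd K d J). Tw n q sq a * Tw n q sq d) * act n q (vT J)"
proof -
  note B = double_coset_bij[OF J K d]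
  note D = Dset_increasing[OF J K d]
  have L: "capd K d J \<subseteq> K" by (auto simp: capd_def)
  let ?A = "Dleft n K (capd K d J)"
  let ?T = "\<lambda>w. act n q (Tw n q sq w)"
  have "(\<Sum>v\<in>{wmul (wmul u d) w | u w. u \<in> WK K \<and> w \<in> WK J}. ?T v) =
    (\<Sum>(a, u)\<in>?A \<times> WK J. ?T (wmul (wmul a d) u))"
    using sum.reindex_bij_betw[OF B(1), of ?T] by (simp add: case_prod_unfold)
  also have "\<dots> = (\<Sum>(a, u)\<in>?A \<times> WK J. ?T a * ?T d * act n q (Tf u))"
  proof (rule sum.cong[OF refl], clarify)
    fix a u assume a: "a \<in> ?A" and u: "u \<in> WK J"
    have ain: "a \<in> Wset n" and uin: "u \<in> Wset n" using Dleft_increasing(2)[OF K L a] WK_in[OF J u] by auto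
    have "?T (wmul (wmul a d) u) = ?T (wmul a d) * ?T u"
      by (rule act_Tw_mult[OF wmul_in[OF ain D(1)] uin B(2)[OF a u]])
    also have "?T (wmul a d) = ?T a * ?T d" by (rule act_Tw_mult[OF ain D(1) B(3)[OF a]])
    finally show "?T (wmul (wmul a d) u) = ?T a * ?T d * act n q (Tf u)"
      by (simp only: act_Tw_S0[OF WK_S0[OF J u]])
  qed
  also have "\<dots> = (\<Sum>a\<in>?A. ?T a * ?T d) * (\<Sum>u\<in>WK J. act n q (Tf u))"
    by (simp add: sum_product sum.cartesian_product)
  finally show ?thesis by (simp add: act_sum act_mult vT_def)
qed

end

subsection \<open>Symmetrisers and invariants\<close>

context hecke_full
begin

text \<open>Ascent and descent in one formula, in the shape that \<open>involution_sum\<close> sums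
  up.\<close>

lemma T_Tf:
  assumes w: "w \<in> S0" and i: "1 \<le> i" "i < n"
  shows "TG i * Tf w \<simeq> fsc (if Lw n (wmul (sfin i) w) = Suc (Lw n w) then 1 else Q) * Tf (wmul (sfin i) w)
    + fsc (if Lw n (wmul (sfin i) w) = Suc (Lw n w) then 0 else Q - 1) * Tf w"
proof (cases "Lw n (wmul (sfin i) w) = Suc (Lw n w)")
  case True
  then show ?thesis using T_Tf_up[OF w i] by simp
next
  case False
  then have "Lw n w = Suc (Lw n (wmul (sfin i) w))" using Lw_sfin_left[OF S0_in[OF w] i] by simp
  then show ?thesis unfolding if_not_P[OF False] by (subst add.commute) (rule T_Tf_down[OF w i])
qed

lemma sfin_right:
  assumes w: "w \<in> S0" and i: "1 \<le> i" "i < n"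
  shows "wmul w (sfin i) \<in> S0" "wmul (wmul w (sfin i)) (sfin i) = w"
    "Lw n (wmul w (sfin i)) = Suc (Lw n w) \<or> Lw n w = Suc (Lw n (wmul w (sfin i)))"
proof -
  have s: "sfin i = sgen n i" by (rule sfin_eq_sgen[OF i(1)])
  show "wmul w (sfin i) \<in> S0" using w i by (intro WK_mult sfin_in_S0)
  show "wmul (wmul w (sfin i)) (sfin i) = w" unfolding s by (rule sgen_sgen[OF i(2)])
  have "zp n w (int i) < zp n w (int i + 1) \<or> zp n w (int i + 1) < zp n w (int i)"
    using zp_Suc_neq[OF S0_in[OF w], of "int i"] by linarith
  then show "Lw n (wmul w (sfin i)) = Suc (Lw n w) \<or> Lw n w = Suc (Lw n (wmul w (sfin i)))"
    unfolding s using Lw_sgen_up[OF S0_in[OF w] i(2)] Lw_sgen_down[OF S0_in[OF w] i(2)]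
    by (elim disjE) (simp_all only: simp_thms)
qed

lemma Tf_T:
  assumes w: "w \<in> S0" and i: "1 \<le> i" "i < n"
  shows "Tf w * TG i \<simeq> fsc (if Lw n (wmul w (sfin i)) = Suc (Lw n w) then 1 else Q) * Tf (wmul w (sfin i))
    + fsc (if Lw n (wmul w (sfin i)) = Suc (Lw n w) then 0 else Q - 1) * Tf w"
proof -
  have up: "Tf v * TG i \<simeq> Tf (wmul v (sfin i))" if v: "v \<in> S0" "Lw n (wmul v (sfin i)) = Suc (Lw n v)" for v
  proof -
    have "Tf v * TG i \<simeq> Tf v * Tf (sfin i)" by (intro heq_mult_left Tf_sfin i)
    also have "\<dots> \<simeq> Tf (wmul v (sfin i))"
      using v i by (intro Tf_mult sfin_in_S0) (simp_all add: Lw_sfin)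
    finally show ?thesis .
  qed
  note r = sfin_right[OF w i]
  show ?thesis
  proof (cases "Lw n (wmul w (sfin i)) = Suc (Lw n w)")
    case True
    then show ?thesis using up[OF w] by simp
  next
    case False
    let ?v = "wmul w (sfin i)"
    have d: "Lw n w = Suc (Lw n ?v)" using r(3) False by simp
    have e: "Tf ?v * TG i \<simeq> Tf w" using up[OF r(1)] r(2) d by simp
    have "Tf w * TG i \<simeq> (Tf ?v * TG i) * TG i" by (intro heq_mult_right heq_sym[OF e])
    also have "\<dots> = Tf ?v * (TG i * TG i)" by (simp only: mult.assoc)
    also have "\<dots> \<simeq> Tf ?v * (fsc (Q - 1) * TG i + fsc Q)" by (intro heq_mult_left heq_TT i)
    also have "\<dots> = fsc (Q - 1) * (Tf ?v * TG i) + fsc Q * Tf ?v"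
      by (simp only: distrib_left fsc_left_commute fsc_commute[symmetric])
    also have "\<dots> \<simeq> fsc (Q - 1) * Tf w + fsc Q * Tf ?v" by (intro heq_add heq_mult_left e heq_refl)
    finally have "Tf w * TG i \<simeq> fsc (Q - 1) * Tf w + fsc Q * Tf ?v" .
    then show ?thesis unfolding if_not_P[OF False] by (simp only: add.commute)
  qed
qed

text \<open>Summing the multiplication rule over a set that is stable under the involution \<open>\<iota>\<close> yields \<open>Q\<close>
  on every term: either \<open>Q + 0\<close> or \<open>1 + (Q - 1)\<close>.\<close>

lemma involution_sum:
  assumes inv: "\<And>w. w \<in> W \<Longrightarrow> \<iota> w \<in> W" "\<And>w. w \<in> W \<Longrightarrow> \<iota> (\<iota> w) = w"
    and flip: "\<And>w. w \<in> W \<Longrightarrow> up (\<iota> w) \<longleftrightarrow> \<not> up w"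
  shows "(\<Sum>w\<in>W. fsc (if up w then 1 else Q) * f (\<iota> w) + fsc (if up w then 0 else Q - 1) * f w) = fsc Q * (\<Sum>w\<in>W. f w)"
proof -
  have bij: "bij_betw \<iota> W W" by (rule bij_betwI[where g = \<iota>]) (use inv in auto)
  have "(\<Sum>w\<in>W. fsc (if up w then 1 else Q) * f (\<iota> w)) = (\<Sum>w\<in>W. fsc (if up (\<iota> w) then 1 else Q) * f (\<iota> (\<iota> w)))"
    using sum.reindex_bij_betw[OF bij, of "\<lambda>w. fsc (if up w then 1 else Q) * f (\<iota> w)"] by simp
  also have "\<dots> = (\<Sum>w\<in>W. fsc (if up w then Q else 1) * f w)"
    by (rule sum.cong) (simp_all add: inv flip)
  finally have 1: "(\<Sum>w\<in>W. fsc (if up w then 1 else Q) * f (\<iota> w)) = (\<Sum>w\<in>W. fsc (if up w then Q else 1) * f w)" .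
  have "(\<Sum>w\<in>W. fsc (if up w then 1 else Q) * f (\<iota> w) + fsc (if up w then 0 else Q - 1) * f w)
     = (\<Sum>w\<in>W. fsc (if up w then Q else 1) * f w + fsc (if up w then 0 else Q - 1) * f w)"
    unfolding sum.distrib 1 ..
  also have "\<dots> = (\<Sum>w\<in>W. fsc Q * f w)"
    by (rule sum.cong) (auto simp: fsc_diff algebra_simps)
  finally show ?thesis by (simp add: sum_distrib_left)
qed

lemma Suc_flip: "a = Suc b \<or> b = Suc a \<Longrightarrow> b = Suc a \<longleftrightarrow> a \<noteq> Suc b"
  by auto

lemma T_vT:
  assumes J: "J \<subseteq> {1..<n}" and j: "j \<in> J"
  shows "TG j * vT J \<simeq> fsc Q * vT J"
proof -
  have i: "1 \<le> j" "j < n" using J j by auto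
  let ?up = "\<lambda>w. Lw n (wmul (sfin j) w) = Suc (Lw n w)"
  have "TG j * vT J = (\<Sum>w\<in>WK J. TG j * Tf w)" by (simp add: vT_def sum_distrib_left)
  also have "\<dots> \<simeq> (\<Sum>w\<in>WK J. fsc (if ?up w then 1 else Q) * Tf (wmul (sfin j) w) + fsc (if ?up w then 0 else Q - 1) * Tf w)"
    by (intro heq_sum T_Tf i WK_S0[OF J])
  also have "\<dots> = fsc Q * vT J"
    unfolding vT_def
  proof (rule involution_sum)
    fix w assume w: "w \<in> WK J"
    show "wmul (sfin j) w \<in> WK J" by (intro WK_mult WK_gen j w)
    show "wmul (sfin j) (wmul (sfin j) w) = w" by (rule sfin_sfin[OF i])
    show "?up (wmul (sfin j) w) \<longleftrightarrow> \<not> ?up w"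
      unfolding sfin_sfin[OF i] by (rule Suc_flip[OF Lw_sfin_left[OF S0_in[OF WK_S0[OF J w]] i]])
  qed
  finally show ?thesis .
qed

lemma vT_T:
  assumes J: "J \<subseteq> {1..<n}" and j: "j \<in> J"
  shows "vT J * TG j \<simeq> fsc Q * vT J"
proof -
  have i: "1 \<le> j" "j < n" using J j by auto
  let ?up = "\<lambda>w. Lw n (wmul w (sfin j)) = Suc (Lw n w)"
  have "vT J * TG j = (\<Sum>w\<in>WK J. Tf w * TG j)" by (simp add: vT_def sum_distrib_right)
  also have "\<dots> \<simeq> (\<Sum>w\<in>WK J. fsc (if ?up w then 1 else Q) * Tf (wmul w (sfin j)) + fsc (if ?up w then 0 else Q - 1) * Tf w)"
    by (intro heq_sum Tf_T i WK_S0[OF J])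
  also have "\<dots> = fsc Q * vT J"
    unfolding vT_def
  proof (rule involution_sum)
    fix w assume w: "w \<in> WK J"
    show "wmul w (sfin j) \<in> WK J" by (intro WK_mult WK_gen j w)
    show "wmul (wmul w (sfin j)) (sfin j) = w" by (rule sfin_right(2)[OF WK_S0[OF J w] i])
    show "?up (wmul w (sfin j)) \<longleftrightarrow> \<not> ?up w"
      unfolding sfin_right(2)[OF WK_S0[OF J w] i] by (rule Suc_flip[OF sfin_right(3)[OF WK_S0[OF J w] i]])
  qed
  finally show ?thesis .
qed

section \<open>Coset decompositions and eigenvectors\<close>

lemma lmap_diff: "lmap (f - g) = lmap f - lmap g"
  using lmap_add[of "f - g" g] by (simp add: algebra_simps)

lemma spn_unique:
  assumes P: "\<And>w. P w \<in> LP" and R: "\<And>w. R w \<in> LP" and e: "spn P \<simeq> spn R" and w: "w \<in> S0"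
  shows "P w = R w"
proof -
  have s: "spn (\<lambda>w. P w - R w) = spn P - spn R"
    by (simp only: spn_def lmap_diff left_diff_distrib sum_subtractf)
  have "act n q (spn (\<lambda>w. P w - R w)) = 0"
    unfolding s act_diff heq_imp_act_eq[OF e] by (rule diff_self)
  then have z: "app (act n q (spn (\<lambda>w. P w - R w))) f = 0" for f by (simp only: app_simps)
  have "P w - R w = 0" by (rule independence[of "\<lambda>w. P w - R w", OF laurent_on_diff[OF P R] z w])
  then show ?thesis by simp
qed

text \<open>The minimal representatives of the cosets of \<open>W_J\<close> in the symmetric
  group.\<close>

definition DJ :: "nat set \<Rightarrow> waff set" where
  "DJ J = {d \<in> S0. increasing_on J d}"

lemma DJ_bij:
  assumes J: "J \<subseteq> {1..<n}"
  shows "bij_betw (\<lambda>(d, u). wmul d u) (DJ J \<times> WK J) S0"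
proof (rule bij_betw_imageI)
  show "inj_on (\<lambda>(d, u). wmul d u) (DJ J \<times> WK J)"
  proof (rule inj_onI; clarify)
    fix d u e v assume as: "d \<in> DJ J" "u \<in> WK J" "e \<in> DJ J" "v \<in> WK J" "wmul d u = wmul e v"
    have "d \<in> Wset n" "increasing_on J d" "e \<in> Wset n" "increasing_on J e"
      using as S0_in by (auto simp: DJ_def)
    then show "d = e \<and> u = v" using coset_unique[OF J _ _ _ _ as(2,4,5)] by blast
  qed
  show "(\<lambda>(d, u). wmul d u) ` (DJ J \<times> WK J) = S0"
  proof (intro equalityI subsetI)
    fix x assume "x \<in> (\<lambda>(d, u). wmul d u) ` (DJ J \<times> WK J)"
    then obtain d u where "x = wmul d u" "d \<in> S0" "u \<in> WK J" by (auto simp: DJ_def)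
    then show "x \<in> S0" using WK_mult WK_S0[OF J] by blast
  next
    fix x assume x: "x \<in> S0"
    obtain d u where d: "d \<in> Wset n" "increasing_on J d" "u \<in> WK J" "x = wmul d u"
      using coset_exists[OF J S0_in[OF x]] by metis
    have uin: "u \<in> Wset n" using WK_in[OF J d(3)] .
    have "wmul x (winv u) = d" unfolding d(4) using uin by (simp add: wmul_assoc wmul_winv wmul_one)
    moreover have "wmul x (winv u) \<in> S0" using WK_mult[OF x WK_S0[OF J WK_inv[OF J d(3)]]] .
    ultimately have "d \<in> DJ J" using d(2) by (simp add: DJ_def)
    then show "x \<in> (\<lambda>(d, u). wmul d u) ` (DJ J \<times> WK J)" using d by force
  qed
qed

lemma sum_DJ:
  assumes J: "J \<subseteq> {1..<n}"
  shows "(\<Sum>w\<in>S0. g w) = (\<Sum>d\<in>DJ J. \<Sum>u\<in>WK J. g (wmul d u) :: 'b::comm_monoid_add)"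
  using sum.reindex_bij_betw[OF DJ_bij[OF J], of g] by (simp add: case_prod_unfold sum.cartesian_product)

lemma Tf_DJ:
  assumes J: "J \<subseteq> {1..<n}" and d: "d \<in> DJ J" and u: "u \<in> WK J"
  shows "Tf (wmul d u) \<simeq> Tf d * Tf u"
proof -
  have dS: "d \<in> S0" "increasing_on J d" using d by (auto simp: DJ_def)
  have "Lw n (wmul d u) = Lw n d + Lw n u" by (rule Lw_coset[OF J S0_in[OF dS(1)] dS(2) u])
  then show ?thesis using heq_sym[OF Tf_mult[OF dS(1) WK_S0[OF J u]]] by simp
qed

lemma WK_induct [consumes 1, case_names one step]:
  assumes "u \<in> WK J" "P wone" "\<And>j u. j \<in> J \<Longrightarrow> u \<in> WK J \<Longrightarrow> P u \<Longrightarrow> P (wmul (sfin j) u)"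
  shows "P u"
proof -
  obtain "is" where i: "u = wprodS is" "set is \<subseteq> J" using assms(1) by (auto simp: WK_def)
  have "set js \<subseteq> J \<Longrightarrow> P (wprodS js)" for js
  proof (induction js)
    case Nil
    then show ?case using assms(2) by (simp add: wprodS_Nil)
  next
    case (Cons j js)
    moreover have "wprodS js \<in> WK J" using Cons(2) by (auto simp: WK_def)
    ultimately show ?case using assms(3)[of j "wprodS js"] by (simp add: wprodS_Cons)
  qed
  then show ?thesis using i by blast
qed

text \<open>Comparing the coefficients of \<open>T_w\<close> in x \<open>T_j\<close> = Q x shows
  that the coefficients P of x are constant on each coset of \<open>W_J\<close>; the terms of the
  coset of d then add up to \<open>P d T_d\<close> times the symmetriser.\<close>

theorem right_eigen_factor:
  assumes J: "J \<subseteq> {1..<n}" and x: "\<And>j. j \<in> J \<Longrightarrow> x * TG j \<simeq> fsc Q * x"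
  shows "\<exists>h. x \<simeq> h * vT J"
proof -
  have "x \<in> SP" by (rule spanning)
  then obtain P where P: "\<forall>w. P w \<in> LP" "x \<simeq> spn P" unfolding SP_def mem_Collect_eq by (elim exE conjE)
  have P1: "P w \<in> LP" for w by (rule spec[OF P(1)])
  have generator_invariant: "P (wmul v (sfin j)) = P v" if v: "v \<in> S0" and j: "j \<in> J" for v j
  proof -
    have i: "1 \<le> j" "j < n" using J j by auto
    let ?\<iota> = "\<lambda>w. wmul w (sfin j)"
    let ?up = "\<lambda>w. Lw n (?\<iota> w) = Suc (Lw n w)"
    define \<alpha> where "\<alpha> w = Lsc (if ?up w then 1 else Q) * P w" for w
    define \<beta> where "\<beta> w = Lsc (if ?up w then 0 else Q - 1) * P w" for w
    have summand: "lmap (P w) * Tf w * TG j \<simeq> lmap (\<alpha> w) * Tf (?\<iota> w) + lmap (\<beta> w) * Tf w" if w: "w \<in> S0" for w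
    proof -
      have "lmap (P w) * Tf w * TG j = lmap (P w) * (Tf w * TG j)" by (rule mult.assoc)
      also have "\<dots> \<simeq> lmap (P w) * (fsc (if ?up w then 1 else Q) * Tf (?\<iota> w) + fsc (if ?up w then 0 else Q - 1) * Tf w)"
        by (intro heq_mult_left Tf_T w i)
      also have "\<dots> = (fsc (if ?up w then 1 else Q) * lmap (P w)) * Tf (?\<iota> w) + (fsc (if ?up w then 0 else Q - 1) * lmap (P w)) * Tf w"
        by (simp only: distrib_left fsc_left_commute mult.assoc)
      finally show ?thesis unfolding \<alpha>_def \<beta>_def lmap_scale .
    qed
    have bij: "bij_betw ?\<iota> S0 S0"
      by (rule bij_betwI[where g = ?\<iota>]) (simp_all add: sfin_right[OF _ i] del: One_nat_def)
    have "fsc Q * x \<simeq> x * TG j" by (rule heq_sym[OF x[OF j]])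
    also have "\<dots> \<simeq> spn P * TG j" by (rule heq_mult_right[OF P(2)])
    also have "\<dots> = (\<Sum>w\<in>S0. lmap (P w) * Tf w * TG j)" by (simp only: spn_def sum_distrib_right)
    also have "\<dots> \<simeq> (\<Sum>w\<in>S0. lmap (\<alpha> w) * Tf (?\<iota> w) + lmap (\<beta> w) * Tf w)" by (intro heq_sum summand)
    also have "\<dots> = (\<Sum>w\<in>S0. lmap (\<alpha> (?\<iota> w)) * Tf (?\<iota> (?\<iota> w))) + (\<Sum>w\<in>S0. lmap (\<beta> w) * Tf w)"
      unfolding sum.distrib using sum.reindex_bij_betw[OF bij, of "\<lambda>w. lmap (\<alpha> w) * Tf (?\<iota> w)"] by simp
    also have "(\<Sum>w\<in>S0. lmap (\<alpha> (?\<iota> w)) * Tf (?\<iota> (?\<iota> w))) = (\<Sum>w\<in>S0. lmap (\<alpha> (?\<iota> w)) * Tf w)"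
      by (rule sum.cong[OF refl]) (simp only: sfin_right(2)[OF _ i])
    also have "(\<Sum>w\<in>S0. lmap (\<alpha> (?\<iota> w)) * Tf w) + (\<Sum>w\<in>S0. lmap (\<beta> w) * Tf w) = spn (\<lambda>w. \<alpha> (?\<iota> w) + \<beta> w)"
      by (simp only: spn_def lmap_add distrib_right sum.distrib)
    finally have 1: "fsc Q * x \<simeq> spn (\<lambda>w. \<alpha> (?\<iota> w) + \<beta> w)" .
    have 2: "fsc Q * spn P = spn (\<lambda>w. Lsc Q * P w)"
      by (simp only: spn_def sum_distrib_left mult.assoc[symmetric] lmap_scale)
    have "spn (\<lambda>w. Lsc Q * P w) \<simeq> spn (\<lambda>w. \<alpha> (?\<iota> w) + \<beta> w)"
      unfolding 2[symmetric] by (rule heq_trans[OF heq_mult_left[OF heq_sym[OF P(2)]] 1])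
    then have eq: "Lsc Q * P w = \<alpha> (?\<iota> w) + \<beta> w" if "w \<in> S0" for w
      by (rule spn_unique[rotated 2]) (use that P1 in \<open>simp_all add: \<alpha>_def \<beta>_def laurent_on_mult laurent_on_Lsc laurent_on_add\<close>)
    have Q1: "Lsc Q \<noteq> (0 :: 'k laurent)"
    proof
      assume "Lsc Q = (0 :: 'k laurent)"
      moreover have "Lsc (inverse Q) * Lsc Q = (1 :: 'k laurent)" using Q0 by (simp flip: Lsc_mult)
      ultimately show False by simp
    qed
    \<comment> \<open>At an ascent w the coefficient of \<open>T_w\<close> comes from
      \<open>T_(w s_j) T_j\<close> alone, with factor Q.\<close>
    have upcase: "P (?\<iota> w) = P w" if w: "w \<in> S0" "?up w" for w
    proof -
      have nup: "\<not> ?up (?\<iota> w)" unfolding sfin_right(2)[OF w(1) i] w(2) by simp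
      have "\<alpha> (?\<iota> w) = Lsc Q * P (?\<iota> w)" unfolding \<alpha>_def if_not_P[OF nup] ..
      moreover have "\<beta> w = 0" unfolding \<beta>_def if_P[OF w(2)] Lsc_0 by (rule mult_zero_left)
      ultimately have "Lsc Q * P w = Lsc Q * P (?\<iota> w)" using eq[OF w(1)] by (simp only: add_0_right)
      then show ?thesis unfolding mult_left_cancel[OF Q1] by (rule sym)
    qed
    show ?thesis
    proof (cases "?up v")
      case True
      then show ?thesis by (rule upcase[OF v])
    next
      case False
      then have "?up (?\<iota> v)" using sfin_right(2,3)[OF v i] by simp
      then have "P (?\<iota> (?\<iota> v)) = P (?\<iota> v)" by (rule upcase[OF sfin_right(1)[OF v i]])
      then show ?thesis using sfin_right(2)[OF v i] by simp
    qed
  qed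
  have const: "\<forall>v\<in>S0. P (wmul v u) = P v" if "u \<in> WK J" for u
    using that
  proof (induction rule: WK_induct)
    case one
    then show ?case by (simp add: wmul_one)
  next
    case (step j u)
    show ?case
    proof
      fix v assume v: "v \<in> S0"
      have "wmul v (sfin j) \<in> S0" using v J step(1) by (intro sfin_right(1)) auto
      then have "P (wmul (wmul v (sfin j)) u) = P (wmul v (sfin j))" using step(3) by blast
      also have "\<dots> = P v" by (rule generator_invariant[OF v step(1)])
      finally show "P (wmul v (wmul (sfin j) u)) = P v" by (simp only: wmul_assoc)
    qed
  qed
  have "x \<simeq> (\<Sum>d\<in>DJ J. \<Sum>u\<in>WK J. lmap (P (wmul d u)) * Tf (wmul d u))"
    using P(2) unfolding spn_def sum_DJ[OF J] .
  also have "\<dots> \<simeq> (\<Sum>d\<in>DJ J. \<Sum>u\<in>WK J. lmap (P d) * (Tf d * Tf u))"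
  proof (intro heq_sum)
    fix d u assume d: "d \<in> DJ J" and u: "u \<in> WK J"
    have "d \<in> S0" using d by (simp add: DJ_def)
    then have "P (wmul d u) = P d" using const[OF u] by blast
    then show "lmap (P (wmul d u)) * Tf (wmul d u) \<simeq> lmap (P d) * (Tf d * Tf u)"
      by (simp only: heq_mult_left[OF Tf_DJ[OF J d u]])
  qed
  also have "\<dots> = (\<Sum>d\<in>DJ J. lmap (P d) * Tf d) * vT J"
    by (simp only: vT_def sum_product mult.assoc)
  finally show ?thesis by blast
qed

text \<open>The operator y is left open: it is the symmetriser in one use, and an operator with
  values in the line of an invariant in the other.\<close>

lemma Tf_vT:
  assumes J: "J \<subseteq> {1..<n}" and u: "u \<in> WK J"
    and y: "\<And>j. j \<in> J \<Longrightarrow> act n q (TG j) * y = emul (Lsc Q) * y"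
  shows "act n q (Tf u) * y = emul (Lsc (Q ^ Lw n u)) * y"
proof -
  obtain "is" where i: "set is \<subseteq> J" "length is = Lw n u" "u = wprodS is" using WK_reduced[OF J u] by blast
  have word: "set js \<subseteq> J \<Longrightarrow> act n q (prod_list (map TG js)) * y = emul (Lsc (Q ^ length js)) * y" for js
  proof (induction js)
    case (Cons j js)
    have "act n q (prod_list (map TG (j # js))) * y = act n q (TG j) * (act n q (prod_list (map TG js)) * y)"
      by (simp add: act_mult mult.assoc)
    also have "\<dots> = (act n q (TG j) * emul (Lsc (Q ^ length js))) * y" using Cons by (simp add: mult.assoc)
    also have "act n q (TG j) * emul (Lsc (Q ^ length js)) = emul (Lsc (Q ^ length js)) * act n q (TG j)"
      using sc_act[of "TG j"] by (simp add: scalar_commuting_def)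
    also have "emul (Lsc (Q ^ length js)) * act n q (TG j) * y = emul (Lsc (Q ^ length js)) * (emul (Lsc Q) * y)"
      using Cons(2) y[of j] by (simp add: mult.assoc)
    also have "\<dots> = emul (Lsc (Q ^ length (j # js))) * y"
      by (simp add: Lsc_mult emul_mult mult.assoc[symmetric] emul_commute)
    finally show ?case .
  qed simp
  have "act n q (Tf u) = act n q (prod_list (map TG is))"
    using heq_imp_act_eq[OF Tf_word[of "is"]] i J by auto
  then show ?thesis using word[OF i(1)] i(2) by simp
qed

lemma act_vT:
  assumes "J \<subseteq> {1..<n}" "j \<in> J"
  shows "act n q (TG j) * act n q (vT J) = emul (Lsc Q) * act n q (vT J)"
  using heq_imp_act_eq[OF T_vT[OF assms]] by (simp add: act_mult act_fsc)

text \<open>The difference of \<open>T_j f\<close> and Q f is a nonzero polynomial times the divided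
  difference of f, which vanishes exactly on the f fixed by the swap.\<close>

lemma act_T_invariant:
  assumes "1 \<le> j" "j < n"
  shows "app (act n q (TG j)) f = Lsc Q * f \<longleftrightarrow> permL (sw j) f = f"
proof -
  have T: "app (act n q (TG j)) f = Lsc Q * f - (Lsc Q * LX j - LX (Suc j)) * ddiff j f"
    using assms by (simp add: act_TG app_Top Q_def)
  have "(LX j - LX (Suc j)) * ddiff j f = 0 \<longleftrightarrow> permL (sw j) f = f"
    unfolding ddiff by auto
  then have d: "ddiff j f = 0 \<longleftrightarrow> permL (sw j) f = f" by (simp add: LX_inj)
  have "(Lsc Q * LX j - LX (Suc j)) * ddiff j f = 0 \<longleftrightarrow> ddiff j f = 0"
    using Top_coeff_nonzero[of Q j] by (simp only: mult_eq_0_iff simp_thms)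
  then show ?thesis unfolding d[symmetric] by (simp only: T diff_eq_eq add_cancel_right_right)
qed

text \<open>The formula \<open>hy\<close> is applied twice with the same weights r: to the
  symmetriser, where independence forces them to vanish, and then to an operator built from
  f.\<close>

theorem kills_invariants:
  assumes J: "J \<subseteq> {1..<n}" and h: "h * vT J \<simeq> 0" and f: "\<And>j. j \<in> J \<Longrightarrow> permL (sw j) f = f"
  shows "app (act n q h) f = 0"
proof -
  have "h \<in> SP" by (rule spanning)
  then obtain P where P: "\<forall>w. P w \<in> LP" "h \<simeq> spn P" unfolding SP_def mem_Collect_eq by (elim exE conjE)
  have P1: "P w \<in> LP" for w by (rule spec[OF P(1)])
  \<comment> \<open>On an eigenvector \<open>T_u\<close> acts by \<open>Q^l(u)\<close>, so the coset
    of d contributes to h through this sum only.\<close>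
  define r where "r d = (\<Sum>u\<in>WK J. Lsc (Q ^ Lw n u) * P (wmul d u))" for d
  have rLP: "r d \<in> LP" for d
    unfolding r_def by (intro laurent_on_sum laurent_on_mult laurent_on_Lsc P1)
  have hy: "act n q h * y = (\<Sum>d\<in>DJ J. emul (r d) * (act n q (Tf d) * y))"
    if y: "\<And>j. j \<in> J \<Longrightarrow> act n q (TG j) * y = emul (Lsc Q) * y" for y
  proof -
    have "act n q h * y = act n q (spn P) * y" using heq_imp_act_eq[OF P(2)] by simp
    also have "\<dots> = (\<Sum>w\<in>S0. emul (P w) * act n q (Tf w)) * y"
      by (simp only: spn_def act_sum act_mult act_lmap[OF P1])
    also have "\<dots> = (\<Sum>d\<in>DJ J. \<Sum>u\<in>WK J. emul (P (wmul d u)) * act n q (Tf (wmul d u)) * y)"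
      by (simp only: sum_DJ[OF J] sum_distrib_right)
    also have "\<dots> = (\<Sum>d\<in>DJ J. \<Sum>u\<in>WK J. emul (Lsc (Q ^ Lw n u) * P (wmul d u)) * (act n q (Tf d) * y))"
    proof (intro sum.cong refl)
      fix d u assume d: "d \<in> DJ J" and u: "u \<in> WK J"
      have "emul (P (wmul d u)) * act n q (Tf (wmul d u)) * y = emul (P (wmul d u)) * (act n q (Tf d) * (act n q (Tf u) * y))"
        using heq_imp_act_eq[OF Tf_DJ[OF J d u]] by (simp only: act_mult mult.assoc)
      also have "act n q (Tf u) * y = emul (Lsc (Q ^ Lw n u)) * y" by (rule Tf_vT[OF J u y])
      also have "act n q (Tf d) * (emul (Lsc (Q ^ Lw n u)) * y) = emul (Lsc (Q ^ Lw n u)) * (act n q (Tf d) * y)"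
        using sc_act[of "Tf d"] unfolding scalar_commuting_def by (simp only: mult.assoc[symmetric])
      also have "emul (P (wmul d u)) * (emul (Lsc (Q ^ Lw n u)) * (act n q (Tf d) * y))
          = (emul (P (wmul d u)) * emul (Lsc (Q ^ Lw n u))) * (act n q (Tf d) * y)" by (simp only: mult.assoc)
      also have "emul (P (wmul d u)) * emul (Lsc (Q ^ Lw n u)) = emul (Lsc (Q ^ Lw n u) * P (wmul d u))"
        by (simp only: emul_mult emul_commute)
      finally show "emul (P (wmul d u)) * act n q (Tf (wmul d u)) * y
          = emul (Lsc (Q ^ Lw n u) * P (wmul d u)) * (act n q (Tf d) * y)" .
    qed
    also have "\<dots> = (\<Sum>d\<in>DJ J. emul (r d) * (act n q (Tf d) * y))"
    proof -
      have "emul (sum g I) = (\<Sum>i\<in>I. emul (g i))" for g :: "waff \<Rightarrow> 'k laurent" and I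
        by (induction I rule: infinite_finite_induct) (simp_all add: emul_add)
      then show ?thesis unfolding r_def by (simp only: sum_distrib_right)
    qed
    finally show ?thesis .
  qed
  \<comment> \<open>Spreads r over whole cosets, so that \<open>spn R\<close> represents h times the
    symmetriser in the basis of the \<open>T_w\<close>.\<close>
  define R where "R w = r (fst (inv_into (DJ J \<times> WK J) (\<lambda>(d, u). wmul d u) w))" for w
  have RLP: "R w \<in> LP" for w unfolding R_def by (rule rLP)
  have R: "R (wmul d u) = r d" if "d \<in> DJ J" "u \<in> WK J" for d u
    using bij_betw_inv_into_left[OF DJ_bij[OF J], of "(d, u)"] that by (simp add: R_def)
  have "act n q (spn R) = (\<Sum>d\<in>DJ J. \<Sum>u\<in>WK J. emul (r d) * (act n q (Tf d) * act n q (Tf u)))"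
  proof -
    have "act n q (spn R) = (\<Sum>d\<in>DJ J. \<Sum>u\<in>WK J. emul (R (wmul d u)) * act n q (Tf (wmul d u)))"
      unfolding spn_def sum_DJ[OF J] act_sum act_mult act_lmap[OF RLP] ..
    also have "\<dots> = (\<Sum>d\<in>DJ J. \<Sum>u\<in>WK J. emul (r d) * (act n q (Tf d) * act n q (Tf u)))"
      by (intro sum.cong refl) (simp only: R heq_imp_act_eq[OF Tf_DJ[OF J]] act_mult)
    finally show ?thesis .
  qed
  also have "\<dots> = (\<Sum>d\<in>DJ J. emul (r d) * (act n q (Tf d) * act n q (vT J)))"
    by (simp only: vT_def act_sum sum_distrib_left)
  also have "\<dots> = act n q h * act n q (vT J)" by (rule hy[OF act_vT[OF J], symmetric])
  also have "\<dots> = 0" using heq_imp_act_eq[OF h] by (simp add: act_mult)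
  finally have z: "act n q (spn R) = 0" .
  have Rw: "R w = 0" if "w \<in> S0" for w
  proof (rule independence[of R, OF RLP _ that])
    show "app (act n q (spn R)) f = 0" for f unfolding z by simp
  qed
  have r0: "r d = 0" if d: "d \<in> DJ J" for d
  proof -
    have "d \<in> S0" using d by (simp add: DJ_def)
    then show ?thesis using R[OF d WK_one] Rw[of d] by (simp add: wmul_one)
  qed
  \<comment> \<open>Turns the vector f into an operator sending 1 to f. Multiplication by f would
    not do: every value must be an eigenvector, so g enters only through a scalar, its constant
    coefficient.\<close>
  define y where "y = Aend (\<lambda>g. Lsc (Poly_Mapping.lookup g 0) * f)"
  have app_y: "app y g = Lsc (Poly_Mapping.lookup g 0) * f" for g
    unfolding y_def by (subst app_Aend) (simp_all add: lookup_add Lsc_add distrib_right)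
  have "act n q (TG j) * y = emul (Lsc Q) * y" if j: "j \<in> J" for j
  proof (rule aend_eqI)
    fix g
    have i: "1 \<le> j" "j < n" using J j by auto
    have "permL (sw j) (app y g) = app y g" unfolding app_y permL_mult by (simp add: f[OF j])
    then show "app (act n q (TG j) * y) g = app (emul (Lsc Q) * y) g"
      using act_T_invariant[OF i, of "app y g"] by simp
  qed
  then have "act n q h * y = (\<Sum>d\<in>DJ J. emul (r d) * (act n q (Tf d) * y))" by (rule hy)
  also have "\<dots> = 0" by (rule sum.neutral) (simp add: r0)
  finally have "app (act n q h * y) 1 = 0" by simp
  then show ?thesis by (simp add: app_y)
qed

end

subsection \<open>The representation of the affine Schur algebra\<close>

context hecke_full
begin

abbreviation "v \<equiv> vJ n q sq"

definition inv_J :: "nat set \<Rightarrow> 'k laurent set" where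
  "inv_J J = {f \<in> LP. \<forall>j\<in>J. permL (sw j) f = f}"

lemma Iset_iff: "J \<in> Iset n \<longleftrightarrow> J \<subseteq> {1..<n}"
  by (simp add: Iset_def)

lemma invariants_eq:
  assumes J: "J \<subseteq> {1..<n}" shows "(invariants n (fst ` WK J) :: 'k laurent set) = inv_J J"
proof (intro equalityI subsetI)
  fix f :: "'k laurent" assume f: "f \<in> invariants n (fst ` WK J)"
  have "permL (sw j) f = f" if "j \<in> J" for j
  proof -
    have "fst (sfin j) \<in> fst ` WK J" using WK_gen[OF that] by (rule imageI)
    then show ?thesis using f by (auto simp: invariants_def sfin_def)
  qed
  then show "f \<in> inv_J J" using f by (simp add: invariants_def inv_J_def laurent_set_eq_on)
next
  fix f :: "'k laurent" assume f: "f \<in> inv_J J"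
  have "permL (fst u) f = f" if "u \<in> WK J" for u
    using that
  proof (induction rule: WK_induct)
    case one
    then show ?case by (simp add: wone_def permL_id[unfolded id_def])
  next
    case (step j u)
    have "fst (wmul (sfin j) u) = sw j \<circ> fst u" by (simp add: wmul_def sfin_def)
    then have "permL (fst (wmul (sfin j) u)) f = permL (sw j) (permL (fst u) f)" by (simp only: permL_comp)
    then show ?case using step f by (simp add: inv_J_def)
  qed
  then show "f \<in> invariants n (fst ` WK J)" using f by (auto simp: invariants_def inv_J_def laurent_set_eq_on)
qed

lemma Pset_iff: "F \<in> Pset n \<longleftrightarrow> (\<forall>K\<in>Iset n. F K \<in> inv_J K) \<and> (\<forall>K. K \<notin> Iset n \<longrightarrow> F K = 0)"
  unfolding Pset_def using invariants_eq Iset_iff by auto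

lemma act_LP: "f \<in> LP \<Longrightarrow> app (act n q x) f \<in> LP"
proof (induction x arbitrary: f rule: falg_induct)
  case (scalar c)
  then show ?case by (simp add: act_fsc laurent_on_mult laurent_on_Lsc)
next
  case (gen g x)
  have "app (gop n q g) h \<in> LP" if h: "h \<in> LP" for h
  proof (cases "valid_gen n g")
    case False
    then show ?thesis by (simp add: gop_def)
  next
    case True
    show ?thesis
    proof (cases g)
      case (GT i)
      then have "i \<in> {1..n}" "Suc i \<in> {1..n}" using True by (auto simp: valid_gen_def)
      then show ?thesis using GT True h
        by (simp only: gop_def if_True not_True_eq_False if_False hgen.case app_Top)
           (intro laurent_on_diff laurent_on_mult laurent_on_Lsc laurent_on_LX ddiff_in)
    next
      case (GX j)
      then have "j \<in> {1..n}" using True by (auto simp: valid_gen_def)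
      then have "LX j * h \<in> LP" using h by (intro laurent_on_mult laurent_on_LX)
      then show ?thesis using GX True by (simp add: gop_def)
    next
      case (GXi j)
      then have "j \<in> {1..n}" using True by (auto simp: valid_gen_def)
      then have "LXinv j * h \<in> LP" using h by (intro laurent_on_mult laurent_on_LXinv)
      then show ?thesis using GXi True by (simp add: gop_def)
    qed
  qed
  then show ?case using gen by (simp add: act_mult act_fgen)
next
  case (add x y)
  then show ?case by (simp add: act_add laurent_on_add)
qed

lemma v_vT: "J \<in> Iset n \<Longrightarrow> v J \<simeq> vT J"
  by (simp add: vJ_vT Iset_iff)

lemma T_v:
  assumes J: "J \<in> Iset n" and j: "j \<in> J" shows "TG j * v J \<simeq> fsc Q * v J" "v J * TG j \<simeq> fsc Q * v J"
proof -
  have Jn: "J \<subseteq> {1..<n}" using J by (simp add: Iset_iff)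
  have "TG j * v J \<simeq> TG j * vT J" by (intro heq_mult_left v_vT J)
  also have "\<dots> \<simeq> fsc Q * vT J" by (rule T_vT[OF Jn j])
  also have "\<dots> \<simeq> fsc Q * v J" by (intro heq_mult_left heq_sym[OF v_vT] J)
  finally show "TG j * v J \<simeq> fsc Q * v J" .
  have "v J * TG j \<simeq> vT J * TG j" by (intro heq_mult_right v_vT J)
  also have "\<dots> \<simeq> fsc Q * vT J" by (rule vT_T[OF Jn j])
  also have "\<dots> \<simeq> fsc Q * v J" by (intro heq_mult_left heq_sym[OF v_vT] J)
  finally show "v J * TG j \<simeq> fsc Q * v J" .
qed

lemma Mset_iff: "x \<in> Mset n q sq J \<longleftrightarrow> (\<exists>h. x \<simeq> v J * h)"
  by (simp add: Mset_def fmul_eq_times)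

lemma Mset_v: "v J * h \<in> Mset n q sq J" "v J \<in> Mset n q sq J"
  unfolding Mset_iff by (rule exI[of _ h], rule heq_refl) (rule exI[of _ 1], simp)

lemma hom_D:
  assumes "is_hom n q sq J K \<phi>"
  shows "x \<in> Mset n q sq J \<Longrightarrow> \<phi> x \<in> Mset n q sq K"
    "x \<in> Mset n q sq J \<Longrightarrow> y \<in> Mset n q sq J \<Longrightarrow> x \<simeq> y \<Longrightarrow> \<phi> x \<simeq> \<phi> y"
    "x \<in> Mset n q sq J \<Longrightarrow> \<phi> (x * h) \<simeq> \<phi> x * h"
  using assms unfolding is_hom_def fmul_eq_times by blast+

lemma hom_apply:
  assumes h: "is_hom n q sq J K \<phi>" and x: "x \<simeq> v J * y"
  shows "\<phi> x \<simeq> \<phi> (v J) * y"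
proof -
  have "x \<in> Mset n q sq J" using x Mset_iff by blast
  then have "\<phi> x \<simeq> \<phi> (v J * y)" using hom_D(2)[OF h _ Mset_v(1) x] by blast
  also have "\<dots> \<simeq> \<phi> (v J) * y" by (rule hom_D(3)[OF h Mset_v(2)])
  finally show ?thesis .
qed

lemma hom_left_factor:
  assumes J: "J \<in> Iset n" and h: "is_hom n q sq J K \<phi>"
  shows "\<exists>h. \<phi> (v J) \<simeq> h * v J"
proof -
  have "\<phi> (v J) * TG j \<simeq> fsc Q * \<phi> (v J)" if j: "j \<in> J" for j
  proof -
    have "\<phi> (v J) * TG j \<simeq> \<phi> (v J * TG j)" by (rule heq_sym[OF hom_D(3)[OF h Mset_v(2)]])
    also have "\<dots> \<simeq> \<phi> (v J) * fsc Q"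
      by (rule hom_apply[OF h]) (simp only: T_v(2)[OF J j] fsc_commute[of Q "v J", symmetric])
    finally show ?thesis by (simp only: fsc_commute)
  qed
  then obtain h where "\<phi> (v J) \<simeq> h * vT J" using right_eigen_factor[of J "\<phi> (v J)"] J by (auto simp: Iset_iff)
  then have "\<phi> (v J) \<simeq> h * v J" using heq_trans heq_mult_left[OF heq_sym[OF v_vT[OF J]]] by blast
  then show ?thesis ..
qed

text \<open>A harmless choice: by \<open>act_well_defined\<close> all left factors of one element
  act alike on invariants.\<close>

definition hsel :: "nat set \<Rightarrow> 'k falg \<Rightarrow> 'k falg" where
  "hsel J y = (SOME h. y \<simeq> h * v J)"

lemma hsel: "y \<simeq> h * v J \<Longrightarrow> y \<simeq> hsel J y * v J"
  unfolding hsel_def by (rule someI)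

lemma act_well_defined:
  assumes J: "J \<in> Iset n" and e: "h * v J \<simeq> h' * v J" and f: "f \<in> inv_J J"
  shows "app (act n q h) f = app (act n q h') f"
proof -
  have "(h - h') * vT J \<simeq> (h - h') * v J" by (intro heq_mult_left heq_sym[OF v_vT] J)
  also have "(h - h') * v J = h * v J - h' * v J" by (rule left_diff_distrib)
  also have "\<dots> \<simeq> h' * v J - h' * v J" by (intro heq_diff e heq_refl)
  finally have "(h - h') * vT J \<simeq> 0" by simp
  then have "app (act n q (h - h')) f = 0"
    using J f by (intro kills_invariants[of J]) (auto simp: Iset_iff inv_J_def)
  then show ?thesis by (simp add: act_diff)
qed

text \<open>For k in K, \<open>T_k h\<close> and Q h agree after multiplication by
  \<open>v_J\<close>, because \<open>h v_J\<close> lies in \<open>v_K H\<close>; by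
  \<open>act_well_defined\<close> they agree on invariants.\<close>

lemma act_invariant:
  assumes J: "J \<in> Iset n" and K: "K \<in> Iset n" and e: "h * v J \<in> Mset n q sq K" and f: "f \<in> inv_J J"
  shows "app (act n q h) f \<in> inv_J K"
  unfolding inv_J_def mem_Collect_eq
proof (intro conjI ballI)
  show "app (act n q h) f \<in> LP" using f by (intro act_LP) (simp add: inv_J_def)
  fix k assume k: "k \<in> K"
  then have i: "1 \<le> k" "k < n" using K by (auto simp: Iset_iff)
  obtain g where g: "h * v J \<simeq> v K * g" using e Mset_iff by blast
  have "(TG k * h) * v J = TG k * (h * v J)" by (rule mult.assoc)
  also have "\<dots> \<simeq> TG k * (v K * g)" by (rule heq_mult_left[OF g])
  also have "\<dots> = (TG k * v K) * g" by (simp only: mult.assoc)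
  also have "\<dots> \<simeq> (fsc Q * v K) * g" by (rule heq_mult_right[OF T_v(1)[OF K k]])
  also have "\<dots> = fsc Q * (v K * g)" by (rule mult.assoc)
  also have "\<dots> \<simeq> fsc Q * (h * v J)" by (rule heq_mult_left[OF heq_sym[OF g]])
  also have "\<dots> = (fsc Q * h) * v J" by (simp only: mult.assoc)
  finally have "app (act n q (TG k * h)) f = app (act n q (fsc Q * h)) f" by (rule act_well_defined[OF J _ f])
  then have "app (act n q (TG k)) (app (act n q h) f) = Lsc Q * app (act n q h) f"
    by (simp add: act_mult act_fsc)
  then show "permL (sw k) (app (act n q h) f) = app (act n q h) f"
    using act_T_invariant[OF i] by blast
qed

definition rho :: "(nat set \<Rightarrow> nat set \<Rightarrow> 'k falg \<Rightarrow> 'k falg) \<Rightarrow> (nat set \<Rightarrow> 'k laurent) \<Rightarrow> nat set \<Rightarrow> 'k laurent" where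
  "rho \<Phi> F K = (if K \<in> Iset n then \<Sum>J\<in>Iset n. app (act n q (hsel J (\<Phi> K J (v J)))) (F J) else 0)"

lemma finite_Iset: "finite (Iset n)"
  by (simp add: Iset_def)

text \<open>Any system of left factors computes \<open>rho\<close>. Each algebraic property below
  thus reduces to exhibiting factors for a sum, a multiple, a composition or a basis
  element.\<close>

lemma rho_eqI:
  assumes H: "\<And>K J. K \<in> Iset n \<Longrightarrow> J \<in> Iset n \<Longrightarrow> \<Phi> K J (v J) \<simeq> H K J * v J" and F: "F \<in> Pset n"
  shows "rho \<Phi> F = (\<lambda>K. if K \<in> Iset n then \<Sum>J\<in>Iset n. app (act n q (H K J)) (F J) else 0)"
proof
  fix K
  show "rho \<Phi> F K = (if K \<in> Iset n then \<Sum>J\<in>Iset n. app (act n q (H K J)) (F J) else 0)"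
  proof (cases "K \<in> Iset n")
    case True
    have "app (act n q (hsel J (\<Phi> K J (v J)))) (F J) = app (act n q (H K J)) (F J)" if J: "J \<in> Iset n" for J
    proof (rule act_well_defined[OF J])
      note e = H[OF True J]
      show "hsel J (\<Phi> K J (v J)) * v J \<simeq> H K J * v J" by (rule heq_trans[OF heq_sym[OF hsel[OF e]] e])
      show "F J \<in> inv_J J" using F J Pset_iff by blast
    qed
    then have "(\<Sum>J\<in>Iset n. app (act n q (hsel J (\<Phi> K J (v J)))) (F J)) = (\<Sum>J\<in>Iset n. app (act n q (H K J)) (F J))"
      by (rule sum.cong[OF refl])
    then show ?thesis unfolding rho_def if_P[OF True] .
  next
    case False
    then show ?thesis by (simp add: rho_def)
  qed
qed

definition HS :: "(nat set \<Rightarrow> nat set \<Rightarrow> 'k falg \<Rightarrow> 'k falg) \<Rightarrow> nat set \<Rightarrow> nat set \<Rightarrow> 'k falg" where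
  "HS \<Phi> K J = hsel J (\<Phi> K J (v J))"

lemma Sset_hom: "\<Phi> \<in> Sset n q sq \<Longrightarrow> J \<in> Iset n \<Longrightarrow> K \<in> Iset n \<Longrightarrow> is_hom n q sq J K (\<Phi> K J)"
  by (simp add: Sset_def)

lemma HS:
  assumes "\<Phi> \<in> Sset n q sq" "K \<in> Iset n" "J \<in> Iset n"
  shows "\<Phi> K J (v J) \<simeq> HS \<Phi> K J * v J"
proof -
  obtain h where "\<Phi> K J (v J) \<simeq> h * v J" using hom_left_factor[OF assms(3) Sset_hom[OF assms(1,3,2)]] by blast
  then show ?thesis unfolding HS_def by (rule hsel)
qed

lemma rho_HS: "rho \<Phi> F K = (if K \<in> Iset n then \<Sum>J\<in>Iset n. app (act n q (HS \<Phi> K J)) (F J) else 0)"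
  by (simp add: rho_def HS_def)

lemma inv_J_0: "0 \<in> inv_J K" by (simp add: inv_J_def)
lemma inv_J_add: "f \<in> inv_J K \<Longrightarrow> g \<in> inv_J K \<Longrightarrow> f + g \<in> inv_J K"
  by (simp add: inv_J_def laurent_on_add permL_add)

lemma sum_in_inv_J: "(\<And>i. i \<in> I \<Longrightarrow> f i \<in> inv_J K) \<Longrightarrow> sum f I \<in> inv_J K"
  by (induction I rule: infinite_finite_induct) (simp_all add: inv_J_0 inv_J_add)

lemma rho_Pset:
  assumes S: "\<Phi> \<in> Sset n q sq" and F: "F \<in> Pset n" shows "rho \<Phi> F \<in> Pset n"
  unfolding Pset_iff
proof (intro conjI ballI allI impI)
  fix K assume K: "K \<in> Iset n"
  have "app (act n q (HS \<Phi> K J)) (F J) \<in> inv_J K" if J: "J \<in> Iset n" for J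
  proof (rule act_invariant[OF J K])
    have "\<Phi> K J (v J) \<in> Mset n q sq K" by (rule hom_D(1)[OF Sset_hom[OF S J K] Mset_v(2)])
    then obtain g where "\<Phi> K J (v J) \<simeq> v K * g" using Mset_iff by blast
    then have "HS \<Phi> K J * v J \<simeq> v K * g" by (rule heq_trans[OF heq_sym[OF HS[OF S K J]]])
    then show "HS \<Phi> K J * v J \<in> Mset n q sq K" using Mset_iff by blast
    show "F J \<in> inv_J J" using F J Pset_iff by blast
  qed
  then have "(\<Sum>J\<in>Iset n. app (act n q (HS \<Phi> K J)) (F J)) \<in> inv_J K"
    by (rule sum_in_inv_J)
  then show "rho \<Phi> F K \<in> inv_J K" using K by (simp add: rho_HS)
qed (simp add: rho_def)

lemma rho_add: "rho \<Phi> (\<lambda>K. F K + G K) = (\<lambda>K. rho \<Phi> F K + rho \<Phi> G K)"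
  by (rule ext) (simp add: rho_def app_add sum.distrib)

lemma app_act_scalar:
  fixes x :: "'k falg" shows "app (act n q x) (Lsc c * f) = Lsc c * app (act n q x) f"
proof -
  have "act n q x * emul (Lsc c) = emul (Lsc c) * act n q x" using sc_act[of x] by (simp add: scalar_commuting_def)
  then have "app (act n q x * emul (Lsc c)) f = app (emul (Lsc c) * act n q x) f" by simp
  then show ?thesis by simp
qed

lemma rho_scalar: "rho \<Phi> (\<lambda>K. Lsc c * F K) = (\<lambda>K. Lsc c * rho \<Phi> F K)"
  by (rule ext) (simp add: rho_def app_act_scalar sum_distrib_left)

lemma rho_seq:
  assumes "\<Phi> \<in> Sset n q sq" "\<Psi> \<in> Sset n q sq" "seq n q sq \<Phi> \<Psi>" "F \<in> Pset n"
  shows "rho \<Phi> F = rho \<Psi> F"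
proof -
  have "\<Phi> K J (v J) \<simeq> HS \<Psi> K J * v J" if "K \<in> Iset n" "J \<in> Iset n" for K J
  proof (rule heq_trans[OF _ HS[OF assms(2) that]])
    show "\<Phi> K J (v J) \<simeq> \<Psi> K J (v J)" using assms(3) that Mset_v(2) unfolding seq_def by blast
  qed
  from rho_eqI[where \<Phi> = \<Phi> and H = "HS \<Psi>", OF this assms(4)] show ?thesis by (simp add: fun_eq_iff rho_HS[of \<Psi>])
qed

lemma rho_sadd:
  assumes "\<Phi> \<in> Sset n q sq" "\<Psi> \<in> Sset n q sq" "F \<in> Pset n"
  shows "rho (sadd \<Phi> \<Psi>) F = (\<lambda>K. rho \<Phi> F K + rho \<Psi> F K)"
proof -
  have "sadd \<Phi> \<Psi> K J (v J) \<simeq> (HS \<Phi> K J + HS \<Psi> K J) * v J" if "K \<in> Iset n" "J \<in> Iset n" for K J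
    unfolding sadd_def distrib_right by (intro heq_add HS assms that)
  from rho_eqI[where \<Phi> = "sadd \<Phi> \<Psi>" and H = "\<lambda>K J. HS \<Phi> K J + HS \<Psi> K J", OF this assms(3)] show ?thesis
    by (simp add: fun_eq_iff rho_HS act_add sum.distrib)
qed

lemma rho_ssc:
  assumes "\<Phi> \<in> Sset n q sq" "F \<in> Pset n"
  shows "rho (ssc c \<Phi>) F = (\<lambda>K. Lsc c * rho \<Phi> F K)"
proof -
  have "ssc c \<Phi> K J (v J) \<simeq> (fsc c * HS \<Phi> K J) * v J" if "K \<in> Iset n" "J \<in> Iset n" for K J
    unfolding ssc_def fmul_eq_times mult.assoc by (intro heq_mult_left HS assms that)
  from rho_eqI[where \<Phi> = "ssc c \<Phi>" and H = "\<lambda>K J. fsc c * HS \<Phi> K J", OF this assms(2)] show ?thesis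
    by (simp add: fun_eq_iff rho_HS act_mult act_fsc sum_distrib_left)
qed

lemma rho_sone:
  assumes "F \<in> Pset n" shows "rho sone F = F"
proof -
  have "sone K J (v J) \<simeq> (if K = J then 1 else 0) * v J" for K J
    by (simp add: sone_def)
  from rho_eqI[where \<Phi> = sone and H = "\<lambda>K J. if K = J then 1 else 0", OF this assms]
  have "rho sone F = (\<lambda>K. if K \<in> Iset n then \<Sum>J\<in>Iset n. app (act n q (if K = J then 1 else 0)) (F J) else 0)" .
  also have "\<dots> = (\<lambda>K. if K \<in> Iset n then \<Sum>J\<in>Iset n. if K = J then F J else 0 else 0)"
    by (intro ext if_cong sum.cong refl) simp
  also have "\<dots> = F" using assms finite_Iset Pset_iff by (auto simp: fun_eq_iff)
  finally show ?thesis .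
qed

lemma rho_scomp:
  assumes \<Phi>: "\<Phi> \<in> Sset n q sq" and \<Psi>: "\<Psi> \<in> Sset n q sq" and F: "F \<in> Pset n"
  shows "rho (scomp n \<Phi> \<Psi>) F = rho \<Phi> (rho \<Psi> F)"
proof -
  have "scomp n \<Phi> \<Psi> K J (v J) \<simeq> (\<Sum>L\<in>Iset n. HS \<Phi> K L * HS \<Psi> L J) * v J" if K: "K \<in> Iset n" and J: "J \<in> Iset n" for K J
    unfolding scomp_def sum_distrib_right
  proof (rule heq_sum)
    fix L assume L: "L \<in> Iset n"
    have "\<Psi> L J (v J) \<in> Mset n q sq L" by (rule hom_D(1)[OF Sset_hom[OF \<Psi> J L] Mset_v(2)])
    then obtain g where g: "\<Psi> L J (v J) \<simeq> v L * g" using Mset_iff by blast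
    \<comment> \<open>Right linearity splits off g; after \<open>\<Phi>\<close> is replaced by its
      left factor, \<open>v_L g\<close> is put back together.\<close>
    have "\<Phi> K L (\<Psi> L J (v J)) \<simeq> \<Phi> K L (v L) * g" by (rule hom_apply[OF Sset_hom[OF \<Phi> L K] g])
    also have "\<dots> \<simeq> (HS \<Phi> K L * v L) * g" by (rule heq_mult_right[OF HS[OF \<Phi> K L]])
    also have "\<dots> = HS \<Phi> K L * (v L * g)" by (rule mult.assoc)
    also have "\<dots> \<simeq> HS \<Phi> K L * \<Psi> L J (v J)" by (rule heq_mult_left[OF heq_sym[OF g]])
    also have "\<dots> \<simeq> HS \<Phi> K L * (HS \<Psi> L J * v J)" by (rule heq_mult_left[OF HS[OF \<Psi> L J]])
    also have "\<dots> = HS \<Phi> K L * HS \<Psi> L J * v J" by (simp only: mult.assoc)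
    finally show "\<Phi> K L (\<Psi> L J (v J)) \<simeq> HS \<Phi> K L * HS \<Psi> L J * v J" .
  qed
  from rho_eqI[where \<Phi> = "scomp n \<Phi> \<Psi>" and H = "\<lambda>K J. \<Sum>L\<in>Iset n. HS \<Phi> K L * HS \<Psi> L J", OF this F]
  have "rho (scomp n \<Phi> \<Psi>) F = (\<lambda>K. if K \<in> Iset n then \<Sum>J\<in>Iset n. \<Sum>L\<in>Iset n. app (act n q (HS \<Phi> K L)) (app (act n q (HS \<Psi> L J)) (F J)) else 0)"
    by (simp only: act_sum act_mult app_sum app_simps)
  also have "\<dots> = (\<lambda>K. if K \<in> Iset n then \<Sum>L\<in>Iset n. \<Sum>J\<in>Iset n. app (act n q (HS \<Phi> K L)) (app (act n q (HS \<Psi> L J)) (F J)) else 0)"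
    by (intro ext if_cong refl sum.swap)
  also have "\<dots> = rho \<Phi> (rho \<Psi> F)"
    by (intro ext) (simp add: rho_HS app_sum_arg)
  finally show ?thesis .
qed

text \<open>Faithfulness: \<open>v J\<close> maps arbitrary Laurent polynomials to \<open>W_J\<close>-invariant ones, so the action
  on invariants determines \<open>h * v J\<close> in the faithful polynomial representation.\<close>

lemma rho_faithful:
  assumes \<Phi>: "\<Phi> \<in> Sset n q sq" and \<Psi>: "\<Psi> \<in> Sset n q sq" and eq: "\<And>F. F \<in> Pset n \<Longrightarrow> rho \<Phi> F = rho \<Psi> F"
  shows "seq n q sq \<Phi> \<Psi>"
  unfolding seq_def
proof (intro ballI)
  fix J K and x :: "'k falg" assume J: "J \<in> Iset n" and K: "K \<in> Iset n" and x: "x \<in> Mset n q sq J"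
  \<comment> \<open>A family concentrated at J isolates one matrix entry.\<close>
  have pick: "rho \<Theta> (\<lambda>L. if L = J then f else 0) K = app (act n q (HS \<Theta> K J)) f" for \<Theta> f
  proof -
    have "rho \<Theta> (\<lambda>L. if L = J then f else 0) K = (\<Sum>L\<in>Iset n. if L = J then app (act n q (HS \<Theta> K J)) f else 0)"
      unfolding rho_HS if_P[OF K] by (intro sum.cong refl) (simp add: app_zero)
    then show ?thesis using J finite_Iset by (simp add: sum.delta')
  qed
  have same: "app (act n q (HS \<Phi> K J)) f = app (act n q (HS \<Psi> K J)) f" if f: "f \<in> inv_J J" for f
  proof -
    have "(\<lambda>L. if L = J then f else 0) \<in> Pset n" unfolding Pset_iff using f J inv_J_0 by auto
    then show ?thesis using eq pick by metis
  qed
  have "HS \<Phi> K J * v J \<simeq> HS \<Psi> K J * v J"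
  proof (rule act_faithful)
    fix g assume g: "g \<in> LP"
    have "app (act n q (v J)) g \<in> inv_J J"
      unfolding inv_J_def mem_Collect_eq
    proof (intro conjI ballI)
      show "app (act n q (v J)) g \<in> LP" by (rule act_LP[OF g])
      fix j assume j: "j \<in> J"
      then have i: "1 \<le> j" "j < n" using J by (auto simp: Iset_iff)
      have "act n q (TG j * v J) = act n q (fsc Q * v J)" by (rule heq_imp_act_eq[OF T_v(1)[OF J j]])
      then have "app (act n q (TG j)) (app (act n q (v J)) g) = Lsc Q * app (act n q (v J)) g"
        by (simp only: act_mult act_fsc app_emul app_simps(6)[symmetric]) simp
      then show "permL (sw j) (app (act n q (v J)) g) = app (act n q (v J)) g"
        using act_T_invariant[OF i] by blast
    qed
    then show "app (act n q (HS \<Phi> K J * v J)) g = app (act n q (HS \<Psi> K J * v J)) g"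
      using same by (simp add: act_mult)
  qed
  then have e: "\<Phi> K J (v J) \<simeq> \<Psi> K J (v J)"
    using heq_trans[OF HS[OF \<Phi> K J]] heq_trans[OF _ heq_sym[OF HS[OF \<Psi> K J]]] by blast
  obtain h where h: "x \<simeq> v J * h" using x Mset_iff by blast
  have "\<Phi> K J x \<simeq> \<Phi> K J (v J) * h" by (rule hom_apply[OF Sset_hom[OF \<Phi> J K] h])
  also have "\<dots> \<simeq> \<Psi> K J (v J) * h" by (rule heq_mult_right[OF e])
  also have "\<dots> \<simeq> \<Psi> K J x" by (rule heq_sym[OF hom_apply[OF Sset_hom[OF \<Psi> J K] h]])
  finally show "\<Phi> K J x \<simeq> \<Psi> K J x" .
qed

lemma rho_bS:
  assumes J: "J \<in> Iset n" and K: "K \<in> Iset n" and d: "d \<in> Dset n K J" and F: "F \<in> Pset n"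
  shows "rho (bS n q sq K J d) F = (\<lambda>K'. if K' = K then
      (\<Sum>a\<in>Dleft n K (capd K d J). actF n q (fmul (Tw n q sq a) (Tw n q sq d)) (F J)) else 0)"
proof -
  define A where "A = (\<Sum>a\<in>Dleft n K (capd K d J). Tw n q sq a * Tw n q sq d)"
  let ?B = "\<Sum>x\<in>{wmul (wmul u d) w | u w. u \<in> WK K \<and> w \<in> WK J}. Tw n q sq x"
  have "act n q ?B = act n q (A * vT J)"
    unfolding A_def act_mult using J K d by (intro act_double_coset) (simp_all add: Iset_iff)
  then have "?B \<simeq> A * vT J" unfolding heq_iff_act .
  then have B: "?B \<simeq> A * v J" by (rule heq_trans[OF _ heq_mult_left[OF heq_sym[OF v_vT[OF J]]]])
  have "bS n q sq K J d K' J' (v J') \<simeq> (if K' = K \<and> J' = J then A else 0) * v J'" for K' J'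
  proof (cases "K' = K \<and> J' = J")
    case True
    \<comment> \<open>\<open>bS\<close> divides by \<open>v_J\<close> through an arbitrary choice,
      which for \<open>v_J\<close> itself need not be 1; it disappears because \<open>v_J h\<close>
      is congruent to \<open>v_J\<close>.\<close>
    define h where "h = (SOME h. v J \<simeq> v J * h)"
    have "v J \<simeq> v J * 1" by simp
    then have h: "v J \<simeq> v J * h" unfolding h_def by (rule someI)
    have "bS n q sq K J d K' J' (v J') = ?B * h" using True by (simp add: bS_def fmul_eq_times h_def)
    also have "\<dots> \<simeq> (A * v J) * h" by (rule heq_mult_right[OF B])
    also have "\<dots> = A * (v J * h)" by (rule mult.assoc)
    also have "\<dots> \<simeq> A * v J" by (rule heq_mult_left[OF heq_sym[OF h]])
    finally show ?thesis using True by simp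
  next
    case False
    then show ?thesis by (auto simp: bS_def)
  qed
  from rho_eqI[where \<Phi> = "bS n q sq K J d" and H = "\<lambda>K' J'. if K' = K \<and> J' = J then A else 0", OF this F]
  have "rho (bS n q sq K J d) F = (\<lambda>K'. if K' \<in> Iset n then \<Sum>J'\<in>Iset n. app (act n q (if K' = K \<and> J' = J then A else 0)) (F J') else 0)" .
  also have "\<dots> = (\<lambda>K'. if K' \<in> Iset n then \<Sum>J'\<in>Iset n. if J' = J then (if K' = K then app (act n q A) (F J) else 0) else 0 else 0)"
    by (intro ext if_cong sum.cong refl) simp
  also have "\<dots> = (\<lambda>K'. if K' = K then app (act n q A) (F J) else 0)"
    using J K finite_Iset by (auto simp: fun_eq_iff sum.delta')
  also have "app (act n q A) (F J) = (\<Sum>a\<in>Dleft n K (capd K d J). actF n q (fmul (Tw n q sq a) (Tw n q sq d)) (F J))"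
    by (simp add: A_def act_sum app_sum actF_eq_app fmul_eq_times)
  finally show ?thesis .
qed

end

theorem theorem4p8:
  fixes n q p e :: nat and sq :: "'k::field"
  assumes "prime p" and "e \<ge> 1" and "q = p ^ e" and "n \<ge> 2"
    and "\<forall>P :: 'k poly. Polynomial.degree P > 0 \<longrightarrow> (\<exists>x. poly P x = 0)"
    and "of_nat p \<noteq> (0::'k)" and "of_nat q \<noteq> (1::'k)"
    and "sq * sq = of_nat q"
  shows "\<exists>\<rho>. (\<forall>\<Phi>\<in>Sset n q sq. \<forall>F\<in>Pset n. \<rho> \<Phi> F \<in> Pset n)
      \<and> (\<forall>\<Phi>\<in>Sset n q sq. \<forall>F\<in>Pset n. \<forall>G\<in>Pset n. \<rho> \<Phi> (\<lambda>K. F K + G K) = (\<lambda>K. \<rho> \<Phi> F K + \<rho> \<Phi> G K))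
      \<and> (\<forall>\<Phi>\<in>Sset n q sq. \<forall>F\<in>Pset n. \<forall>c. \<rho> \<Phi> (\<lambda>K. Lsc c * F K) = (\<lambda>K. Lsc c * \<rho> \<Phi> F K))
      \<and> (\<forall>\<Phi>\<in>Sset n q sq. \<forall>\<Psi>\<in>Sset n q sq. seq n q sq \<Phi> \<Psi> \<longrightarrow> (\<forall>F\<in>Pset n. \<rho> \<Phi> F = \<rho> \<Psi> F))
      \<and> (\<forall>\<Phi>\<in>Sset n q sq. \<forall>\<Psi>\<in>Sset n q sq. \<forall>F\<in>Pset n.
            \<rho> (sadd \<Phi> \<Psi>) F = (\<lambda>K. \<rho> \<Phi> F K + \<rho> \<Psi> F K))
      \<and> (\<forall>\<Phi>\<in>Sset n q sq. \<forall>c. \<forall>F\<in>Pset n. \<rho> (ssc c \<Phi>) F = (\<lambda>K. Lsc c * \<rho> \<Phi> F K))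
      \<and> (\<forall>\<Phi>\<in>Sset n q sq. \<forall>\<Psi>\<in>Sset n q sq. \<forall>F\<in>Pset n. \<rho> (scomp n \<Phi> \<Psi>) F = \<rho> \<Phi> (\<rho> \<Psi> F))
      \<and> (\<forall>F\<in>Pset n. \<rho> sone F = F)
      \<and> (\<forall>\<Phi>\<in>Sset n q sq. \<forall>\<Psi>\<in>Sset n q sq. (\<forall>F\<in>Pset n. \<rho> \<Phi> F = \<rho> \<Psi> F) \<longrightarrow> seq n q sq \<Phi> \<Psi>)
      \<and> (\<forall>J\<in>Iset n. \<forall>K\<in>Iset n. \<forall>d\<in>Dset n K J. \<forall>F\<in>Pset n.
            \<rho> (bS n q sq K J d) F =
              (\<lambda>K'. if K' = K then
                       (\<Sum>a\<in>Dleft n K (capd K d J). actF n q (fmul (Tw n q sq a) (Tw n q sq d)) (F J))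
                     else 0))"
proof -
  have Q0: "of_nat q \<noteq> (0::'k)" using assms(3,6) by simp
  interpret hecke_full n q "of_nat q" sq
    by unfold_locales (use assms(4,8) Q0 in auto)
  show ?thesis
  proof (intro exI[of _ rho] conjI ballI allI impI)
    fix \<Phi> \<Psi> :: "nat set \<Rightarrow> nat set \<Rightarrow> 'k falg \<Rightarrow> 'k falg" and F G :: "nat set \<Rightarrow> 'k laurent" and c
    show "\<Phi> \<in> Sset n q sq \<Longrightarrow> F \<in> Pset n \<Longrightarrow> rho \<Phi> F \<in> Pset n" by (rule rho_Pset)
    show "rho \<Phi> (\<lambda>K. F K + G K) = (\<lambda>K. rho \<Phi> F K + rho \<Phi> G K)" by (rule rho_add)
    show "rho \<Phi> (\<lambda>K. Lsc c * F K) = (\<lambda>K. Lsc c * rho \<Phi> F K)" by (rule rho_scalar)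
    show "\<Phi> \<in> Sset n q sq \<Longrightarrow> \<Psi> \<in> Sset n q sq \<Longrightarrow> seq n q sq \<Phi> \<Psi> \<Longrightarrow> F \<in> Pset n \<Longrightarrow> rho \<Phi> F = rho \<Psi> F" by (rule rho_seq)
    show "\<Phi> \<in> Sset n q sq \<Longrightarrow> \<Psi> \<in> Sset n q sq \<Longrightarrow> F \<in> Pset n \<Longrightarrow> rho (sadd \<Phi> \<Psi>) F = (\<lambda>K. rho \<Phi> F K + rho \<Psi> F K)"
      by (rule rho_sadd)
    show "\<Phi> \<in> Sset n q sq \<Longrightarrow> F \<in> Pset n \<Longrightarrow> rho (ssc c \<Phi>) F = (\<lambda>K. Lsc c * rho \<Phi> F K)" by (rule rho_ssc)
    show "\<Phi> \<in> Sset n q sq \<Longrightarrow> \<Psi> \<in> Sset n q sq \<Longrightarrow> F \<in> Pset n \<Longrightarrow> rho (scomp n \<Phi> \<Psi>) F = rho \<Phi> (rho \<Psi> F)"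
      by (rule rho_scomp)
    show "F \<in> Pset n \<Longrightarrow> rho sone F = F" by (rule rho_sone)
    show "\<Phi> \<in> Sset n q sq \<Longrightarrow> \<Psi> \<in> Sset n q sq \<Longrightarrow> \<forall>F\<in>Pset n. rho \<Phi> F = rho \<Psi> F \<Longrightarrow> seq n q sq \<Phi> \<Psi>"
      by (rule rho_faithful) auto
  qed (rule rho_bS)
qed

end
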